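(* Let $\alpha\in(0,1)$ and $n\ge2$. The inclusion $BV^\alpha(\mathbb{R}^n)\subset B^\alpha_{1,\infty}(\mathbb{R}^n)$ is strict.
   Context: For $\alpha\in(0,1)$ set $\mu_{n,\alpha}:=2^{\alpha}\pi^{-\frac n2}\frac{\Gamma\left(\frac{n+\alpha+1}{2}\right)}{\Gamma\left(\frac{1-\alpha}{2}\right)}$ and, for $\varphi\in C^\infty_c(\mathbb{R}^n;\mathbb{R}^n)$, $$\mathrm{div}^\alpha\varphi(x):=\mu_{n,\alpha}\int_{\mathbb{R}^n}\frac{(y-x)\cdot(\varphi(y)-\varphi(x))}{|y-x|^{n+\alpha+1}}\,dy.$$ $BV^\alpha(\mathbb{R}^n)$ is the space of $f\in L^1(\mathbb{R}^n)$ such that $$|D^\alpha f|(\mathbb{R}^n):=\sup\left\{\int_{\mathbb{R}^n}f\,\mathrm{div}^\alpha\varphi\,dx:\varphi\in C^\infty_c(\mathbb{R}^n;\mathbb{R}^n),\ \|\varphi\|_{L^\infty}\le1\right\}<+\infty.$$ $B^\alpha_{1,\infty}(\mathbb{R}^n)$ is the Besov space of $f\in L^1(\mathbb{R}^n)$ such that $\sup_{h\in\mathbb{R}^n\setminus\{0\}}|h|^{-\alpha}\|f(\cdot+h)-f\|_{L^1(\mathbb{R}^n)}<+\infty$. *)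

theory Defs
  imports "HOL-Analysis.Analysis" "HOL-Probability.Essential_Supremum"
begin

text \<open>
  In finite dimension a map is \<open>C\<^sup>k\<^sup>+\<^sup>1\<close> iff it is differentiable everywhere and
  each of its directional derivatives is \<open>C\<^sup>k\<close>.
\<close>

primrec Ck :: "nat \<Rightarrow> ('a::euclidean_space \<Rightarrow> 'b::real_normed_vector) \<Rightarrow> bool" where
  "Ck 0 f \<longleftrightarrow> continuous_on UNIV f"
| "Ck (Suc k) f \<longleftrightarrow>
     (\<forall>x. f differentiable (at x)) \<and> (\<forall>v. Ck k (\<lambda>x. frechet_derivative f (at x) v))"

definition Cc_infinity :: "('a::euclidean_space \<Rightarrow> 'b::real_normed_vector) set" where
  "Cc_infinity = {\<phi>. (\<forall>k. Ck k \<phi>) \<and> compact (closure {x. \<phi> x \<noteq> 0})}"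

text \<open>
  Elements of \<open>L\<^sup>1\<close> are represented by functions rather than by classes modulo
  almost-everywhere equality. Both spaces \<open>BV_frac\<close> and \<open>besov_1_infty\<close> below are
  closed under almost-everywhere equality, so inclusion and strictness mean the same
  for functions as for classes.
\<close>

definition L1 :: "('a::euclidean_space \<Rightarrow> real) set" where
  "L1 = {f. integrable lebesgue f}"

definition L1_norm :: "('a::euclidean_space \<Rightarrow> real) \<Rightarrow> real" where
  "L1_norm f = (\<integral>x. \<bar>f x\<bar> \<partial>lebesgue)"

definition Linf_norm :: "('a::euclidean_space \<Rightarrow> 'b::real_normed_vector) \<Rightarrow> ereal" where
  "Linf_norm \<phi> = esssup lebesgue (\<lambda>x. ereal (norm (\<phi> x)))"

definition mu_frac :: "nat \<Rightarrow> real \<Rightarrow> real" where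
  "mu_frac n \<alpha> =
     2 powr \<alpha> * pi powr (- (real n / 2)) * (Gamma ((real n + \<alpha> + 1) / 2) / Gamma ((1 - \<alpha>) / 2))"

text \<open>
  The integral converges absolutely for \<open>\<phi> \<in> Cc_infinity\<close> and \<open>0 < \<alpha> < 1\<close>: the integrand
  is at most of order \<open>norm (y - x) powr (1 - n - \<alpha>)\<close> near \<open>x\<close> and \<open>norm (y - x) powr (- n - \<alpha>)\<close>
  at infinity. At \<open>y = x\<close> it has the value \<open>0\<close> by the convention for division by zero.
\<close>

definition div_frac :: "real \<Rightarrow> (real ^ 'n \<Rightarrow> real ^ 'n) \<Rightarrow> real ^ 'n \<Rightarrow> real" where
  "div_frac \<alpha> \<phi> x =
     mu_frac CARD('n) \<alpha> *
     (\<integral>y. ((y - x) \<bullet> (\<phi> y - \<phi> x)) / norm (y - x) powr (real CARD('n) + \<alpha> + 1) \<partial>lebesgue)"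

definition frac_variation :: "real \<Rightarrow> (real ^ 'n \<Rightarrow> real) \<Rightarrow> ereal" where
  "frac_variation \<alpha> f =
     (SUP \<phi> \<in> {\<phi> \<in> Cc_infinity. Linf_norm \<phi> \<le> 1}.
        ereal (\<integral>x. f x * div_frac \<alpha> \<phi> x \<partial>lebesgue))"

definition BV_frac :: "real \<Rightarrow> (real ^ 'n \<Rightarrow> real) set" where
  "BV_frac \<alpha> = {f \<in> L1. frac_variation \<alpha> f < \<infinity>}"

definition besov_1_infty :: "real \<Rightarrow> (real ^ 'n \<Rightarrow> real) set" where
  "besov_1_infty \<alpha> =
     {f \<in> L1. (SUP h \<in> UNIV - {0}.
        ereal (norm h powr (- \<alpha>) * L1_norm (\<lambda>x. f (x + h) - f x))) < \<infinity>}"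

end

theory Submission
  imports Defs "HOL-Probability.Distributions" "HOL-Real_Asymp.Real_Asymp"
begin

text \<open>
  Both kernels involved are superpositions of Gaussians over all scales: up to constants,
  \<open>u/|u|\<^sup>n\<^sup>+\<^sup>\<alpha>\<^sup>+\<^sup>1\<close> is the integral of \<open>t\<^sup>-\<^sup>\<alpha>\<^sup>-\<^sup>1 t\<^sup>-\<^sup>n (u/t) exp(-|u/t|\<^sup>2) dt\<close>, and replacing \<open>-\<alpha>\<close> by
  \<open>\<alpha>\<close> gives the Riesz-type kernel \<open>K(u) = u/|u|\<^sup>n\<^sup>+\<^sup>1\<^sup>-\<^sup>\<alpha>\<close>. Rotation invariance of the Gaussian on
  \<open>\<real>\<^sup>n \<times> \<real>\<^sup>n\<close> and the heat equation then show that \<open>div\<^sup>\<alpha> (K * g)\<close> is a multiple of \<open>g\<close>.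

  Inclusion: by duality the \<open>L\<^sup>1\<close> norm of \<open>f(\<cdot> + h) - f\<close> is a supremum of integrals of \<open>f g\<close>
  with \<open>g = \<psi>(\<cdot> - h) - \<psi>\<close> and \<open>|\<psi>| \<le> 1\<close>; writing \<open>g\<close> as a fractional divergence of \<open>K * g\<close>, the
  claim follows from \<open>|K * g| \<le> C |h|\<^sup>\<alpha>\<close>, a bound on Gaussian translates at each scale.

  Strictness: a truncation \<open>f\<close> of \<open>|x|\<^sup>\<alpha>\<^sup>-\<^sup>n\<close> lies in the Besov space. For a radial field
  \<open>\<phi>(x) = \<eta>(x) x\<close> with \<open>\<eta> \<ge> 0\<close>, the pairing of \<open>f\<close> with \<open>div\<^sup>\<alpha> \<phi>(2\<^sup>k \<cdot>)\<close> is bounded below by a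
  positive number independent of \<open>k\<close>, whereas the sums of these fields over \<open>k < m\<close> stay bounded
  by \<open>2\<close> for all \<open>m\<close>.
\<close>

section \<open>Smooth functions\<close>

text \<open>Estimates are made at one scale t and then integrated against a power weight;
  \<open>min 1 t\<close> and \<open>min 1 (1 / t)\<close> are the model majorants, and 0 < \<alpha>
  < 1 makes both ends integrable. Polar coordinates and Fourier transforms are avoided, and
  constants such as the Gaussian mass are never evaluated, only shown positive.

  The inversion rests on one fact: averages at scales s and t combine into an average at scale sqrt
  (s^2 + t^2). Substituting s = t v splits the double scale integral into a constant and the
  integral of a logarithmic scale derivative, which telescopes to a multiple of g x.

  The obstacle in the inclusion is that K * g need not have compact support and so is no admissible
  test field. Truncating both the scales and the Gaussian vectors gives admissible fields; the error
  is small in sup norm and in Lipschitz constant, and these two together control the fractional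
  divergence uniformly.

  For strictness, the exponent of f is critical: the factor gained by the divergence of a dilated
  field is undone by the homogeneity of f, so every dyadic dilation contributes a fixed
  amount.\<close>

lemma Ck_mono: "Ck (Suc k) f \<Longrightarrow> Ck k f"
proof (induction k arbitrary: f)
  case 0
  then show ?case
    by (auto intro!: differentiable_imp_continuous_on simp: differentiable_on_def
        intro: differentiable_at_withinI)
next
  case (Suc k)
  then show ?case by (metis Ck.simps(2))
qed

lemma Ck_differentiable: "Ck (Suc k) f \<Longrightarrow> (f has_derivative frechet_derivative f (at x)) (at x)"
  by (simp add: frechet_derivative_works)

lemma Ck_SucI:
  assumes "\<And>x. (f has_derivative f' x) (at x)" and "\<And>v. Ck k (\<lambda>x. f' x v)"
  shows "Ck (Suc k) f"
proof -
  have "frechet_derivative f (at x) = f' x" for x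
    using assms(1)[of x] by (metis frechet_derivative_at)
  then show ?thesis
    using assms by (auto simp: differentiable_def)
qed

lemma Ck_const: "Ck k (\<lambda>x. c)"
proof (induction k arbitrary: c)
  case (Suc k)
  show ?case by (rule Ck_SucI[where f'="\<lambda>_ _. 0"]) (auto intro: Suc)
qed auto

lemma Ck_bounded_linear:
  assumes "bounded_linear f" shows "Ck k f"
proof (cases k)
  case 0
  then show ?thesis using assms by (simp add: linear_continuous_on)
next
  case (Suc m)
  show ?thesis unfolding Suc
    by (rule Ck_SucI[where f'="\<lambda>_. f"])
      (auto intro: bounded_linear_imp_has_derivative assms Ck_const)
qed

lemma Ck_add: "Ck k f \<Longrightarrow> Ck k g \<Longrightarrow> Ck k (\<lambda>x. f x + g x)"
proof (induction k arbitrary: f g)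
  case 0
  then show ?case by (auto intro: continuous_intros)
next
  case (Suc k)
  show ?case
    by (rule Ck_SucI, rule has_derivative_add, (rule Ck_differentiable, rule Suc)+)
      (use Suc in auto)
qed

lemma Ck_scaleR: "Ck k f \<Longrightarrow> Ck k g \<Longrightarrow> Ck k (\<lambda>x. f x *\<^sub>R g x)"
proof (induction k arbitrary: f g)
  case 0
  then show ?case by (auto intro: continuous_intros)
next
  case (Suc k)
  show ?case
    by (rule Ck_SucI, rule has_derivative_scaleR, (rule Ck_differentiable, rule Suc)+)
      (use Suc.prems in \<open>auto intro!: Ck_add Suc.IH Ck_mono[OF Suc.prems(1)] Ck_mono[OF Suc.prems(2)]\<close>)
qed

lemma Ck_affine:
  fixes f :: "'a::euclidean_space \<Rightarrow> 'b::real_normed_vector"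
  shows "Ck k f \<Longrightarrow> Ck k (\<lambda>x. f (a + c *\<^sub>R x))"
proof (induction k arbitrary: f)
  case 0
  then have "continuous_on UNIV f" by simp
  then show ?case
    by (auto intro!: continuous_intros continuous_on_compose2[of UNIV f])
next
  case (Suc k)
  have "((\<lambda>x. f (a + c *\<^sub>R x)) has_derivative
      (\<lambda>v. frechet_derivative f (at (a + c *\<^sub>R x)) (c *\<^sub>R v))) (at x)" for x
    by (rule has_derivative_compose[where g=f])
      (auto intro!: derivative_eq_intros Ck_differentiable Suc)
  then show ?case
    by (rule Ck_SucI) (use Suc in auto)
qed

text \<open>The functions \<open>bump_aux j\<close> are closed under derivatives up to sums, so no polynomials are needed.\<close>

definition bump_aux :: "nat \<Rightarrow> real \<Rightarrow> real" where
  "bump_aux j t = (if t > 0 then exp (- (1 / t)) / t ^ j else 0)"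

lemma bump_aux_tendsto_0: "((\<lambda>t::real. exp (- (1 / t)) / t ^ j) \<longlongrightarrow> 0) (at_right 0)"
  by real_asymp

lemma has_real_derivative_bump_aux:
  "(bump_aux j has_real_derivative (bump_aux (j+2) t - of_nat j * bump_aux (j+1) t)) (at t)"
proof -
  consider "t > 0" | "t < 0" | "t = 0" by linarith
  then show ?thesis
  proof cases
    case 1
    have "((\<lambda>t. exp (- (1 / t)) / t ^ j) has_real_derivative (bump_aux (j+2) t - of_nat j * bump_aux (j+1) t)) (at t)"
      using 1 by (auto intro!: derivative_eq_intros simp: bump_aux_def)
        (cases j; auto simp: field_simps power2_eq_square)
    then show ?thesis
      by (rule has_field_derivative_transform_within[of _ _ _ _ t]) (use 1 in \<open>auto simp: bump_aux_def dist_real_def\<close>)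
  next
    case 2
    have "((\<lambda>t. 0) has_real_derivative (bump_aux (j+2) t - of_nat j * bump_aux (j+1) t)) (at t)"
      using 2 by (auto simp: bump_aux_def)
    then show ?thesis
      by (rule has_field_derivative_transform_within[of _ _ _ _ "-t"]) (use 2 in \<open>auto simp: bump_aux_def dist_real_def\<close>)
  next
    case 3
    \<comment> \<open>At 0 the right difference quotient of \<open>bump_aux j\<close> is
      \<open>bump_aux (Suc j)\<close>, so its limit is the decay of exp (-1/t) against powers of t;
      the left one vanishes identically.\<close>
    have "((\<lambda>h. bump_aux j h / h) \<longlongrightarrow> 0) (at_right 0)"
      by (rule Lim_transform_eventually[OF bump_aux_tendsto_0[of "Suc j"]])
        (auto simp: bump_aux_def eventually_at_right_less eventually_at_filter field_simps)
    moreover have "((\<lambda>h. bump_aux j h / h) \<longlongrightarrow> 0) (at_left 0)"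
      by (rule Lim_transform_eventually[OF tendsto_const])
        (auto simp: bump_aux_def eventually_at_filter)
    ultimately have "((\<lambda>h. bump_aux j h / h) \<longlongrightarrow> 0) (at 0)"
      by (simp add: filterlim_split_at)
    then show ?thesis
      by (simp add: 3 has_field_derivative_iff bump_aux_def)
  qed
qed

lemma Ck_bump_aux_comp: "(\<And>j. Ck j q) \<Longrightarrow> Ck k (\<lambda>x. bump_aux j (q x))"
proof (induction k arbitrary: j)
  case 0
  have "continuous_on UNIV (bump_aux j)"
    using has_real_derivative_bump_aux by (meson DERIV_continuous continuous_at_imp_continuous_on)
  then show ?case
    using 0[of 0] by (auto intro!: continuous_on_compose2[of UNIV "bump_aux j"])
next
  case (Suc k)
  have "((\<lambda>x. bump_aux j (q x)) has_derivative
     (\<lambda>v. frechet_derivative q (at x) v * (bump_aux (j+2) (q x) - of_nat j * bump_aux (j+1) (q x)))) (at x)" for x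
    using has_derivative_compose[OF Ck_differentiable[OF Suc(2)[of "Suc 0"], of x]
        has_real_derivative_bump_aux[of j "q x", unfolded has_field_derivative_def]]
    by (simp add: mult.commute)
  then show ?case
  proof (rule Ck_SucI)
    fix v
    have "Ck k (\<lambda>x. frechet_derivative q (at x) v)" using Suc(2)[of "Suc k"] by simp
    moreover have "Ck k (\<lambda>x. bump_aux (j+2) (q x) + (- of_nat j) *\<^sub>R bump_aux (j+1) (q x))"
      by (intro Ck_add Ck_scaleR Ck_const Suc)
    ultimately show "Ck k (\<lambda>x. frechet_derivative q (at x) v *
        (bump_aux (j+2) (q x) - of_nat j * bump_aux (j+1) (q x)))"
      using Ck_scaleR by fastforce
  qed
qed

text \<open>The classical bump exp (-1 / (1 - |x|^2)) on the unit ball. Using the inner product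
  instead of the norm makes the inner function a polynomial, smooth at the origin as well.\<close>

definition bump :: "'a::euclidean_space \<Rightarrow> real" where
  "bump x = bump_aux 0 (1 - x \<bullet> x)"

lemma Ck_bump: "Ck k (bump :: 'a::euclidean_space \<Rightarrow> real)"
proof -
  have "Ck j (\<lambda>x::'a. 1 - x \<bullet> x)" for j
  proof (cases j)
    case (Suc m)
    have "((\<lambda>x::'a. 1 - x \<bullet> x) has_derivative (\<lambda>v. - 2 * (x \<bullet> v))) (at x)" for x
      by (auto intro!: derivative_eq_intros simp: inner_commute)
    then show ?thesis unfolding Suc
      by (rule Ck_SucI) (intro Ck_bounded_linear bounded_linear_intros)
  qed (auto intro!: continuous_intros)
  then show ?thesis
    unfolding bump_def by (rule Ck_bump_aux_comp)
qed

lemma bump_nonneg: "0 \<le> bump x"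
  by (simp add: bump_def bump_aux_def)

lemma bump_pos_iff: "0 < bump x \<longleftrightarrow> norm x < 1"
  by (simp add: bump_def bump_aux_def dot_square_norm power_less_one_iff abs_square_less_1)

lemma bump_eq_0: "norm x \<ge> 1 \<Longrightarrow> bump x = 0"
  using bump_nonneg[of x] bump_pos_iff[of x] by linarith

subsection \<open>Compactly supported smooth functions\<close>

lemma Cc_infinityI:
  assumes "\<And>k. Ck k f" and "\<And>x. r < norm x \<Longrightarrow> f x = 0"
  shows "f \<in> Cc_infinity"
proof -
  have "{x. f x \<noteq> 0} \<subseteq> cball 0 r"
    using assms(2) by (force simp: not_le[symmetric])
  then have "compact (closure {x. f x \<noteq> 0})"
    by (meson bounded_cball bounded_subset compact_closure)
  then show ?thesis using assms(1) by (simp add: Cc_infinity_def)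
qed

lemma Cc_infinity_Ck: "f \<in> Cc_infinity \<Longrightarrow> Ck k f"
  by (simp add: Cc_infinity_def)

lemma Cc_infinity_supportE:
  assumes "f \<in> Cc_infinity"
  obtains r where "\<forall>x. r < norm x \<longrightarrow> f x = 0"
proof -
  have "bounded {x. f x \<noteq> 0}"
    using assms by (auto simp: Cc_infinity_def dest!: compact_imp_bounded intro: bounded_subset[OF _ closure_subset])
  then obtain r where "r > 0" "\<And>x. f x \<noteq> 0 \<Longrightarrow> norm x \<le> r"
    unfolding bounded_pos by auto
  then have "\<forall>x. r < norm x \<longrightarrow> f x = 0" by force
  then show ?thesis using that by blast
qed

lemma Cc_infinity_has_derivative:
  "f \<in> Cc_infinity \<Longrightarrow> (f has_derivative frechet_derivative f (at x)) (at x)"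
  using Ck_differentiable Cc_infinity_Ck by blast

lemma Cc_infinity_continuous: "f \<in> Cc_infinity \<Longrightarrow> continuous_on A f"
  using Cc_infinity_Ck[of f 0] continuous_on_subset by auto

lemma Cc_infinity_frechet_derivative:
  assumes "f \<in> Cc_infinity" shows "(\<lambda>x. frechet_derivative f (at x) v) \<in> Cc_infinity"
proof -
  obtain r where r: "\<forall>x. r < norm x \<longrightarrow> f x = 0" by (rule Cc_infinity_supportE[OF assms])
  show ?thesis
  proof (rule Cc_infinityI[where r=r])
    show "Ck k (\<lambda>x. frechet_derivative f (at x) v)" for k
      using Cc_infinity_Ck[OF assms, of "Suc k"] by simp
    fix x :: 'a assume "r < norm x"
    then have "((\<lambda>x. 0) has_derivative frechet_derivative f (at x)) (at x)"
      by (intro has_derivative_transform_within_open[OF Cc_infinity_has_derivative[OF assms], where s="- cball 0 r"])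
        (auto simp: r)
    then show "frechet_derivative f (at x) v = 0"
      by (metis frechet_derivative_at frechet_derivative_const)
  qed
qed

lemma Cc_infinity_affine:
  fixes f :: "'a::euclidean_space \<Rightarrow> 'b::real_normed_vector"
  assumes "f \<in> Cc_infinity" and "c \<noteq> 0" shows "(\<lambda>x. f (a + c *\<^sub>R x)) \<in> Cc_infinity"
proof -
  obtain r where r: "\<forall>x. r < norm x \<longrightarrow> f x = 0" by (rule Cc_infinity_supportE[OF assms(1)])
  show ?thesis
  proof (rule Cc_infinityI[where r="(norm a + r) / \<bar>c\<bar>"])
    fix x :: 'a assume "(norm a + r) / \<bar>c\<bar> < norm x"
    then have "norm a + r < norm (c *\<^sub>R x)" using assms(2) by (simp add: field_simps)
    then have "r < norm (a + c *\<^sub>R x)"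
      using norm_triangle_ineq4[of "a + c *\<^sub>R x" a] by simp
    then show "f (a + c *\<^sub>R x) = 0" by (simp add: r)
  qed (intro Ck_affine Cc_infinity_Ck assms)
qed

lemma Cc_infinity_add:
  assumes "f \<in> Cc_infinity" "g \<in> Cc_infinity" shows "(\<lambda>x. f x + g x) \<in> Cc_infinity"
proof -
  obtain r where r: "\<forall>x. r < norm x \<longrightarrow> f x = 0" by (rule Cc_infinity_supportE[OF assms(1)])
  obtain s where s: "\<forall>x. s < norm x \<longrightarrow> g x = 0" by (rule Cc_infinity_supportE[OF assms(2)])
  show ?thesis
    by (rule Cc_infinityI[where r="max r s"]) (use r s in \<open>auto intro!: Ck_add simp: Cc_infinity_Ck assms\<close>)
qed

lemma Cc_infinity_scaleR_left:
  assumes "f \<in> Cc_infinity" "\<And>k. Ck k g" shows "(\<lambda>x. f x *\<^sub>R g x) \<in> Cc_infinity"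
proof -
  obtain r where "\<forall>x. r < norm x \<longrightarrow> f x = 0"
    by (rule Cc_infinity_supportE[OF assms(1)])
  then show ?thesis
    by - (rule Cc_infinityI[where r=r], auto intro!: Ck_scaleR simp: Cc_infinity_Ck assms)
qed

lemma Cc_infinity_scaleR:
  assumes "f \<in> Cc_infinity" shows "(\<lambda>x. c *\<^sub>R f x) \<in> Cc_infinity"
proof -
  obtain r where "\<forall>x. r < norm x \<longrightarrow> f x = 0"
    by (rule Cc_infinity_supportE[OF assms])
  then show ?thesis
    by - (rule Cc_infinityI[where r=r], auto intro!: Ck_scaleR Ck_const simp: Cc_infinity_Ck assms)
qed

lemma Cc_infinity_sum:
  "finite A \<Longrightarrow> (\<And>i. i \<in> A \<Longrightarrow> f i \<in> Cc_infinity) \<Longrightarrow> (\<lambda>x. \<Sum>i\<in>A. f i x) \<in> Cc_infinity"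
proof (induction A rule: finite_induct)
  case empty
  then show ?case by (auto intro!: Cc_infinityI Ck_const)
qed (auto intro: Cc_infinity_add)

lemma bump_Cc_infinity: "bump \<in> Cc_infinity"
  by (rule Cc_infinityI[where r=1]) (auto intro: Ck_bump bump_eq_0)

lemma continuous_vanishing_imp_bounded:
  fixes f :: "'a::euclidean_space \<Rightarrow> 'b::real_normed_vector"
  assumes "continuous_on UNIV f" and "\<forall>x. r < norm x \<longrightarrow> f x = 0"
  obtains B where "B > 0" and "\<forall>x. norm (f x) \<le> B"
proof -
  have "compact (f ` cball 0 r)"
    using assms(1) by (meson compact_cball compact_continuous_image continuous_on_subset subset_UNIV)
  then obtain B where B: "B > 0" "\<And>x. x \<in> cball 0 r \<Longrightarrow> norm (f x) \<le> B"
    using compact_imp_bounded[of "f ` cball 0 r"] unfolding bounded_pos by blast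
  have "norm (f x) \<le> B" for x
    using B assms(2) by (cases "norm x \<le> r") auto
  then show ?thesis using that B by blast
qed

lemma Cc_infinity_boundedE:
  assumes "f \<in> Cc_infinity"
  obtains B where "B > 0" and "\<forall>x. norm (f x) \<le> B"
proof -
  obtain r where "\<forall>x. r < norm x \<longrightarrow> f x = 0" by (rule Cc_infinity_supportE[OF assms])
  then show ?thesis
    by (rule continuous_vanishing_imp_bounded[OF Cc_infinity_continuous[OF assms]]) (rule that)
qed

text \<open>Crude in the constant but sufficient: only finiteness of Lipschitz constants matters, so
  bounds along \<open>Basis\<close> can stand in for the operator norm.\<close>

lemma norm_linear_le_sum_Basis:
  fixes f :: "'a::euclidean_space \<Rightarrow> 'b::real_normed_vector"
  assumes "linear f" and "\<And>b. b \<in> Basis \<Longrightarrow> norm (f b) \<le> B"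
  shows "norm (f v) \<le> real DIM('a) * B * norm v"
proof -
  have "f v = f (\<Sum>b\<in>Basis. (v \<bullet> b) *\<^sub>R b)" by (simp add: euclidean_representation)
  also have "\<dots> = (\<Sum>b\<in>Basis. (v \<bullet> b) *\<^sub>R f b)"
    using assms(1) by (simp add: linear_sum linear_scale)
  also have "norm \<dots> \<le> (\<Sum>b\<in>(Basis::'a set). norm v * B)"
  proof (rule sum_norm_le)
    fix b :: 'a assume b: "b \<in> Basis"
    have "norm ((v \<bullet> b) *\<^sub>R f b) = \<bar>v \<bullet> b\<bar> * norm (f b)" by simp
    also have "\<dots> \<le> norm v * B"
      using Basis_le_norm[OF b, of v] assms(2)[OF b] by (intro mult_mono) auto
    finally show "norm ((v \<bullet> b) *\<^sub>R f b) \<le> norm v * B" .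
  qed
  finally show ?thesis by (simp add: mult_ac)
qed

text \<open>Directional derivatives of a test function are again test functions, hence bounded; the
  mean value inequality does the rest.\<close>

lemma Cc_infinity_lipschitzE:
  fixes f :: "'a::euclidean_space \<Rightarrow> 'b::real_normed_vector"
  assumes "f \<in> Cc_infinity"
  obtains L where "L > 0" and "\<forall>x y. norm (f x - f y) \<le> L * norm (x - y)"
proof -
  have "\<exists>B>0. \<forall>x. norm (frechet_derivative f (at x) b) \<le> B" for b
    by (rule Cc_infinity_boundedE[OF Cc_infinity_frechet_derivative[OF assms, of b]]) blast
  then obtain B where B: "\<And>b. B b > 0" "\<And>b x. norm (frechet_derivative f (at x) b) \<le> B b"
    by metis
  define M where "M = (\<Sum>b\<in>(Basis::'a set). B b)"
  have M: "norm (frechet_derivative f (at x) b) \<le> M" if "b \<in> Basis" for x b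
  proof -
    have "B b \<le> M"
      unfolding M_def using B(1) that by (intro member_le_sum) (auto simp: less_imp_le)
    then show ?thesis using B(2)[of x b] by linarith
  qed
  have Mpos: "M > 0"
    unfolding M_def using B(1) by (intro sum_pos) auto
  show ?thesis
  proof (rule that)
    show "real DIM('a) * M > 0" using Mpos by simp
    show "\<forall>x y. norm (f x - f y) \<le> real DIM('a) * M * norm (x - y)"
    proof (intro allI)
      fix x y
      show "norm (f x - f y) \<le> real DIM('a) * M * norm (x - y)"
      proof (rule differentiable_bound[where S=UNIV and f'="\<lambda>x. frechet_derivative f (at x)"])
        fix z show "(f has_derivative frechet_derivative f (at z)) (at z)"
          by (rule Cc_infinity_has_derivative[OF assms])
        then have "linear (frechet_derivative f (at z))"
          using has_derivative_linear by blast
        then show "onorm (frechet_derivative f (at z)) \<le> real DIM('a) * M"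
          by (intro onorm_le norm_linear_le_sum_Basis M) auto
      qed auto
    qed
  qed
qed

lemma Cc_infinity_borel:
  fixes f :: "'a::euclidean_space \<Rightarrow> 'b::real_normed_vector"
  shows "f \<in> Cc_infinity \<Longrightarrow> f \<in> borel_measurable borel"
  using Cc_infinity_continuous borel_measurable_continuous_onI by blast

lemma Cc_infinity_integrable:
  fixes f :: "'a::euclidean_space \<Rightarrow> 'b::{banach,second_countable_topology}"
  assumes "f \<in> Cc_infinity" shows "integrable lborel f"
proof -
  obtain r where r: "\<forall>x. r < norm x \<longrightarrow> f x = 0" by (rule Cc_infinity_supportE[OF assms])
  have "integrable lborel (\<lambda>x. indicator (cball 0 r) x *\<^sub>R f x)"
    using Cc_infinity_continuous[OF assms] by (intro borel_integrable_compact) auto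
  also have "(\<lambda>x. indicator (cball 0 r) x *\<^sub>R f x) = f"
    using r by (force simp: indicator_def)
  finally show ?thesis .
qed

text \<open>The derivative is itself Lipschitz, so the linearization error is small uniformly in the
  base point \<open>y\<close>. This uniformity permits differentiation under an integral over
  arbitrary shifts.\<close>

lemma Cc_infinity_uniformly_differentiable:
  fixes g :: "'a::euclidean_space \<Rightarrow> real"
  assumes "g \<in> Cc_infinity" and "e > 0"
  obtains d where "d > 0"
    and "\<And>y v. norm v < d \<Longrightarrow> norm (g (y + v) - g y - frechet_derivative g (at y) v) \<le> e * norm v"
proof -
  define e' where "e' = e / real DIM('a)"
  have "\<exists>L>0. \<forall>x y. norm (frechet_derivative g (at x) b - frechet_derivative g (at y) b) \<le> L * norm (x - y)" for b
    by (rule Cc_infinity_lipschitzE[OF Cc_infinity_frechet_derivative[OF assms(1), of b]]) blast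
  then obtain L where L: "\<And>b. L b > 0"
    "\<And>b x y. norm (frechet_derivative g (at x) b - frechet_derivative g (at y) b) \<le> L b * norm (x - y)"
    by metis
  define M where "M = (\<Sum>b\<in>(Basis::'a set). L b)"
  have Mpos: "M > 0"
    unfolding M_def using L(1) by (intro sum_pos) auto
  have LM: "L b \<le> M" if "b \<in> Basis" for b
    unfolding M_def using L(1) that by (intro member_le_sum) (auto simp: less_imp_le)
  have lin: "linear (frechet_derivative g (at z))" for z
    using Cc_infinity_has_derivative[OF assms(1)] has_derivative_linear by blast
  \<comment> \<open>Chosen so that \<open>real DIM('a) * (M * d)\<close>, the bound for the change
    of the derivative on a ball of radius \<open>d\<close>, equals \<open>e\<close>.\<close>
  define d where "d = e / (real DIM('a) * M)"
  have "d > 0" using assms(2) Mpos by (simp add: d_def)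
  show ?thesis
  proof (rule that[OF \<open>d > 0\<close>])
    fix y v :: 'a assume v: "norm v < d"
    have "norm (g (y + v) - g y - frechet_derivative g (at y) (y + v - y)) \<le> norm (y + v - y) * e"
    proof (rule differentiable_bound_linearization[where f'="\<lambda>z. frechet_derivative g (at z)" and S="ball y d"])
      fix t :: real assume t: "t \<in> {0..1}"
      then have "\<bar>t\<bar> * norm v \<le> 1 * norm v" by (intro mult_right_mono) auto
      then show "y + t *\<^sub>R (y + v - y) \<in> ball y d" using v by (simp add: dist_norm)
    next
      fix z assume z: "z \<in> ball y d"
      have "norm (frechet_derivative g (at z) w - frechet_derivative g (at y) w)
          \<le> real DIM('a) * (M * d) * norm w" for w
      proof (rule norm_linear_le_sum_Basis[where f="\<lambda>w. frechet_derivative g (at z) w - frechet_derivative g (at y) w"])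
        show "linear (\<lambda>w. frechet_derivative g (at z) w - frechet_derivative g (at y) w)"
          using lin by (intro linear_compose_sub)
        fix b :: 'a assume b: "b \<in> Basis"
        have "norm (frechet_derivative g (at z) b - frechet_derivative g (at y) b) \<le> L b * norm (z - y)"
          by (rule L)
        also have "\<dots> \<le> M * d"
          using LM[OF b] z L(1)[of b] Mpos by (intro mult_mono) (auto simp: dist_norm norm_minus_commute)
        finally show "norm (frechet_derivative g (at z) b - frechet_derivative g (at y) b) \<le> M * d" .
      qed
      then have "norm (frechet_derivative g (at z) w - frechet_derivative g (at y) w) \<le> e * norm w" for w
        using Mpos by (simp add: d_def field_simps)
      then show "onorm (frechet_derivative g (at z) - frechet_derivative g (at y)) \<le> e"
        by (intro onorm_le) simp
    qed (use \<open>d > 0\<close> in \<open>auto intro: has_derivative_at_withinI Cc_infinity_has_derivative[OF assms(1)]\<close>)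
    then show "norm (g (y + v) - g y - frechet_derivative g (at y) v) \<le> e * norm v"
      by (simp add: mult.commute)
  qed
qed

section \<open>Differentiation under the integral sign\<close>

lemma norm_integral_le_integral:
  fixes f :: "'w \<Rightarrow> 'b::{banach,second_countable_topology}"
  assumes "integrable M f" "integrable M g" "\<And>x. norm (f x) \<le> g x"
  shows "norm (\<integral>x. f x \<partial>M) \<le> (\<integral>x. g x \<partial>M)"
  by (rule order_trans[OF integral_norm_bound integral_mono]) (use assms in auto)

text \<open>The uniform linearization error is integrated against the finite mass of
  \<open>m\<close>, so no convergence theorem is needed. The derivative has the same form with a
  directional derivative in place of \<open>g\<close>, which drives the induction. The general
  measure \<open>M\<close> lets the lemma serve both mollification and truncated Riesz
  potentials.\<close>

lemma Ck_superposition: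
  fixes g :: "'a::euclidean_space \<Rightarrow> real" and m :: "'w \<Rightarrow> 'b::euclidean_space"
  assumes m: "integrable M m" and z [measurable]: "z \<in> borel_measurable M"
  shows "g \<in> Cc_infinity \<Longrightarrow> Ck k (\<lambda>x. \<integral>w. g (x + z w) *\<^sub>R m w \<partial>M)"
proof (induction k arbitrary: g)
  have [measurable]: "m \<in> borel_measurable M" using m by simp
  have int: "integrable M (\<lambda>w. g (x + z w) *\<^sub>R m w)" if g: "g \<in> Cc_infinity" for g :: "'a \<Rightarrow> real" and x
  proof -
    note [measurable] = Cc_infinity_borel[OF g]
    obtain B where "B > 0" and B: "\<forall>x. norm (g x) \<le> B" by (rule Cc_infinity_boundedE[OF g])
    show ?thesis
      by (rule Bochner_Integration.integrable_bound[of _ "\<lambda>w. B *\<^sub>R m w"])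
        (use m B \<open>B > 0\<close> in \<open>auto intro!: mult_right_mono\<close>)
  qed
  let ?I = "\<lambda>g x. \<integral>w. g (x + z w) *\<^sub>R m w \<partial>M"
  have der: "(?I g has_derivative (\<lambda>v. ?I (\<lambda>y. frechet_derivative g (at y) v) x)) (at x)"
    if g: "g \<in> Cc_infinity" for g :: "'a \<Rightarrow> real" and x
  proof -
    let ?D = "\<lambda>v. ?I (\<lambda>y. frechet_derivative g (at y) v) x"
    have lin: "linear (frechet_derivative g (at y))" for y
      using Cc_infinity_has_derivative[OF g] has_derivative_linear by blast
    have intD: "integrable M (\<lambda>w. frechet_derivative g (at (x + z w)) v *\<^sub>R m w)" for v
      by (rule int[OF Cc_infinity_frechet_derivative[OF g]])
    have "linear ?D"
      using intD by (intro linearI) (simp_all add: linear_add[OF lin] linear_scale[OF lin] scaleR_add_left flip: scaleR_scaleR)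
    then have bl: "bounded_linear ?D" by (simp add: linear_conv_bounded_linear)
    have "\<exists>d>0. \<forall>y. norm (y - x) < d \<longrightarrow> norm (?I g y - ?I g x - ?D (y - x)) \<le> e * norm (y - x)"
      if e: "e > 0" for e
    proof -
      \<comment> \<open>The summand 1 keeps \<open>N\<close> positive even when \<open>m\<close>
        vanishes almost everywhere.\<close>
      define N where "N = (\<integral>w. norm (m w) \<partial>M) + 1"
      have N: "N > 0" unfolding N_def by (simp add: add_nonneg_pos)
      from e N have "e / N > 0" by simp
      then obtain d where d: "d > 0"
        "\<And>y v. norm v < d \<Longrightarrow> norm (g (y + v) - g y - frechet_derivative g (at y) v) \<le> e / N * norm v"
        by (rule Cc_infinity_uniformly_differentiable[OF g]) blast
      have "norm (?I g y - ?I g x - ?D (y - x)) \<le> e * norm (y - x)" if y: "norm (y - x) < d" for y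
      proof -
        have "?I g y - ?I g x - ?D (y - x) =
           (\<integral>w. (g ((x + z w) + (y - x)) - g (x + z w) - frechet_derivative g (at (x + z w)) (y - x)) *\<^sub>R m w \<partial>M)"
          using int[OF g] intD by (simp add: scaleR_diff_left algebra_simps)
        also have "norm \<dots> \<le> (\<integral>w. e / N * norm (y - x) * norm (m w) \<partial>M)"
        proof (rule norm_integral_le_integral)
          show "integrable M (\<lambda>w. (g ((x + z w) + (y - x)) - g (x + z w) - frechet_derivative g (at (x + z w)) (y - x)) *\<^sub>R m w)"
            using int[OF g, of y] int[OF g, of x] intD by (simp add: scaleR_diff_left algebra_simps)
          show "norm ((g ((x + z w) + (y - x)) - g (x + z w) - frechet_derivative g (at (x + z w)) (y - x)) *\<^sub>R m w)
            \<le> e / N * norm (y - x) * norm (m w)" for w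
            using mult_right_mono[OF d(2)[OF y, of "x + z w"], of "norm (m w)"] by simp
        qed (use m in auto)
        also have "\<dots> = e / N * norm (y - x) * (N - 1)" by (simp add: N_def)
        also have "\<dots> \<le> e * norm (y - x)" using N e by (simp add: field_simps)
        finally show ?thesis .
      qed
      then show ?thesis using d by blast
    qed
    then show ?thesis
      unfolding has_derivative_at_alt using bl by blast
  qed
  {
    case 0
    show ?case
      unfolding Ck.simps
      by (rule has_derivative_continuous_on[OF has_derivative_at_withinI[OF der[OF 0]]])
  next
    case (Suc k)
    show ?case
      by (rule Ck_SucI[OF der[OF Suc(2)]], rule Suc(1), rule Cc_infinity_frechet_derivative, rule Suc(2))
  }
qed

lemma Cc_infinity_superposition:
  fixes g :: "'a::euclidean_space \<Rightarrow> real" and m :: "'w \<Rightarrow> 'b::euclidean_space"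
  assumes g: "g \<in> Cc_infinity" and m: "integrable M m" and z: "z \<in> borel_measurable M"
    and bd: "\<And>w. m w \<noteq> 0 \<Longrightarrow> norm (z w) \<le> R"
  shows "(\<lambda>x. \<integral>w. g (x + z w) *\<^sub>R m w \<partial>M) \<in> Cc_infinity"
proof -
  obtain r where r: "\<forall>x. r < norm x \<longrightarrow> g x = 0" by (rule Cc_infinity_supportE[OF g])
  show ?thesis
  proof (rule Cc_infinityI[where r="r + R"])
    fix x :: 'a assume x: "r + R < norm x"
    have zero: "g (x + z w) *\<^sub>R m w = 0" for w
    proof (cases "m w = 0")
      case False
      then have "r < norm (x + z w)"
        using bd[of w] x norm_triangle_ineq4[of "x + z w" "z w"] by simp
      then show ?thesis by (simp add: r)
    qed simp
    show "(\<integral>w. g (x + z w) *\<^sub>R m w \<partial>M) = 0"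
      by (simp only: zero integral_zero)
  qed (intro Ck_superposition g m z)
qed

section \<open>The Gaussian measure and the measures \<open>t\<^sup>a\<^sup>-\<^sup>1 dt\<close>\<close>

text \<open>Left unnormalised. With density exp (-|x|^2) each coordinate has variance 1/2, which is
  the source of the terms \<open>DIM('a) / 2\<close> below.\<close>

definition gauss :: "'a::euclidean_space measure" where
  "gauss = density lborel (\<lambda>x. ennreal (exp (- (norm x)\<^sup>2)))"

text \<open>Homogeneous of degree \<open>a\<close> under dilations of the half-line;
  \<open>pw 0\<close> is the dilation invariant measure dt/t. Negative \<open>a\<close> is used for
  integrands that vanish linearly at 0.\<close>

definition pw :: "real \<Rightarrow> real measure" where
  "pw a = density lborel (\<lambda>t. ennreal (indicator {0<..} t * t powr (a - 1)))"

lemma sets_gauss [measurable_cong, simp]: "sets gauss = sets borel"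
  by (simp add: gauss_def)

lemma space_gauss [simp]: "space gauss = UNIV"
  by (simp add: gauss_def)

lemma sets_pw [measurable_cong, simp]: "sets (pw a) = sets borel"
  by (simp add: pw_def)

lemma space_pw [simp]: "space (pw a) = UNIV"
  by (simp add: pw_def)

lemma integrable_gauss_iff:
  fixes f :: "'a::euclidean_space \<Rightarrow> 'b::{banach,second_countable_topology}"
  assumes "f \<in> borel_measurable borel"
  shows "integrable gauss f \<longleftrightarrow> integrable lborel (\<lambda>x. exp (- (norm x)\<^sup>2) *\<^sub>R f x)"
  unfolding gauss_def using assms by (subst integrable_density) auto

lemma integral_gauss:
  fixes f :: "'a::euclidean_space \<Rightarrow> 'b::{banach,second_countable_topology}"
  assumes "f \<in> borel_measurable borel"
  shows "(\<integral>x. f x \<partial>gauss) = (\<integral>x. exp (- (norm x)\<^sup>2) *\<^sub>R f x \<partial>lborel)"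
  unfolding gauss_def using assms by (subst integral_density) auto

lemma integrable_pw_iff:
  fixes f :: "real \<Rightarrow> 'b::{banach,second_countable_topology}"
  assumes "f \<in> borel_measurable borel"
  shows "integrable (pw a) f \<longleftrightarrow> integrable lborel (\<lambda>t. (indicator {0<..} t * t powr (a - 1)) *\<^sub>R f t)"
  unfolding pw_def using assms by (subst integrable_density) auto

lemma integral_pw:
  fixes f :: "real \<Rightarrow> 'b::{banach,second_countable_topology}"
  assumes "f \<in> borel_measurable borel"
  shows "(\<integral>t. f t \<partial>pw a) = (\<integral>t. (indicator {0<..} t * t powr (a - 1)) *\<^sub>R f t \<partial>lborel)"
  unfolding pw_def using assms by (subst integral_density) auto

text \<open>Lets later arguments assume a positive scale, so the values of \<open>1 / t\<close> and
  \<open>t powr a\<close> at t \<le> 0 never matter.\<close>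

lemma AE_pw_pos: "AE t in pw a. 0 < t"
  unfolding pw_def by (subst AE_density) (auto simp: indicator_def)

lemma sigma_finite_pw: "sigma_finite_measure (pw a)"
  unfolding pw_def by (subst sigma_finite_measure.sigma_finite_iff_density_finite[OF sigma_finite_lborel]) auto

lemma integrable_scaleR_right_iff:
  fixes f :: "'w \<Rightarrow> 'b::{banach,second_countable_topology}"
  assumes "c \<noteq> 0" shows "integrable M (\<lambda>x. c *\<^sub>R f x) \<longleftrightarrow> integrable M f"
  using assms integrable_scaleR_right[of "1 / c" M "\<lambda>x. c *\<^sub>R f x"] by auto

section \<open>Affine changes of variables\<close>

lemma nn_integral_lborel_affine:
  fixes t :: "'a::euclidean_space"
  assumes c: "c \<noteq> 0" and [measurable]: "f \<in> borel_measurable borel"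
  shows "(\<integral>\<^sup>+x. f x \<partial>lborel) = ennreal (\<bar>c\<bar> ^ DIM('a)) * (\<integral>\<^sup>+x. f (t + c *\<^sub>R x) \<partial>lborel)"
  by (subst lborel_affine[OF c, of t])
    (simp add: nn_integral_density nn_integral_distr nn_integral_cmult)

lemma integrable_lborel_affine_iff:
  fixes t :: "'a::euclidean_space" and f :: "'a \<Rightarrow> 'b::{banach,second_countable_topology}"
  assumes c: "c \<noteq> 0" and [measurable]: "f \<in> borel_measurable borel"
  shows "integrable lborel (\<lambda>x. f (t + c *\<^sub>R x)) \<longleftrightarrow> integrable lborel f"
proof -
  have "integrable lborel f \<longleftrightarrow> integrable (density (distr lborel borel (\<lambda>x. t + c *\<^sub>R x)) (\<lambda>_. ennreal (\<bar>c\<bar>^DIM('a)))) f"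
    using lborel_affine[OF c, of t] by simp
  also have "\<dots> \<longleftrightarrow> integrable lborel (\<lambda>x. f (t + c *\<^sub>R x))"
    using c by (simp add: integrable_density integrable_distr_eq integrable_scaleR_right_iff)
  finally show ?thesis ..
qed

lemma integral_lborel_affine:
  fixes t :: "'a::euclidean_space" and f :: "'a \<Rightarrow> 'b::{banach,second_countable_topology}"
  assumes c: "c \<noteq> 0" and [measurable]: "f \<in> borel_measurable borel"
  shows "(\<integral>x. f x \<partial>lborel) = (\<bar>c\<bar> ^ DIM('a)) *\<^sub>R (\<integral>x. f (t + c *\<^sub>R x) \<partial>lborel)"
proof -
  have "(\<integral>x. f x \<partial>lborel) = (\<integral>x. f x \<partial>density (distr lborel borel (\<lambda>x. t + c *\<^sub>R x)) (\<lambda>_. ennreal (\<bar>c\<bar>^DIM('a))))"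
    using lborel_affine[OF c, of t] by simp
  also have "\<dots> = (\<bar>c\<bar> ^ DIM('a)) *\<^sub>R (\<integral>x. f (t + c *\<^sub>R x) \<partial>lborel)"
    by (simp add: integral_density integral_distr)
  finally show ?thesis .
qed

lemma integrable_lborel_translation_iff:
  fixes t :: "'a::euclidean_space" and f :: "'a \<Rightarrow> 'b::{banach,second_countable_topology}"
  assumes "f \<in> borel_measurable borel"
  shows "integrable lborel (\<lambda>x. f (t + x)) \<longleftrightarrow> integrable lborel f"
  using integrable_lborel_affine_iff[of 1 f t] assms by simp

lemma integral_lborel_translation:
  fixes t :: "'a::euclidean_space" and f :: "'a \<Rightarrow> 'b::{banach,second_countable_topology}"
  assumes "f \<in> borel_measurable borel"
  shows "(\<integral>x. f (t + x) \<partial>lborel) = (\<integral>x. f x \<partial>lborel)"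
  using integral_lborel_affine[of 1 f t] assms by simp

subsection \<open>Gaussian moments\<close>

lemma integrable_exp_norm_square:
  assumes c: "c > 0"
  shows "integrable lborel (\<lambda>x::'a::euclidean_space. exp (- (c * (norm x)\<^sup>2)))"
proof -
  have i1: "integrable lborel (\<lambda>x::real. exp (- (c * x\<^sup>2)))"
  proof -
    \<comment> \<open>Variance 1 / (2 c) makes the normal density a multiple of exp (- c
      x^2).\<close>
    have "integrable lborel (\<lambda>x. normal_density 0 (1 / sqrt (2 * c)) x)"
      using c by (intro integrable_normal_density) auto
    then have "integrable lborel (\<lambda>x. sqrt (2 * pi * (1 / sqrt (2 * c))\<^sup>2) * normal_density 0 (1 / sqrt (2 * c)) x)"
      by (rule integrable_mult_right)
    also have "(\<lambda>x. sqrt (2 * pi * (1 / sqrt (2 * c))\<^sup>2) * normal_density 0 (1 / sqrt (2 * c)) x) = (\<lambda>x. exp (- (c * x\<^sup>2)))"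
      using c by (auto simp: normal_density_def fun_eq_iff field_simps)
    finally show ?thesis .
  qed
  have ex: "exp (- (c * (norm x)\<^sup>2)) = (\<Prod>b\<in>Basis. exp (- (c * (x \<bullet> b)\<^sup>2)))" for x :: 'a
  proof -
    have "(norm x)\<^sup>2 = (\<Sum>b\<in>Basis. (x \<bullet> b)\<^sup>2)"
      unfolding power2_norm_eq_inner by (subst euclidean_inner) (simp add: power2_eq_square)
    then show ?thesis
      by (simp add: exp_sum sum_distrib_left flip: sum_negf)
  qed
  have "(\<integral>\<^sup>+x. ennreal (exp (- (c * (norm x)\<^sup>2))) \<partial>(lborel :: 'a measure))
      = (\<integral>\<^sup>+x. (\<Prod>b\<in>Basis. ennreal (exp (- (c * (x \<bullet> b)\<^sup>2)))) \<partial>(lborel :: 'a measure))"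
    unfolding ex by (simp add: prod_ennreal)
  also have "\<dots> = (\<Prod>b\<in>(Basis::'a set). (\<integral>\<^sup>+x. ennreal (exp (- (c * x\<^sup>2))) \<partial>lborel))"
    by (rule nn_integral_lborel_prod) auto
  also have "\<dots> < \<infinity>"
    using i1 unfolding integrable_iff_bounded
    by (auto simp: less_top[symmetric] power_eq_top_ennreal_iff)
  finally show ?thesis
    by (subst integrable_iff_bounded) auto
qed

text \<open>Half of the Gaussian exponent absorbs any power of the norm; the other half stays
  available for integrability.\<close>

lemma norm_power_exp_bounded:
  obtains C where "C > 0" and "\<forall>x::'a::euclidean_space. norm x ^ k * exp (- ((norm x)\<^sup>2 / 2)) \<le> C"
proof -
  have lim: "((\<lambda>t::real. t ^ k * exp (- (t\<^sup>2 / 2))) \<longlongrightarrow> 0) at_top"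
    by real_asymp
  then have "eventually (\<lambda>t::real. t ^ k * exp (- (t\<^sup>2 / 2)) < 1) at_top"
    by (rule order_tendstoD) simp
  then obtain T where T: "\<And>t::real. t \<ge> T \<Longrightarrow> t ^ k * exp (- (t\<^sup>2 / 2)) < 1"
    unfolding eventually_at_top_linorder by blast
  have "norm x ^ k * exp (- ((norm x)\<^sup>2 / 2)) \<le> 1 + \<bar>T\<bar> ^ k" for x :: 'a
  proof (cases "norm x \<ge> T")
    case True
    then show ?thesis using T[of "norm x"] by (simp add: add_increasing2 less_imp_le)
  next
    case False
    then have "norm x ^ k * exp (- ((norm x)\<^sup>2 / 2)) \<le> \<bar>T\<bar> ^ k * 1"
      by (intro mult_mono power_mono) auto
    then show ?thesis by simp
  qed
  then show ?thesis using that[of "1 + \<bar>T\<bar> ^ k"] by (simp add: add_pos_nonneg)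
qed

lemma integrable_gauss_norm_power: "integrable gauss (\<lambda>x::'a::euclidean_space. norm x ^ k)"
proof -
  obtain C where C: "C > 0" "\<forall>x::'a. norm x ^ k * exp (- ((norm x)\<^sup>2 / 2)) \<le> C"
    by (rule norm_power_exp_bounded)
  have "integrable lborel (\<lambda>x::'a. C * exp (- (1/2 * (norm x)\<^sup>2)))"
    by (intro integrable_mult_right integrable_exp_norm_square) auto
  from this have "integrable lborel (\<lambda>x::'a. exp (- (norm x)\<^sup>2) *\<^sub>R norm x ^ k)"
  proof (rule Bochner_Integration.integrable_bound, goal_cases)
    case 2
    show ?case
    proof (rule AE_I2)
    fix x :: 'a
    have "exp (- (norm x)\<^sup>2) = exp (- ((norm x)\<^sup>2/2)) * exp (- ((norm x)\<^sup>2/2))"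
      by (simp flip: exp_add)
    then have "exp (- (norm x)\<^sup>2) * norm x ^ k \<le> C * exp (- ((norm x)\<^sup>2/2))"
      using mult_right_mono[OF C(2)[rule_format, of x], of "exp (- ((norm x)\<^sup>2/2))"] by (simp add: mult_ac)
    then show "norm (exp (- (norm x)\<^sup>2) *\<^sub>R norm x ^ k) \<le> norm (C * exp (- (1/2 * (norm x)\<^sup>2)))"
      using C(1) by (simp add: abs_mult)
    qed
  qed simp
  then show ?thesis
    by (subst integrable_gauss_iff) auto
qed

lemma integrable_gauss_norm: "integrable gauss (\<lambda>x::'a::euclidean_space. norm x)"
  using integrable_gauss_norm_power[of 1] by simp

lemma finite_measure_gauss: "finite_measure (gauss :: 'a::euclidean_space measure)"
proof
  have "integrable gauss (\<lambda>x::'a. 1::real)"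
    using integrable_gauss_norm_power[where k=0] by simp
  then show "emeasure (gauss :: 'a measure) (space gauss) \<noteq> \<infinity>"
    by (simp add: integrable_iff_bounded less_top[symmetric])
qed

interpretation gauss: finite_measure "gauss :: 'a::euclidean_space measure"
  by (rule finite_measure_gauss)

lemma integrable_gauss_bound:
  fixes f :: "'a::euclidean_space \<Rightarrow> 'b::{banach,second_countable_topology}"
  assumes "f \<in> borel_measurable borel" and "\<And>x. norm (f x) \<le> C * norm x ^ k"
  shows "integrable gauss f"
proof (rule Bochner_Integration.integrable_bound)
  show "integrable gauss (\<lambda>x::'a. C * norm x ^ k)"
    by (intro integrable_mult_right integrable_gauss_norm_power)
  show "AE x in gauss. norm (f x) \<le> norm (C * norm x ^ k)"
    by (intro AE_I2 order_trans[OF assms(2)]) simp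
qed (use assms in auto)

lemma gauss_mass_pos: "0 < measure (gauss :: 'a::euclidean_space measure) UNIV"
proof -
  have "emeasure (gauss :: 'a measure) UNIV \<noteq> 0"
  proof
    assume "emeasure (gauss :: 'a measure) UNIV = 0"
    then have "(\<integral>\<^sup>+x. ennreal (exp (- (norm x)\<^sup>2)) \<partial>(lborel :: 'a measure)) = 0"
      by (simp add: gauss_def emeasure_density)
    then have "AE x in (lborel :: 'a measure). False"
      by (subst (asm) nn_integral_0_iff_AE) auto
    then show False
      using ae_filter_eq_bot_iff[of "lborel :: 'a measure"] by (auto simp: trivial_limit_def)
  qed
  then show ?thesis
    by (simp add: gauss.emeasure_eq_measure zero_less_measure_iff)
qed

lemma integral_gauss_odd:
  fixes f :: "'a::euclidean_space \<Rightarrow> real"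
  assumes "f \<in> borel_measurable borel" and "\<And>x. f (- x) = - f x"
  shows "(\<integral>x. f x \<partial>gauss) = 0"
proof -
  have "(\<integral>x. f x \<partial>gauss) = (\<integral>x. exp (- (norm x)\<^sup>2) * f x \<partial>lborel)"
    using assms(1) by (simp add: integral_gauss)
  also have "\<dots> = (\<integral>x. exp (- (norm (- x))\<^sup>2) * f (- x) \<partial>lborel)"
    by (subst integral_lborel_affine[where c="-1" and t=0]) (use assms(1) in auto)
  also have "\<dots> = - (\<integral>x. exp (- (norm x)\<^sup>2) * f x \<partial>lborel)"
    by (simp add: assms(2))
  also have "(\<integral>x. exp (- (norm x)\<^sup>2) * f x \<partial>lborel) = (\<integral>x. f x \<partial>gauss)"
    using assms(1) by (simp add: integral_gauss)
  finally show ?thesis by simp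
qed

text \<open>Passage between two views of an average at scale \<open>s\<close>: a standard Gaussian
  vector \<open>N\<close> multiplied by \<open>s\<close>, and convolution with the kernel s^(-n) exp
  (-|w|^2 / s^2).\<close>

lemma integral_gauss_scale:
  fixes f :: "'a::euclidean_space \<Rightarrow> 'b::{banach,second_countable_topology}"
  assumes s: "s > 0" and [measurable]: "f \<in> borel_measurable borel"
  shows "(\<integral>N. f (s *\<^sub>R N) \<partial>gauss) = (\<integral>w. (exp (- (norm w / s)\<^sup>2) / s ^ DIM('a)) *\<^sub>R f w \<partial>lborel)"
    and "integrable gauss (\<lambda>N. f (s *\<^sub>R N)) \<longleftrightarrow> integrable lborel (\<lambda>w. (exp (- (norm w / s)\<^sup>2) / s ^ DIM('a)) *\<^sub>R f w)"
proof -
  have eq: "(exp (- (norm (0 + s *\<^sub>R N) / s)\<^sup>2) / s ^ DIM('a)) *\<^sub>R f (0 + s *\<^sub>R N) =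
     (1 / s ^ DIM('a)) *\<^sub>R (exp (- (norm N)\<^sup>2) *\<^sub>R f (s *\<^sub>R N))" for N
    using s by simp
  have "(\<integral>w. (exp (- (norm w / s)\<^sup>2) / s ^ DIM('a)) *\<^sub>R f w \<partial>lborel)
     = (\<bar>s\<bar> ^ DIM('a)) *\<^sub>R (\<integral>N. (1 / s ^ DIM('a)) *\<^sub>R (exp (- (norm N)\<^sup>2) *\<^sub>R f (s *\<^sub>R N)) \<partial>lborel)"
    by (subst integral_lborel_affine[where c=s and t=0]) (use s in simp, simp, simp only: eq)
  also have "\<dots> = (\<integral>N. f (s *\<^sub>R N) \<partial>gauss)"
    using s by (subst integral_scaleR_right) (simp add: integral_gauss)
  finally show "(\<integral>N. f (s *\<^sub>R N) \<partial>gauss) = (\<integral>w. (exp (- (norm w / s)\<^sup>2) / s ^ DIM('a)) *\<^sub>R f w \<partial>lborel)" ..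
  have "integrable lborel (\<lambda>w. (exp (- (norm w / s)\<^sup>2) / s ^ DIM('a)) *\<^sub>R f w) \<longleftrightarrow>
     integrable lborel (\<lambda>N. (1 / s ^ DIM('a)) *\<^sub>R (exp (- (norm N)\<^sup>2) *\<^sub>R f (s *\<^sub>R N)))"
    by (subst integrable_lborel_affine_iff[where c=s and t=0, symmetric]) (use s in simp, simp, simp only: eq)
  also have "\<dots> \<longleftrightarrow> integrable gauss (\<lambda>N. f (s *\<^sub>R N))"
    using s by (subst integrable_scaleR_right_iff) (simp_all add: integrable_gauss_iff)
  finally show "integrable gauss (\<lambda>N. f (s *\<^sub>R N)) \<longleftrightarrow> integrable lborel (\<lambda>w. (exp (- (norm w / s)\<^sup>2) / s ^ DIM('a)) *\<^sub>R f w)" ..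
qed

subsection \<open>Rotation invariance\<close>

text \<open>The rotation is performed as two substitutions in one variable each: first b is replaced
  with a fixed, then, after exchanging the integrals, a is replaced with w = c a + s b fixed. The
  Jacobians |1/s|^n and |s|^n cancel.\<close>

lemma nn_integral_lborel_rotation:
  fixes F :: "'a::euclidean_space \<times> 'a \<Rightarrow> ennreal"
  assumes cs: "c\<^sup>2 + s\<^sup>2 = 1" "s \<noteq> 0" and [measurable]: "F \<in> borel_measurable (borel \<Otimes>\<^sub>M borel)"
  shows "(\<integral>\<^sup>+a. \<integral>\<^sup>+b. F (c *\<^sub>R a - s *\<^sub>R b, s *\<^sub>R a + c *\<^sub>R b) \<partial>lborel \<partial>lborel) = (\<integral>\<^sup>+a. \<integral>\<^sup>+b. F (a, b) \<partial>lborel \<partial>lborel)"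
proof -
  let ?k = "ennreal (\<bar>1 / s\<bar> ^ DIM('a))" and ?l = "ennreal (\<bar>- s\<bar> ^ DIM('a))"
  have "?k * ?l = 1"
    using cs(2) by (simp flip: ennreal_mult power_mult_distrib abs_mult)
  then have kl: "ennreal ((1 / \<bar>s\<bar>) ^ DIM('a)) * ennreal (\<bar>s\<bar> ^ DIM('a)) = 1" by simp
  have "(\<integral>\<^sup>+a. \<integral>\<^sup>+b. F (a, b) \<partial>lborel \<partial>lborel) =
      (\<integral>\<^sup>+a. ?k * \<integral>\<^sup>+w. F (a, (- (c / s)) *\<^sub>R a + (1 / s) *\<^sub>R w) \<partial>lborel \<partial>lborel)"
    using cs(2) by (intro nn_integral_cong nn_integral_lborel_affine) auto
  also have "\<dots> = ?k * (\<integral>\<^sup>+a. \<integral>\<^sup>+w. F (a, (- (c / s)) *\<^sub>R a + (1 / s) *\<^sub>R w) \<partial>lborel \<partial>lborel)"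
    by (rule nn_integral_cmult) measurable
  also have "(\<integral>\<^sup>+a. \<integral>\<^sup>+w. F (a, (- (c / s)) *\<^sub>R a + (1 / s) *\<^sub>R w) \<partial>lborel \<partial>lborel) =
     (\<integral>\<^sup>+w. \<integral>\<^sup>+a. F (a, (- (c / s)) *\<^sub>R a + (1 / s) *\<^sub>R w) \<partial>lborel \<partial>lborel)"
    by (rule lborel_pair.Fubini') measurable
  also have "\<dots> = (\<integral>\<^sup>+w. ?l * \<integral>\<^sup>+z. F (c *\<^sub>R w + (- s) *\<^sub>R z, (- (c / s)) *\<^sub>R (c *\<^sub>R w + (- s) *\<^sub>R z) + (1 / s) *\<^sub>R w) \<partial>lborel \<partial>lborel)"
    using cs(2) by (intro nn_integral_cong nn_integral_lborel_affine[where f="\<lambda>a. F (a, (- (c / s)) *\<^sub>R a + (1 / s) *\<^sub>R _)"]) auto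
  also have "\<dots> = ?l * (\<integral>\<^sup>+w. \<integral>\<^sup>+z. F (c *\<^sub>R w + (- s) *\<^sub>R z, (- (c / s)) *\<^sub>R (c *\<^sub>R w + (- s) *\<^sub>R z) + (1 / s) *\<^sub>R w) \<partial>lborel \<partial>lborel)"
    by (rule nn_integral_cmult) measurable
  also have "(\<lambda>w z::'a. F (c *\<^sub>R w + (- s) *\<^sub>R z, (- (c / s)) *\<^sub>R (c *\<^sub>R w + (- s) *\<^sub>R z) + (1 / s) *\<^sub>R w))
      = (\<lambda>w z. F (c *\<^sub>R w - s *\<^sub>R z, s *\<^sub>R w + c *\<^sub>R z))"
  proof (intro ext)
    fix w z :: 'a
    have "(- (c / s)) *\<^sub>R (c *\<^sub>R w + (- s) *\<^sub>R z) + (1 / s) *\<^sub>R w = ((1 - c * c) / s) *\<^sub>R w + c *\<^sub>R z"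
      using cs(2) by (simp add: algebra_simps diff_divide_distrib)
    also have "(1 - c * c) / s = s"
      using cs by (simp add: field_simps power2_eq_square)
    finally show "F (c *\<^sub>R w + (- s) *\<^sub>R z, (- (c / s)) *\<^sub>R (c *\<^sub>R w + (- s) *\<^sub>R z) + (1 / s) *\<^sub>R w)
      = F (c *\<^sub>R w - s *\<^sub>R z, s *\<^sub>R w + c *\<^sub>R z)" by simp
  qed
  finally show ?thesis
    using kl by (simp flip: mult.assoc)
qed

text \<open>The joint density depends only on |a|^2 + |b|^2, which the rotation preserves, and
  Lebesgue measure is invariant by the preceding lemma.\<close>

lemma distr_gauss_rotation:
  assumes cs: "c\<^sup>2 + s\<^sup>2 = 1" "s \<noteq> 0"
  shows "distr (gauss \<Otimes>\<^sub>M gauss) (gauss \<Otimes>\<^sub>M gauss) (\<lambda>(a, b). (c *\<^sub>R a - s *\<^sub>R b, s *\<^sub>R a + c *\<^sub>R b))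
    = (gauss \<Otimes>\<^sub>M gauss :: ('a::euclidean_space \<times> 'a) measure)"
proof (rule measure_eqI)
  let ?e = "\<lambda>x::'a. ennreal (exp (- (norm x)\<^sup>2))"
  let ?r = "\<lambda>(a, b). (c *\<^sub>R a - s *\<^sub>R b, s *\<^sub>R a + c *\<^sub>R b) :: 'a \<times> 'a"
  have nn: "(\<integral>\<^sup>+p. F p \<partial>(gauss \<Otimes>\<^sub>M gauss)) = (\<integral>\<^sup>+a. \<integral>\<^sup>+b. ?e a * ?e b * F (a, b) \<partial>lborel \<partial>lborel)"
    if [measurable]: "F \<in> borel_measurable (borel \<Otimes>\<^sub>M borel)" for F
  proof -
    have "(\<integral>\<^sup>+p. F p \<partial>(gauss \<Otimes>\<^sub>M gauss)) = (\<integral>\<^sup>+a. \<integral>\<^sup>+b. F (a, b) \<partial>gauss \<partial>gauss)"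
      by (rule gauss.nn_integral_fst[symmetric]) simp
    also have "\<dots> = (\<integral>\<^sup>+a. ?e a * (\<integral>\<^sup>+b. ?e b * F (a, b) \<partial>lborel) \<partial>lborel)"
      by (simp add: gauss_def nn_integral_density)
    also have "\<dots> = (\<integral>\<^sup>+a. \<integral>\<^sup>+b. ?e a * ?e b * F (a, b) \<partial>lborel \<partial>lborel)"
      by (simp add: mult.assoc nn_integral_cmult)
    finally show ?thesis .
  qed
  fix A :: "('a \<times> 'a) set"
  assume "A \<in> sets (distr (gauss \<Otimes>\<^sub>M gauss) (gauss \<Otimes>\<^sub>M gauss) ?r)"
  then have [measurable]: "A \<in> sets (borel \<Otimes>\<^sub>M borel)"
    by (simp cong: sets_pair_measure_cong)
  have [measurable]: "?r \<in> (borel \<Otimes>\<^sub>M borel) \<rightarrow>\<^sub>M (borel \<Otimes>\<^sub>M borel)" by measurable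
  have nrm: "(norm (c *\<^sub>R a - s *\<^sub>R b))\<^sup>2 + (norm (s *\<^sub>R a + c *\<^sub>R b))\<^sup>2 = (norm a)\<^sup>2 + (norm b)\<^sup>2" for a b :: 'a
  proof -
    have "(norm (c *\<^sub>R a - s *\<^sub>R b))\<^sup>2 + (norm (s *\<^sub>R a + c *\<^sub>R b))\<^sup>2 = (c\<^sup>2 + s\<^sup>2) * ((norm a)\<^sup>2 + (norm b)\<^sup>2)"
      unfolding power2_norm_eq_inner by (simp add: inner_simps inner_commute power2_eq_square algebra_simps)
    then show ?thesis using cs by simp
  qed
  have eq: "?e a * ?e b = ?e (c *\<^sub>R a - s *\<^sub>R b) * ?e (s *\<^sub>R a + c *\<^sub>R b)" for a b
    using nrm[of a b] by (simp flip: ennreal_mult exp_add)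
  have "emeasure (distr (gauss \<Otimes>\<^sub>M gauss) (gauss \<Otimes>\<^sub>M gauss) ?r) A
     = (\<integral>\<^sup>+p. indicator A p \<partial>distr (gauss \<Otimes>\<^sub>M gauss) (gauss \<Otimes>\<^sub>M gauss) ?r)"
    by (subst nn_integral_indicator) simp_all
  also have "\<dots> = (\<integral>\<^sup>+p. indicator A (?r p) \<partial>(gauss \<Otimes>\<^sub>M gauss))"
    by (subst nn_integral_distr) simp_all
  also have "\<dots> = (\<integral>\<^sup>+a. \<integral>\<^sup>+b. ?e a * ?e b * indicator A (?r (a, b)) \<partial>lborel \<partial>lborel)"
    by (rule nn) measurable
  also have "\<dots> = (\<integral>\<^sup>+a. \<integral>\<^sup>+b. (\<lambda>(a, b). ?e a * ?e b * indicator A (a, b)) (c *\<^sub>R a - s *\<^sub>R b, s *\<^sub>R a + c *\<^sub>R b) \<partial>lborel \<partial>lborel)"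
    by (simp only: prod.case eq[symmetric])
  also have "\<dots> = (\<integral>\<^sup>+a. \<integral>\<^sup>+b. (\<lambda>(a, b). ?e a * ?e b * indicator A (a, b)) (a, b) \<partial>lborel \<partial>lborel)"
    by (rule nn_integral_lborel_rotation[OF cs]) measurable
  also have "\<dots> = (\<integral>\<^sup>+p. indicator A p \<partial>(gauss \<Otimes>\<^sub>M gauss))"
    by (subst nn) simp_all
  also have "\<dots> = emeasure (gauss \<Otimes>\<^sub>M gauss) A"
    by (subst nn_integral_indicator) (simp_all cong: sets_pair_measure_cong)
  finally show "emeasure (distr (gauss \<Otimes>\<^sub>M gauss) (gauss \<Otimes>\<^sub>M gauss) ?r) A = emeasure (gauss \<Otimes>\<^sub>M gauss) A" .
qed (simp cong: sets_pair_measure_cong)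

interpretation gauss2: pair_sigma_finite "gauss :: 'a::euclidean_space measure" "gauss :: 'b::euclidean_space measure" ..

lemma integral_gauss_rotation:
  fixes F :: "'a::euclidean_space \<times> 'a \<Rightarrow> 'b::{banach,second_countable_topology}"
  assumes cs: "c\<^sup>2 + s\<^sup>2 = 1" "s \<noteq> 0" and [measurable]: "F \<in> borel_measurable (borel \<Otimes>\<^sub>M borel)"
  shows "(\<integral>p. F p \<partial>(gauss \<Otimes>\<^sub>M gauss)) = (\<integral>p. F (c *\<^sub>R fst p - s *\<^sub>R snd p, s *\<^sub>R fst p + c *\<^sub>R snd p) \<partial>(gauss \<Otimes>\<^sub>M gauss))"
  by (subst distr_gauss_rotation[OF cs, symmetric], subst integral_distr) (simp_all add: case_prod_beta)

text \<open>The criterion behind the later exchanges of integrals. An almost everywhere hypothesis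
  in the first variable suffices, so with \<open>pw\<close> in that place only positive scales have
  to be estimated.\<close>

lemma (in pair_sigma_finite) integrable_pair_dominated:
  fixes f :: "_ \<Rightarrow> _::{banach, second_countable_topology}"
  assumes [measurable]: "f \<in> borel_measurable (M1 \<Otimes>\<^sub>M M2)" and B: "integrable M1 B"
    and "AE x in M1. integrable M2 (\<lambda>y. f (x, y)) \<and> (\<integral>y. norm (f (x, y)) \<partial>M2) \<le> B x"
  shows "integrable (M1 \<Otimes>\<^sub>M M2) f"
proof (rule Fubini_integrable)
  show "integrable M1 (\<lambda>x. \<integral>y. norm (f (x, y)) \<partial>M2)"
    by (rule Bochner_Integration.integrable_bound[OF B])
      (measurable, use assms(3) in eventually_elim, auto intro: order_trans[OF _ abs_ge_self])
qed (use assms(3) in auto)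

subsection \<open>Scaling and integrability for \<open>pw\<close>\<close>

lemma pw_scale:
  fixes F :: "real \<Rightarrow> 'b::{banach,second_countable_topology}"
  assumes c: "c > 0" and [measurable]: "F \<in> borel_measurable borel"
  shows "integrable (pw a) (\<lambda>t. F (c * t)) \<longleftrightarrow> integrable (pw a) F"
    and "(\<integral>t. F (c * t) \<partial>pw a) = c powr (- a) *\<^sub>R (\<integral>t. F t \<partial>pw a)"
proof -
  let ?G = "\<lambda>t. (indicator {0<..} t * t powr (a - 1)) *\<^sub>R F t"
  have eq: "?G (0 + c *\<^sub>R t) = c powr (a - 1) *\<^sub>R ((indicator {0<..} t * t powr (a - 1)) *\<^sub>R F (c * t))" for t
    using c by (auto simp: indicator_def zero_less_mult_iff powr_mult)
  have c1: "c * c powr (a - 1) = c powr a"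
    using c powr_mult_base[of c "a - 1"] by simp
  have cp: "c powr (a - 1) \<noteq> 0" using c by simp
  have "integrable (pw a) F \<longleftrightarrow> integrable lborel (\<lambda>t. ?G (0 + c *\<^sub>R t))"
    using c by (subst integrable_lborel_affine_iff) (simp_all add: integrable_pw_iff)
  also have "\<dots> \<longleftrightarrow> integrable (pw a) (\<lambda>t. F (c * t))"
    unfolding eq by (subst integrable_scaleR_right_iff[OF cp]) (simp add: integrable_pw_iff)
  finally show "integrable (pw a) (\<lambda>t. F (c * t)) \<longleftrightarrow> integrable (pw a) F" ..
  have "(\<integral>t. F t \<partial>pw a) = c *\<^sub>R (\<integral>t. ?G (0 + c *\<^sub>R t) \<partial>lborel)"
    using c by (subst integral_pw, simp, subst integral_lborel_affine[where c=c and t=0]) simp_all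
  also have "\<dots> = (c * c powr (a - 1)) *\<^sub>R (\<integral>t. F (c * t) \<partial>pw a)"
    unfolding eq by (subst integral_scaleR_right) (simp add: integral_pw)
  finally show "(\<integral>t. F (c * t) \<partial>pw a) = c powr (- a) *\<^sub>R (\<integral>t. F t \<partial>pw a)"
    unfolding c1 using c by (simp flip: powr_add)
qed

text \<open>The two ends use the two bounds on \<open>a\<close>: t^(a-1) is integrable at 0 since a
  > 0, and t^(a-2) at infinity since a < 1.\<close>

lemma integrable_pw_min:
  assumes "0 < a" "a < 1"
  shows "integrable (pw a) (\<lambda>t. min 1 (1 / t))"
proof -
  have fin: "integrable lborel f" if "f \<in> borel_measurable borel" "\<And>x. 0 \<le> f x" "(f has_integral I) UNIV"
    for f :: "real \<Rightarrow> real" and I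
    using that nn_integral_has_integral_lborel[of f I]
    by (intro integrableI_nn_integral_finite[of f _ I]) auto
  have 1: "integrable lborel (\<lambda>t::real. if t \<in> {0..1} then t powr (a - 1) else 0)"
    by (rule fin, simp, simp, subst has_integral_restrict_UNIV, rule has_integral_powr_from_0)
      (use assms in auto)
  have 2: "integrable lborel (\<lambda>t::real. if t \<in> {1..} then t powr (a - 2) else 0)"
    by (rule fin, simp, simp, subst has_integral_restrict_UNIV, rule has_integral_powr_to_inf)
      (use assms in auto)
  have "integrable lborel (\<lambda>t. (indicator {0<..} t * t powr (a - 1)) *\<^sub>R min 1 (1 / t))"
  proof (rule Bochner_Integration.integrable_bound[OF Bochner_Integration.integrable_add[OF 1 2]])
    show "AE t in lborel. norm ((indicator {0<..} t * t powr (a - 1)) *\<^sub>R min 1 (1 / t))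
        \<le> norm ((if t \<in> {0..1} then t powr (a - 1) else 0) + (if t \<in> {1..} then t powr (a - 2) else 0))"
    proof (rule AE_I2)
      fix t :: real
      consider "t \<le> 0" | "0 < t" "t \<le> 1" | "1 < t" by linarith
      then show "norm ((indicator {0<..} t * t powr (a - 1)) *\<^sub>R min 1 (1 / t))
        \<le> norm ((if t \<in> {0..1} then t powr (a - 1) else 0) + (if t \<in> {1..} then t powr (a - 2) else 0))"
      proof cases
        case 3
        have "t powr (a - 1) = t * t powr (a - 2)"
          using 3 powr_mult_base[of t "a - 2"] by simp
        then show ?thesis using 3 by (simp add: min_def)
      qed (auto simp: min_def indicator_def)
    qed
  qed simp
  then show ?thesis by (simp add: integrable_pw_iff)
qed

definition pw_const :: "real \<Rightarrow> real" where
  "pw_const a = (\<integral>t. min 1 (1 / t) \<partial>pw a)"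

lemma pw_const_nonneg: "0 \<le> pw_const a"
  unfolding pw_const_def by (rule integral_nonneg_AE) (use AE_pw_pos[of a] in eventually_elim, auto)

text \<open>The origin of the exponent in the Besov seminorm: a translation by a vector of length
  \<open>h\<close> costs min 1 (h/t) at scale t, and homogeneity of the weight turns the sum over
  scales into \<open>h powr a\<close>.\<close>

lemma pw_min_scale:
  assumes a: "0 < a" "a < 1" and h: "0 < h"
  shows "integrable (pw a) (\<lambda>t. min 1 (h / t))" "(\<integral>t. min 1 (h / t) \<partial>pw a) = h powr a * pw_const a"
proof -
  have eq: "min 1 (h / t) = min 1 (1 / ((1 / h) * t))" for t
    using h by simp
  show "integrable (pw a) (\<lambda>t. min 1 (h / t))"
    unfolding eq by (subst pw_scale[where F="\<lambda>t. min 1 (1 / t)"]) (use h integrable_pw_min[OF a] in auto)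
  show "(\<integral>t. min 1 (h / t) \<partial>pw a) = h powr a * pw_const a"
    unfolding eq by (subst pw_scale[where F="\<lambda>t. min 1 (1 / t)"])
      (use h in \<open>auto simp: pw_const_def powr_minus powr_divide\<close>)
qed

lemma integrable_pw_bound:
  fixes f :: "real \<Rightarrow> 'b::{banach,second_countable_topology}"
  assumes "0 < a" "a < 1" and "f \<in> borel_measurable borel"
    and "\<And>t. 0 < t \<Longrightarrow> norm (f t) \<le> C * min 1 (1 / t)"
  shows "integrable (pw a) f"
proof (rule Bochner_Integration.integrable_bound)
  show "integrable (pw a) (\<lambda>t. C * min 1 (1 / t))"
    using integrable_pw_min[OF assms(1,2)] by simp
  show "AE t in pw a. norm (f t) \<le> norm (C * min 1 (1 / t))"
    using AE_pw_pos[of a] by eventually_elim (rule order_trans[OF assms(4)], auto)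
qed (use assms in auto)

lemma pw_shift:
  fixes F :: "real \<Rightarrow> 'b::{banach,second_countable_topology}"
  assumes [measurable]: "F \<in> borel_measurable borel"
  shows "integrable (pw a) (\<lambda>t. t powr b *\<^sub>R F t) \<longleftrightarrow> integrable (pw (a + b)) F"
    and "(\<integral>t. t powr b *\<^sub>R F t \<partial>pw a) = (\<integral>t. F t \<partial>pw (a + b))"
proof -
  have eq: "(indicator {0<..} t * t powr (a - 1)) *\<^sub>R t powr b *\<^sub>R F t
      = (indicator {0<..} t * t powr (a + b - 1)) *\<^sub>R F t" for t
    by (simp add: indicator_def flip: powr_add) (simp add: algebra_simps)
  show "integrable (pw a) (\<lambda>t. t powr b *\<^sub>R F t) \<longleftrightarrow> integrable (pw (a + b)) F"
    by (simp add: integrable_pw_iff eq del: scaleR_scaleR)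
  show "(\<integral>t. t powr b *\<^sub>R F t \<partial>pw a) = (\<integral>t. F t \<partial>pw (a + b))"
    by (simp add: integral_pw eq del: scaleR_scaleR)
qed

text \<open>One factor t moves into the measure, which turns \<open>pw (- a)\<close> into
  \<open>pw (1 - a)\<close> and the majorant \<open>min 1 t\<close> into
  \<open>min 1 (1 / t)\<close>.\<close>

lemma integrable_pw_neg:
  fixes f :: "real \<Rightarrow> 'b::{banach,second_countable_topology}"
  assumes a: "0 < a" "a < 1" and [measurable]: "f \<in> borel_measurable borel"
    and le: "\<And>t. 0 < t \<Longrightarrow> norm (f t) \<le> C * min 1 t"
  shows "integrable (pw (- a)) f"
proof -
  have "integrable (pw (1 - a)) (\<lambda>t. (1 / t) *\<^sub>R f t)"
  proof (rule integrable_pw_bound[where C=C])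
    fix t :: real assume t: "0 < t"
    have "norm ((1 / t) *\<^sub>R f t) \<le> (1 / t) * (C * min 1 t)"
      using le[OF t] t by (simp add: divide_right_mono)
    also have "\<dots> = C * min 1 (1 / t)"
      using t by (simp add: min_def)
    finally show "norm ((1 / t) *\<^sub>R f t) \<le> C * min 1 (1 / t)" .
  qed (use a in auto)
  then have "integrable (pw (- a)) (\<lambda>t. t powr 1 *\<^sub>R (1 / t) *\<^sub>R f t)"
    by (subst pw_shift) (simp_all add: add.commute)
  moreover have "AE t in pw (- a). t powr 1 *\<^sub>R (1 / t) *\<^sub>R f t = f t"
    using AE_pw_pos[of "- a"] by eventually_elim auto
  ultimately show ?thesis
    by (subst integrable_cong_AE[symmetric]) auto
qed

subsection \<open>Translates of Gaussian kernels\<close>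

text \<open>Long translations are handled by the triangle inequality. For short ones the mean value
  inequality is applied on a unit ball around z, where the Gaussian bound of the derivative is still
  dominated by a wider Gaussian in z.\<close>

lemma gaussian_decay_translation_bound:
  fixes q :: "'a::euclidean_space \<Rightarrow> 'b::euclidean_space"
  assumes der: "\<And>x. (q has_derivative q' x) (at x)" and qi: "integrable lborel q"
    and le: "\<And>x v. norm (q' x v) \<le> C * exp (- ((norm x)\<^sup>2 / 2)) * norm v"
  obtains K where "K \<ge> 0" and "\<forall>h. (\<integral>z. norm (q (z + h) - q z) \<partial>lborel) \<le> K * min 1 (norm h)"
proof -
  have [measurable]: "q \<in> borel_measurable borel" using qi by auto
  have Cnn: "0 \<le> C"
  proof -
    obtain b :: 'a where "b \<in> Basis" using nonempty_Basis by blast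
    then have "0 \<le> C * exp (- ((norm (0::'a))\<^sup>2 / 2)) * norm b"
      using le[of 0 b] norm_ge_zero order_trans by blast
    then show ?thesis using \<open>b \<in> Basis\<close> by simp
  qed
  let ?E = "\<lambda>z::'a. exp (- (1/4 * (norm z)\<^sup>2))"
  have Ei: "integrable lborel ?E" by (rule integrable_exp_norm_square) simp
  define K1 where "K1 = C * exp (1/2) * (\<integral>z. ?E z \<partial>lborel)"
  define K2 where "K2 = 2 * (\<integral>z. norm (q z) \<partial>lborel)"
  have K1: "0 \<le> K1" using Cnn by (simp add: K1_def)
  have K2: "0 \<le> K2" by (simp add: K2_def)
  have qh: "integrable lborel (\<lambda>z. q (z + h))" for h
    using integrable_lborel_translation_iff[of q h] qi by (simp add: add.commute)
  have qnh: "(\<integral>z. norm (q (z + h)) \<partial>lborel) = (\<integral>z. norm (q z) \<partial>lborel)" for h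
    using integral_lborel_translation[of "\<lambda>z. norm (q z)" h] by (simp add: add.commute)
  have "(\<integral>z. norm (q (z + h) - q z) \<partial>lborel) \<le> (K1 + K2) * min 1 (norm h)" for h
  proof (cases "norm h \<le> 1")
    case True
    have pt: "norm (q (z + h) - q z) \<le> C * exp (1/2) * ?E z * norm h" for z
    proof -
      have "norm (q (z + h) - q z) \<le> C * exp (1/2) * ?E z * norm (z + h - z)"
      proof (rule differentiable_bound[where S="cball z 1" and f'=q'])
        fix w assume "w \<in> cball z 1"
        then have "norm z \<le> norm w + 1"
          using norm_triangle_ineq2[of z w] by (simp add: dist_norm)
        then have "(norm z)\<^sup>2 \<le> (norm w + 1)\<^sup>2" by (intro power_mono) auto
        \<comment> \<open>This inequality determines the constants 1/4 and exp (1/2): it converts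
          exp (-|w|^2 / 2) into exp (1/2) exp (-|z|^2 / 4).\<close>
        also have "\<dots> \<le> 2 * (norm w)\<^sup>2 + 2"
          using zero_le_power2[of "norm w - 1"] by (simp add: power2_eq_square algebra_simps)
        finally have "exp (- ((norm w)\<^sup>2 / 2)) \<le> exp (1/2 + (- (1/4 * (norm z)\<^sup>2)))"
          by simp
        then have e: "C * exp (- ((norm w)\<^sup>2 / 2)) \<le> C * exp (1/2) * ?E z"
          using Cnn unfolding exp_add mult.assoc by (intro mult_left_mono) auto
        show "onorm (q' w) \<le> C * exp (1/2) * ?E z"
        proof (rule onorm_le)
          fix v show "norm (q' w v) \<le> C * exp (1/2) * ?E z * norm v"
            using order_trans[OF le[of w v] mult_right_mono[OF e]] by simp
        qed
      qed (use der True in \<open>auto intro: has_derivative_at_withinI simp: dist_norm\<close>)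
      then show ?thesis by simp
    qed
    have "(\<integral>z. norm (q (z + h) - q z) \<partial>lborel) \<le> (\<integral>z. C * exp (1/2) * ?E z * norm h \<partial>lborel)"
      by (rule integral_mono) (use pt qi qh Ei in auto)
    also have "\<dots> = K1 * norm h" by (simp add: K1_def)
    also have "\<dots> \<le> (K1 + K2) * min 1 (norm h)"
      using True K2 by (simp add: mult_right_mono)
    finally show ?thesis .
  next
    case False
    have "(\<integral>z. norm (q (z + h) - q z) \<partial>lborel) \<le> (\<integral>z. norm (q (z + h)) + norm (q z) \<partial>lborel)"
      by (rule integral_mono) (use qi qh in \<open>auto intro: norm_triangle_ineq4\<close>)
    also have "\<dots> = K2"
      using qi qh by (subst Bochner_Integration.integral_add) (auto simp: qnh K2_def)
    finally show ?thesis using False K1 by simp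
  qed
  then show ?thesis using that[of "K1 + K2"] K1 K2 by auto
qed

lemma has_derivative_gauss_kernel:
  "((\<lambda>x::'a::euclidean_space. exp (- (norm x)\<^sup>2)) has_derivative (\<lambda>v. - (2 * (x \<bullet> v) * exp (- (norm x)\<^sup>2)))) (at x)"
  unfolding power2_norm_eq_inner
  by (auto intro!: derivative_eq_intros simp: inner_commute algebra_simps)

lemma gauss_kernel_translation_bound:
  obtains K where "K \<ge> 0"
    and "\<forall>h::'a::euclidean_space. (\<integral>z. norm (exp (- (norm (z + h))\<^sup>2) - exp (- (norm z)\<^sup>2)) \<partial>lborel) \<le> K * min 1 (norm h)"
proof -
  obtain C where C: "C > 0" "\<forall>x::'a. norm x ^ 1 * exp (- ((norm x)\<^sup>2 / 2)) \<le> C"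
    by (rule norm_power_exp_bounded)
  have le: "norm (- (2 * (x \<bullet> v) * exp (- (norm x)\<^sup>2))) \<le> (2 * C) * exp (- ((norm x)\<^sup>2 / 2)) * norm v" for x v :: 'a
  proof -
    have e: "exp (- (norm x)\<^sup>2) = exp (- ((norm x)\<^sup>2/2)) * exp (- ((norm x)\<^sup>2/2))"
      by (simp flip: exp_add)
    have "norm (- (2 * (x \<bullet> v) * exp (- (norm x)\<^sup>2))) \<le> 2 * (norm x * norm v) * exp (- (norm x)\<^sup>2)"
      using Cauchy_Schwarz_ineq2[of x v] by (simp add: abs_mult)
    also have "\<dots> = 2 * (norm x ^ 1 * exp (- ((norm x)\<^sup>2/2))) * (exp (- ((norm x)\<^sup>2/2)) * norm v)"
      unfolding e by simp
    also have "\<dots> \<le> 2 * C * (exp (- ((norm x)\<^sup>2/2)) * norm v)"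
      using C(2) by (intro mult_right_mono mult_left_mono) auto
    finally show ?thesis by (simp add: mult.assoc)
  qed
  have "integrable lborel (\<lambda>x::'a. exp (- (norm x)\<^sup>2))"
    using integrable_exp_norm_square[of 1] by simp
  from gaussian_decay_translation_bound[OF has_derivative_gauss_kernel this le] show ?thesis
    using that by blast
qed

text \<open>The kernel exp (-|z|^2) z is the one-scale slice of the Riesz-type kernel. Its
  derivative has a term quadratic in z, hence the second power of the norm in the choice of
  C.\<close>

lemma gauss_moment_kernel_translation_bound:
  obtains K where "K \<ge> 0"
    and "\<forall>h::'a::euclidean_space. (\<integral>z. norm (exp (- (norm (z + h))\<^sup>2) *\<^sub>R (z + h) - exp (- (norm z)\<^sup>2) *\<^sub>R z) \<partial>lborel) \<le> K * min 1 (norm h)"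
proof -
  obtain C where C: "C > 0" "\<forall>x::'a. norm x ^ 2 * exp (- ((norm x)\<^sup>2 / 2)) \<le> C"
    by (rule norm_power_exp_bounded)
  let ?D = "\<lambda>x v::'a. exp (- (norm x)\<^sup>2) *\<^sub>R v + (- (2 * (x \<bullet> v) * exp (- (norm x)\<^sup>2))) *\<^sub>R x"
  have der: "((\<lambda>x. exp (- (norm x)\<^sup>2) *\<^sub>R x) has_derivative ?D x) (at x)" for x :: 'a
    by (rule has_derivative_scaleR[OF has_derivative_gauss_kernel has_derivative_ident])
  have le: "norm (?D x v) \<le> (1 + 2 * C) * exp (- ((norm x)\<^sup>2 / 2)) * norm v" for x v :: 'a
  proof -
    have e: "exp (- (norm x)\<^sup>2) = exp (- ((norm x)\<^sup>2/2)) * exp (- ((norm x)\<^sup>2/2))"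
      by (simp flip: exp_add)
    have "norm (?D x v) \<le> exp (- (norm x)\<^sup>2) * norm v + 2 * (norm x * norm v) * exp (- (norm x)\<^sup>2) * norm x"
      using mult_right_mono[OF mult_right_mono[OF Cauchy_Schwarz_ineq2[of x v], of "norm x"], of "exp (- (norm x)\<^sup>2)"]
      by (intro order_trans[OF norm_triangle_ineq] add_mono) (auto simp: abs_mult mult_ac)
    also have "\<dots> = (exp (- ((norm x)\<^sup>2/2)) + 2 * (norm x ^ 2 * exp (- ((norm x)\<^sup>2/2)))) * (exp (- ((norm x)\<^sup>2/2)) * norm v)"
      unfolding e by (simp add: algebra_simps power2_eq_square)
    also have "\<dots> \<le> (1 + 2 * C) * (exp (- ((norm x)\<^sup>2/2)) * norm v)"
      using C(2) by (intro mult_right_mono add_mono mult_left_mono) auto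
    finally show ?thesis by (simp add: mult.assoc)
  qed
  have "integrable gauss (\<lambda>x::'a. x)"
    by (rule integrable_gauss_bound[where C=1 and k=1]) auto
  then have "integrable lborel (\<lambda>x::'a. exp (- (norm x)\<^sup>2) *\<^sub>R x)"
    by (subst (asm) integrable_gauss_iff) auto
  from gaussian_decay_translation_bound[OF der this le] show ?thesis
    using that by blast
qed

text \<open>At small scales the sup bound of g is used. At scales s \<ge> 1 the weighted kernel is
  at most C / s^n, so the L^1 bound of g gives decay; 1 / s is all that is kept, since the weight
  t^(\<alpha>-1) with \<alpha> < 1 then converges.\<close>

lemma gauss_weighted_integral_decay:
  fixes g :: "'a::euclidean_space \<Rightarrow> real" and p :: "'a \<Rightarrow> real"
  assumes [measurable]: "g \<in> borel_measurable borel" "p \<in> borel_measurable borel"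
    and p: "\<And>N. 0 \<le> p N" "integrable gauss p" "\<And>N. exp (- (norm N)\<^sup>2) * p N \<le> C"
    and g: "\<And>x. \<bar>g x\<bar> \<le> A" "integrable lborel g" "(\<integral>x. \<bar>g x\<bar> \<partial>lborel) \<le> A"
    and s: "s > 0"
  shows "integrable gauss (\<lambda>N. p N * \<bar>g (x + s *\<^sub>R N)\<bar>)" (is ?I)
    and "(\<integral>N. p N * \<bar>g (x + s *\<^sub>R N)\<bar> \<partial>gauss) \<le> A * (C + (\<integral>N. p N \<partial>gauss)) * min 1 (1 / s)" (is ?L)
proof -
  have A: "0 \<le> A" using g(1)[of 0] by linarith
  have C: "0 \<le> C" using p(3)[of 0] p(1)[of 0] by (simp add: order_trans)
  have P: "0 \<le> (\<integral>N. p N \<partial>gauss)" using p(1) by simp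
  show I: ?I
    by (rule Bochner_Integration.integrable_bound[where f="\<lambda>N. A * p N"])
      (use p g A in \<open>auto simp: abs_mult mult.commute[of A] intro!: mult_left_mono\<close>)
  have 1: "(\<integral>N. p N * \<bar>g (x + s *\<^sub>R N)\<bar> \<partial>gauss) \<le> A * (\<integral>N. p N \<partial>gauss)"
  proof -
    have "(\<integral>N. p N * \<bar>g (x + s *\<^sub>R N)\<bar> \<partial>gauss) \<le> (\<integral>N. p N * A \<partial>gauss)"
      by (rule integral_mono[OF I]) (use p g in \<open>auto intro!: mult_left_mono\<close>)
    then show ?thesis by (simp add: mult.commute)
  qed
  have 2: "(\<integral>N. p N * \<bar>g (x + s *\<^sub>R N)\<bar> \<partial>gauss) \<le> A * C / s" if s1: "s \<ge> 1"
  proof -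
    let ?f = "\<lambda>w. p ((1 / s) *\<^sub>R w) * \<bar>g (x + w)\<bar>"
    have fs: "?f (s *\<^sub>R N) = p N * \<bar>g (x + s *\<^sub>R N)\<bar>" for N using s by simp
    have gx: "integrable lborel (\<lambda>w. \<bar>g (x + w)\<bar>)"
      using g(2) by (subst integrable_lborel_translation_iff[where f="\<lambda>w. \<bar>g w\<bar>"]) auto
    have "(\<integral>N. p N * \<bar>g (x + s *\<^sub>R N)\<bar> \<partial>gauss) = (\<integral>w. (exp (- (norm w / s)\<^sup>2) / s ^ DIM('a)) *\<^sub>R ?f w \<partial>lborel)"
      unfolding fs[symmetric] by (rule integral_gauss_scale(1)[OF s]) measurable
    also have "\<dots> \<le> (\<integral>w. C / s ^ DIM('a) * \<bar>g (x + w)\<bar> \<partial>lborel)"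
    proof (rule integral_mono)
      show "integrable lborel (\<lambda>w. (exp (- (norm w / s)\<^sup>2) / s ^ DIM('a)) *\<^sub>R ?f w)"
        using I unfolding fs[symmetric] by (subst (asm) integral_gauss_scale(2)[OF s]) auto
      fix w
      have "exp (- (norm w / s)\<^sup>2) * p ((1 / s) *\<^sub>R w) \<le> C"
        using p(3)[of "(1 / s) *\<^sub>R w"] s by simp
      then have "(exp (- (norm w / s)\<^sup>2) * p ((1 / s) *\<^sub>R w)) * (\<bar>g (x + w)\<bar> / s ^ DIM('a)) \<le> C * (\<bar>g (x + w)\<bar> / s ^ DIM('a))"
        using s by (intro mult_right_mono) auto
      then show "(exp (- (norm w / s)\<^sup>2) / s ^ DIM('a)) *\<^sub>R ?f w \<le> C / s ^ DIM('a) * \<bar>g (x + w)\<bar>"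
        by (simp add: mult_ac)
    qed (use gx in auto)
    also have "\<dots> = C / s ^ DIM('a) * (\<integral>w. \<bar>g w\<bar> \<partial>lborel)"
      by (simp add: integral_lborel_translation[where f="\<lambda>w. \<bar>g w\<bar>"])
    also have "\<dots> \<le> C / s * A"
    proof (rule mult_mono)
      have "s ^ 1 \<le> s ^ DIM('a)" using s1 by (intro power_increasing) (auto simp: Suc_leI)
      then show "C / s ^ DIM('a) \<le> C / s" using C s by (intro divide_left_mono) auto
    qed (use g C s in auto)
    finally show ?thesis by (simp add: mult.commute)
  qed
  show ?L
  proof (cases "s \<ge> 1")
    case True
    have "A * C / s \<le> A * (C + (\<integral>N. p N \<partial>gauss)) / s"
      using A P s by (intro divide_right_mono mult_left_mono) auto
    moreover have "min 1 (1 / s) = 1 / s" using True by (simp add: min_def)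
    ultimately show ?thesis using 2[OF True] by simp
  next
    case False
    have "A * (\<integral>N. p N \<partial>gauss) \<le> A * (C + (\<integral>N. p N \<partial>gauss))"
      using A C by (intro mult_left_mono) auto
    moreover have "min 1 (1 / s) = 1" using False s by (simp add: min_def)
    ultimately show ?thesis using 1 by simp
  qed
qed

subsection \<open>The heat equation in integrated form\<close>

text \<open>
  The kernel \<open>\<rho>\<^sup>-\<^sup>n exp(- |w|\<^sup>2/\<rho>\<^sup>2)\<close> has the \<open>\<rho>\<close>-derivative
  \<open>2 \<rho>\<^sup>-\<^sup>n\<^sup>-\<^sup>1 (|w|\<^sup>2/\<rho>\<^sup>2 - n/2) exp(- |w|\<^sup>2/\<rho>\<^sup>2)\<close>.
\<close>

lemma gauss_average_FTC:
  fixes g :: "'a::euclidean_space \<Rightarrow> real"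
  assumes [measurable]: "g \<in> borel_measurable borel" and gA: "\<And>x. \<bar>g x\<bar> \<le> A" and ab: "0 < a" "a \<le> b"
  shows "(\<integral>\<rho>. indicator {a..b} \<rho> * (\<integral>M. ((norm M)\<^sup>2 - DIM('a) / 2) * g (\<rho> *\<^sub>R M) \<partial>gauss) \<partial>pw 0)
    = ((\<integral>M. g (b *\<^sub>R M) \<partial>gauss) - (\<integral>M. g (a *\<^sub>R M) \<partial>gauss)) / 2"
proof -
  let ?n = "DIM('a)"
  \<comment> \<open>One factor \<rho> is split off the weighted kernel. It cancels the weight
    1/\<rho> of \<open>pw 0\<close>, and what remains is half of the \<rho>-derivative stated
    above.\<close>
  define k where "k \<rho> w = exp (- (norm w / \<rho>)\<^sup>2) / \<rho> ^ (?n + 1) * ((norm w / \<rho>)\<^sup>2 - ?n / 2)" for \<rho> and w :: 'a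
  define C where "C = A * (\<integral>M. \<bar>(norm (M::'a))\<^sup>2 - ?n / 2\<bar> \<partial>gauss)"
  have A: "0 \<le> A" using gA[of 0] by linarith
  have C: "0 \<le> C" using A by (simp add: C_def)
  have mi: "integrable gauss (\<lambda>M::'a. (norm M)\<^sup>2 - ?n / 2)"
    using integrable_gauss_norm_power[where k=2] gauss.integrable_const by (intro Bochner_Integration.integrable_diff) auto
  have mg: "integrable gauss (\<lambda>M. ((norm M)\<^sup>2 - ?n / 2) * g (\<rho> *\<^sub>R M))" for \<rho>
    by (rule Bochner_Integration.integrable_bound[where f="\<lambda>M. A * ((norm M)\<^sup>2 - ?n / 2)"])
      (use mi gA A in \<open>auto simp: abs_mult mult.commute[of A] intro!: mult_left_mono\<close>)
  have scal: "(\<integral>M. ((norm M)\<^sup>2 - ?n / 2) * g (\<rho> *\<^sub>R M) \<partial>gauss) = \<rho> * (\<integral>w. k \<rho> w * g w \<partial>lborel)"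
    "integrable lborel (\<lambda>w. k \<rho> w * g w)" "(\<integral>w. norm (k \<rho> w * g w) \<partial>lborel) \<le> C / \<rho>" if \<rho>: "\<rho> > 0" for \<rho>
  proof -
    have eq: "((norm M)\<^sup>2 - ?n / 2) * g (\<rho> *\<^sub>R M) = (\<lambda>w. ((norm w / \<rho>)\<^sup>2 - ?n / 2) * g w) (\<rho> *\<^sub>R M)" for M
      using \<rho> by simp
    have eq2: "(exp (- (norm w / \<rho>)\<^sup>2) / \<rho> ^ ?n) *\<^sub>R (((norm w / \<rho>)\<^sup>2 - ?n / 2) * g w) = \<rho> * (k \<rho> w * g w)" for w
      using \<rho> by (simp add: k_def)
    show *: "(\<integral>M. ((norm M)\<^sup>2 - ?n / 2) * g (\<rho> *\<^sub>R M) \<partial>gauss) = \<rho> * (\<integral>w. k \<rho> w * g w \<partial>lborel)"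
      unfolding eq by (subst integral_gauss_scale(1)[OF \<rho>]) (simp_all only: eq2 integral_mult_right_zero, measurable)
    have "(\<lambda>w. ((norm w / \<rho>)\<^sup>2 - ?n / 2) * g w) \<in> borel_measurable borel" by measurable
    then have "integrable lborel (\<lambda>w. \<rho> * (k \<rho> w * g w))"
      using iffD1[OF integral_gauss_scale(2)[OF \<rho>]] mg[of \<rho>] unfolding eq eq2[symmetric] by blast
    then show **: "integrable lborel (\<lambda>w. k \<rho> w * g w)" using \<rho> by simp
    have eq3: "\<bar>((norm M)\<^sup>2 - ?n / 2) * g (\<rho> *\<^sub>R M)\<bar> = (\<lambda>w. \<bar>((norm w / \<rho>)\<^sup>2 - ?n / 2) * g w\<bar>) (\<rho> *\<^sub>R M)" for M
      using \<rho> by simp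
    have eq4: "(exp (- (norm w / \<rho>)\<^sup>2) / \<rho> ^ ?n) *\<^sub>R \<bar>((norm w / \<rho>)\<^sup>2 - ?n / 2) * g w\<bar> = \<rho> * \<bar>k \<rho> w * g w\<bar>" for w
      using \<rho> by (simp add: k_def abs_mult)
    have "\<rho> * (\<integral>w. \<bar>k \<rho> w * g w\<bar> \<partial>lborel) = (\<integral>M. \<bar>((norm M)\<^sup>2 - ?n / 2) * g (\<rho> *\<^sub>R M)\<bar> \<partial>gauss)"
      unfolding eq3 by (subst integral_gauss_scale(1)[OF \<rho>]) (simp_all only: eq4 integral_mult_right_zero, measurable)
    also have "\<dots> \<le> (\<integral>M. A * \<bar>(norm (M::'a))\<^sup>2 - ?n / 2\<bar> \<partial>gauss)"
      by (rule integral_mono) (use integrable_abs[OF mg[of \<rho>]] mi gA in \<open>auto simp: abs_mult mult.commute[of A] intro!: mult_left_mono\<close>)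
    also have "\<dots> = C" by (simp add: C_def)
    finally show "(\<integral>w. norm (k \<rho> w * g w) \<partial>lborel) \<le> C / \<rho>"
      using \<rho> by (simp add: field_simps)
  qed
  have [measurable]: "(\<lambda>p. k (fst p) (snd p)) \<in> borel_measurable (borel \<Otimes>\<^sub>M borel)"
    unfolding k_def by measurable
  have FTC: "(\<integral>\<rho>. indicator {a..b} \<rho> * k \<rho> w \<partial>lborel)
      = exp (- (norm w / b)\<^sup>2) / b ^ ?n / 2 - exp (- (norm w / a)\<^sup>2) / a ^ ?n / 2" for w
  proof -
    have "(\<integral>\<rho>. indicator {a..b} \<rho> *\<^sub>R k \<rho> w \<partial>lborel)
      = exp (- (norm w / b)\<^sup>2) / b ^ ?n / 2 - exp (- (norm w / a)\<^sup>2) / a ^ ?n / 2"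
    proof (rule integral_FTC_Icc[where F="\<lambda>\<rho>. exp (- (norm w / \<rho>)\<^sup>2) / \<rho> ^ ?n / 2"])
      fix \<rho> assume "a \<le> \<rho>" "\<rho> \<le> b"
      then have \<rho>: "\<rho> > 0" using ab by simp
      have "((\<lambda>\<rho>. exp (- (norm w / \<rho>)\<^sup>2) / \<rho> ^ ?n / 2) has_real_derivative k \<rho> w) (at \<rho>)"
      proof -
        obtain m where m: "?n = Suc m" using DIM_positive[where 'a='a] gr0_implies_Suc by blast
        show ?thesis
          unfolding k_def m using \<rho>
          by (auto intro!: derivative_eq_intros simp: field_simps power2_eq_square) (cases m; simp)
      qed
      then show "((\<lambda>\<rho>. exp (- (norm w / \<rho>)\<^sup>2) / \<rho> ^ ?n / 2) has_vector_derivative k \<rho> w) (at \<rho> within {a..b})"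
        by (meson has_field_derivative_at_within has_real_derivative_iff_has_vector_derivative)
    next
      show "continuous_on {a..b} (\<lambda>\<rho>. k \<rho> w)"
        unfolding k_def using ab by (auto intro!: continuous_intros)
    qed (use ab in auto)
    then show ?thesis by simp
  qed
  have int: "integrable (lborel \<Otimes>\<^sub>M lborel) (\<lambda>(\<rho>, w). indicator {a..b} \<rho> * (k \<rho> w * g w))"
  proof (rule lborel_pair.integrable_pair_dominated[where B="\<lambda>\<rho>. indicator {a..b} \<rho> * (C / a)"])
    show "AE \<rho> in lborel. integrable lborel (\<lambda>w. case (\<rho>, w) of (\<rho>, w) \<Rightarrow> indicator {a..b} \<rho> * (k \<rho> w * g w)) \<and>
       (\<integral>w. norm (case (\<rho>, w) of (\<rho>, w) \<Rightarrow> indicator {a..b} \<rho> * (k \<rho> w * g w)) \<partial>lborel) \<le> indicator {a..b} \<rho> * (C / a)"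
    proof (rule AE_I2)
      fix \<rho> :: real
      have "C / \<rho> \<le> C / a" if "a \<le> \<rho>" using C ab that by (intro divide_left_mono) auto
      then show "integrable lborel (\<lambda>w. case (\<rho>, w) of (\<rho>, w) \<Rightarrow> indicator {a..b} \<rho> * (k \<rho> w * g w)) \<and>
       (\<integral>w. norm (case (\<rho>, w) of (\<rho>, w) \<Rightarrow> indicator {a..b} \<rho> * (k \<rho> w * g w)) \<partial>lborel) \<le> indicator {a..b} \<rho> * (C / a)"
        using scal(2,3)[of \<rho>] ab by (auto simp: indicator_def)
    qed
    have "integrable lborel (indicator {a..b} :: real \<Rightarrow> real)"
      by (rule integrable_real_indicator) (auto simp: emeasure_lborel_Icc_eq)
    then show "integrable lborel (\<lambda>\<rho>. indicator {a..b} \<rho> * (C / a))" by simp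
  qed measurable
  have gi: "integrable gauss (\<lambda>M. g (\<rho> *\<^sub>R M))" for \<rho>
    by (rule gauss.integrable_const_bound[where B=A]) (use gA in auto)
  have gb: "integrable lborel (\<lambda>w. (exp (- (norm w / \<rho>)\<^sup>2) / \<rho> ^ ?n) *\<^sub>R g w)" if "\<rho> > 0" for \<rho>
    using gi[of \<rho>] that by (subst (asm) integral_gauss_scale(2)) auto
  have "(\<integral>\<rho>. indicator {a..b} \<rho> * (\<integral>M. ((norm M)\<^sup>2 - DIM('a) / 2) * g (\<rho> *\<^sub>R M) \<partial>gauss) \<partial>pw 0)
     = (\<integral>\<rho>. (\<integral>w. indicator {a..b} \<rho> * (k \<rho> w * g w) \<partial>lborel) \<partial>lborel)"
  proof (subst integral_pw)
    show "(\<lambda>\<rho>. indicator {a..b} \<rho> * (\<integral>M. ((norm M)\<^sup>2 - DIM('a) / 2) * g (\<rho> *\<^sub>R M) \<partial>gauss)) \<in> borel_measurable borel"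
      by measurable
    show "(\<integral>\<rho>. (indicator {0<..} \<rho> * \<rho> powr (0 - 1)) *\<^sub>R (indicator {a..b} \<rho> * (\<integral>M. ((norm M)\<^sup>2 - DIM('a) / 2) * g (\<rho> *\<^sub>R M) \<partial>gauss)) \<partial>lborel)
      = (\<integral>\<rho>. (\<integral>w. indicator {a..b} \<rho> * (k \<rho> w * g w) \<partial>lborel) \<partial>lborel)"
    proof (rule Bochner_Integration.integral_cong[OF refl])
      fix \<rho> :: real
      show "(indicator {0<..} \<rho> * \<rho> powr (0 - 1)) *\<^sub>R (indicator {a..b} \<rho> * (\<integral>M. ((norm M)\<^sup>2 - DIM('a) / 2) * g (\<rho> *\<^sub>R M) \<partial>gauss))
        = (\<integral>w. indicator {a..b} \<rho> * (k \<rho> w * g w) \<partial>lborel)"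
      proof (cases "\<rho> \<in> {a..b}")
        case True
        then have "\<rho> > 0" using ab by simp
        then show ?thesis by (simp add: scal(1) True powr_minus)
      qed simp
    qed
  qed
  also have "\<dots> = (\<integral>w. (\<integral>\<rho>. indicator {a..b} \<rho> * (k \<rho> w * g w) \<partial>lborel) \<partial>lborel)"
    by (rule lborel_pair.Fubini_integral[symmetric, OF int])
  also have "\<dots> = (\<integral>w. ((exp (- (norm w / b)\<^sup>2) / b ^ ?n) *\<^sub>R g w - (exp (- (norm w / a)\<^sup>2) / a ^ ?n) *\<^sub>R g w) / 2 \<partial>lborel)"
  proof (rule Bochner_Integration.integral_cong[OF refl])
    fix w
    have "(\<integral>\<rho>. indicator {a..b} \<rho> * (k \<rho> w * g w) \<partial>lborel) = (\<integral>\<rho>. (indicator {a..b} \<rho> * k \<rho> w) * g w \<partial>lborel)"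
      by (simp add: mult.assoc)
    also have "\<dots> = (\<integral>\<rho>. (indicator {a..b} \<rho> * k \<rho> w) \<partial>lborel) * g w"
      by (rule integral_mult_left_zero)
    finally show "(\<integral>\<rho>. indicator {a..b} \<rho> * (k \<rho> w * g w) \<partial>lborel)
      = ((exp (- (norm w / b)\<^sup>2) / b ^ ?n) *\<^sub>R g w - (exp (- (norm w / a)\<^sup>2) / a ^ ?n) *\<^sub>R g w) / 2"
      unfolding FTC by (simp add: diff_divide_distrib left_diff_distrib)
  qed
  also have "\<dots> = ((\<integral>M. g (b *\<^sub>R M) \<partial>gauss) - (\<integral>M. g (a *\<^sub>R M) \<partial>gauss)) / 2"
    using ab gb[of a] gb[of b] by (simp add: integral_gauss_scale)
  finally show ?thesis .
qed

text \<open>No moment has to be computed: for constant g the scale derivative integrates to zero,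
  while the left-hand side is this moment times the positive finite mass of a scale
  interval.\<close>

lemma gauss_second_moment:
  "(\<integral>M. (norm (M::'a::euclidean_space))\<^sup>2 - DIM('a) / 2 \<partial>gauss) = 0"
proof -
  let ?c = "(\<integral>M. (norm (M::'a::euclidean_space))\<^sup>2 - DIM('a) / 2 \<partial>gauss)"
  have "(\<integral>\<rho>. indicator {1..2} \<rho> * ?c \<partial>pw 0) = 0"
    using gauss_average_FTC[of "\<lambda>_::'a. 1" 1 1 2] by simp
  moreover have "(\<integral>\<rho>. indicator {1..2} \<rho> * ?c \<partial>pw 0) = measure (pw 0) {1..2} * ?c"
    by simp
  moreover have "emeasure (pw 0) {1..2} \<noteq> 0"
  proof
    assume "emeasure (pw 0) {1..2} = 0"
    then have "AE t in lborel. t \<notin> {1..2::real}"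
      by (auto simp: pw_def emeasure_density nn_integral_0_iff_AE indicator_def split: if_splits elim!: eventually_mono)
    then have "emeasure lborel {1..2::real} = 0"
      by (subst (asm) AE_iff_measurable[where N="{1..2}"]) auto
    then show False by simp
  qed
  moreover have "emeasure (pw 0) {1..2} \<noteq> \<infinity>"
  proof -
    have "emeasure (pw 0) {1..2} \<le> (\<integral>\<^sup>+t. indicator {1..2::real} t \<partial>lborel)"
      unfolding pw_def
    proof (subst emeasure_density, measurable, rule nn_integral_mono)
      fix t :: real
      show "ennreal (indicator {0<..} t * t powr (0 - 1)) * indicator {1..2} t \<le> indicator {1..2} t"
        by (auto simp: indicator_def powr_minus divide_simps split: if_splits intro!: ennreal_le_1[THEN iffD2])
    qed
    also have "\<dots> = 1" by simp
    finally show ?thesis by (auto simp: top_unique)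
  qed
  ultimately show ?thesis by (simp add: measure_def enn2real_eq_0_iff)
qed

interpretation pw: sigma_finite_measure "pw a" for a
  by (rule sigma_finite_pw)

interpretation gauss_pw: pair_sigma_finite "gauss :: 'a::euclidean_space measure" "pw a" for a ..

interpretation pw_gauss: pair_sigma_finite "pw a" "gauss :: 'a::euclidean_space measure" for a ..

interpretation pw_pw: pair_sigma_finite "pw a" "pw b" for a b ..

section \<open>Fractional divergence and Riesz kernel as Gaussian superpositions\<close>

text \<open>Exactly the two bounds that make the divergence converge: the Lipschitz bound at small
  scales, the sup bound at large ones. A single constant makes all estimates linear in
  \<open>B\<close>.\<close>

definition bounded_lipschitz :: "real \<Rightarrow> ('a::real_normed_vector \<Rightarrow> 'b::real_normed_vector) \<Rightarrow> bool" where
  "bounded_lipschitz B f \<longleftrightarrow> (\<forall>x. norm (f x) \<le> B) \<and> (\<forall>x y. norm (f x - f y) \<le> B * norm (x - y))"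

text \<open>The counterpart for the Riesz potential: the sup bound serves small scales and the L^1
  bound large ones.\<close>

definition bounded_L1 :: "real \<Rightarrow> ('a::euclidean_space \<Rightarrow> real) \<Rightarrow> bool" where
  "bounded_L1 A g \<longleftrightarrow> (\<forall>x. \<bar>g x\<bar> \<le> A) \<and> integrable lborel g \<and> (\<integral>x. \<bar>g x\<bar> \<partial>lborel) \<le> A"

text \<open>Up to a constant, \<open>gauss_div\<close> is \<open>div\<^sup>\<alpha>\<close> and \<open>riesz\<close> is convolution with \<open>x/|x|\<^sup>n\<^sup>+\<^sup>1\<^sup>-\<^sup>\<alpha>\<close>.\<close>

definition gauss_div :: "real \<Rightarrow> ('a::euclidean_space \<Rightarrow> 'a) \<Rightarrow> 'a \<Rightarrow> real" where
  "gauss_div \<alpha> \<phi> x = (\<integral>t. (\<integral>N. N \<bullet> \<phi> (x + t *\<^sub>R N) \<partial>gauss) \<partial>pw (- \<alpha>))"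

definition riesz :: "real \<Rightarrow> ('a::euclidean_space \<Rightarrow> real) \<Rightarrow> 'a \<Rightarrow> 'a" where
  "riesz \<alpha> g x = (\<integral>s. (\<integral>N. g (x + s *\<^sub>R N) *\<^sub>R N \<partial>gauss) \<partial>pw \<alpha>)"

lemma bounded_lipschitz_borel:
  fixes f :: "'a::euclidean_space \<Rightarrow> 'b::euclidean_space"
  assumes "bounded_lipschitz B f" shows "f \<in> borel_measurable borel"
proof -
  have "0 \<le> B" using assms norm_ge_zero order_trans unfolding bounded_lipschitz_def by blast
  then have "B-lipschitz_on UNIV f"
    using assms by (intro lipschitz_onI) (auto simp: bounded_lipschitz_def dist_norm)
  then show ?thesis
    using lipschitz_on_continuous_on borel_measurable_continuous_onI by blast
qed

lemma Cc_infinity_bounded_lipschitz: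
  fixes f :: "'a::euclidean_space \<Rightarrow> 'b::real_normed_vector"
  assumes "f \<in> Cc_infinity"
  obtains B where "B > 0" and "bounded_lipschitz B f"
proof -
  obtain B where B: "B > 0" "\<forall>x. norm (f x) \<le> B" by (rule Cc_infinity_boundedE[OF assms])
  obtain L where L: "L > 0" "\<forall>x y. norm (f x - f y) \<le> L * norm (x - y)" by (rule Cc_infinity_lipschitzE[OF assms])
  have "bounded_lipschitz (B + L) f"
    unfolding bounded_lipschitz_def
  proof (intro conjI allI)
    show "norm (f x) \<le> B + L" for x using B(2) L(1) by (simp add: add_increasing2)
    have "L * norm (x - y) \<le> (B + L) * norm (x - y)" for x y :: 'a
      using B(1) by (intro mult_right_mono) auto
    then show "norm (f x - f y) \<le> (B + L) * norm (x - y)" for x y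
      using L(2) order_trans by blast
  qed
  then show ?thesis using that[of "B + L"] B(1) L(1) by simp
qed

subsection \<open>The Gaussian divergence\<close>

lemma gauss_integrable_inner:
  fixes \<phi> :: "'a::euclidean_space \<Rightarrow> 'a"
  assumes "bounded_lipschitz B \<phi>"
  shows "integrable gauss (\<lambda>N. N \<bullet> \<phi> (x + t *\<^sub>R N))"
proof (rule integrable_gauss_bound[where k=1 and C=B])
  note [measurable] = bounded_lipschitz_borel[OF assms]
  show "(\<lambda>N. N \<bullet> \<phi> (x + t *\<^sub>R N)) \<in> borel_measurable borel" by measurable
  fix N
  have "norm (N \<bullet> \<phi> (x + t *\<^sub>R N)) \<le> norm N * norm (\<phi> (x + t *\<^sub>R N))"
    using Cauchy_Schwarz_ineq2 by simp
  also have "\<dots> \<le> norm N * B"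
    using assms by (intro mult_left_mono) (auto simp: bounded_lipschitz_def)
  finally show "norm (N \<bullet> \<phi> (x + t *\<^sub>R N)) \<le> B * norm N ^ 1" by (simp add: mult.commute)
qed

text \<open>Since N has mean zero, \<phi> x may be subtracted for free. The increment then supplies
  the factor t at small scales that the singular weight of \<open>pw (- \<alpha>)\<close>
  requires.\<close>

lemma gauss_inner_bound:
  fixes \<phi> :: "'a::euclidean_space \<Rightarrow> 'a"
  assumes bl: "bounded_lipschitz B \<phi>" and t: "0 < t"
  shows "(\<integral>N. \<bar>N \<bullet> (\<phi> (x + t *\<^sub>R N) - \<phi> x)\<bar> \<partial>gauss) \<le> B * (\<integral>N. 2 * norm N + (norm (N::'a))\<^sup>2 \<partial>gauss) * min 1 t"
    and "integrable gauss (\<lambda>N. N \<bullet> (\<phi> (x + t *\<^sub>R N) - \<phi> x))"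
    and "(\<integral>N. N \<bullet> \<phi> (x + t *\<^sub>R N) \<partial>gauss) = (\<integral>N. N \<bullet> (\<phi> (x + t *\<^sub>R N) - \<phi> x) \<partial>gauss)"
proof -
  note [measurable] = bounded_lipschitz_borel[OF bl]
  have B: "0 \<le> B" "norm (\<phi> y) \<le> B" "norm (\<phi> y - \<phi> z) \<le> B * norm (y - z)" for y z
    using bl norm_ge_zero order_trans unfolding bounded_lipschitz_def by blast+
  have i0: "integrable gauss (\<lambda>N. N \<bullet> \<phi> x)"
    by (rule integrable_gauss_bound[where k=1 and C="norm (\<phi> x)"])
      (use Cauchy_Schwarz_ineq2 in \<open>auto simp: mult.commute\<close>)
  have z: "(\<integral>N. N \<bullet> \<phi> x \<partial>gauss) = 0"
    by (rule integral_gauss_odd) auto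
  show i: "integrable gauss (\<lambda>N. N \<bullet> (\<phi> (x + t *\<^sub>R N) - \<phi> x))"
    using i0 gauss_integrable_inner[OF bl] by (simp add: inner_diff_right)
  show "(\<integral>N. N \<bullet> \<phi> (x + t *\<^sub>R N) \<partial>gauss) = (\<integral>N. N \<bullet> (\<phi> (x + t *\<^sub>R N) - \<phi> x) \<partial>gauss)"
    using i0 gauss_integrable_inner[OF bl] z by (simp add: inner_diff_right)
  have pt: "\<bar>N \<bullet> (\<phi> (x + t *\<^sub>R N) - \<phi> x)\<bar> \<le> B * min 1 t * (2 * norm N + (norm N)\<^sup>2)" for N
  proof -
    have cs: "\<bar>N \<bullet> (\<phi> (x + t *\<^sub>R N) - \<phi> x)\<bar> \<le> norm N * norm (\<phi> (x + t *\<^sub>R N) - \<phi> x)"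
      by (rule Cauchy_Schwarz_ineq2)
    show ?thesis
    proof (cases "t \<le> 1")
      case True
      have "norm (\<phi> (x + t *\<^sub>R N) - \<phi> x) \<le> B * (t * norm N)"
        using B(3)[of "x + t *\<^sub>R N" x] t by simp
      then have "norm N * norm (\<phi> (x + t *\<^sub>R N) - \<phi> x) \<le> norm N * (B * (t * norm N))"
        by (intro mult_left_mono) auto
      also have "\<dots> = B * min 1 t * (norm N)\<^sup>2" using True by (simp add: power2_eq_square min_def)
      also have "\<dots> \<le> B * min 1 t * (2 * norm N + (norm N)\<^sup>2)"
        using B t by (intro mult_left_mono) auto
      finally show ?thesis using cs by linarith
    next
      case False
      have "norm (\<phi> (x + t *\<^sub>R N) - \<phi> x) \<le> 2 * B"
        using norm_triangle_ineq4[of "\<phi> (x + t *\<^sub>R N)" "\<phi> x"] B(2)[of "x + t *\<^sub>R N"] B(2)[of x] by linarith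
      then have "norm N * norm (\<phi> (x + t *\<^sub>R N) - \<phi> x) \<le> norm N * (2 * B)"
        by (intro mult_left_mono) auto
      also have "\<dots> = B * min 1 t * (2 * norm N)" using False by (simp add: min_def)
      also have "\<dots> \<le> B * min 1 t * (2 * norm N + (norm N)\<^sup>2)"
        using B t by (intro mult_left_mono) auto
      finally show ?thesis using cs by linarith
    qed
  qed
  have m: "integrable gauss (\<lambda>N::'a. 2 * norm N + (norm N)\<^sup>2)"
    using integrable_gauss_norm integrable_gauss_norm_power[where k=2] by auto
  have "(\<integral>N. \<bar>N \<bullet> (\<phi> (x + t *\<^sub>R N) - \<phi> x)\<bar> \<partial>gauss) \<le> (\<integral>N. B * min 1 t * (2 * norm N + (norm (N::'a))\<^sup>2) \<partial>gauss)"
    by (rule integral_mono) (use i m pt in \<open>auto simp del: distrib_left_numeral\<close>)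
  also have "\<dots> = B * (\<integral>N. 2 * norm N + (norm (N::'a))\<^sup>2 \<partial>gauss) * min 1 t"
    by (subst integral_mult_right_zero) (simp add: mult_ac)
  finally show "(\<integral>N. \<bar>N \<bullet> (\<phi> (x + t *\<^sub>R N) - \<phi> x)\<bar> \<partial>gauss) \<le> B * (\<integral>N. 2 * norm N + (norm (N::'a))\<^sup>2 \<partial>gauss) * min 1 t" .
qed

lemma gauss_inner_norm_bound:
  fixes \<phi> :: "'a::euclidean_space \<Rightarrow> 'a"
  assumes bl: "bounded_lipschitz B \<phi>" and t: "0 < t"
  shows "\<bar>\<integral>N. N \<bullet> \<phi> (x + t *\<^sub>R N) \<partial>gauss\<bar> \<le> B * (\<integral>N. 2 * norm N + (norm (N::'a))\<^sup>2 \<partial>gauss) * min 1 t"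
  unfolding gauss_inner_bound(3)[OF bl t]
  using integral_abs_bound[of gauss "\<lambda>N. N \<bullet> (\<phi> (x + t *\<^sub>R N) - \<phi> x)"] gauss_inner_bound(1)[OF bl t, of x]
  by linarith

lemma gauss_div_integrable:
  fixes \<phi> :: "'a::euclidean_space \<Rightarrow> 'a"
  assumes \<alpha>: "0 < \<alpha>" "\<alpha> < 1" and bl: "bounded_lipschitz B \<phi>"
  shows "integrable (pw (- \<alpha>)) (\<lambda>t. \<integral>N. N \<bullet> \<phi> (x + t *\<^sub>R N) \<partial>gauss)"
proof (rule integrable_pw_neg[OF \<alpha>])
  note [measurable] = bounded_lipschitz_borel[OF bl]
  show "(\<lambda>t. \<integral>N. N \<bullet> \<phi> (x + t *\<^sub>R N) \<partial>gauss) \<in> borel_measurable borel" by measurable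
qed (use gauss_inner_norm_bound[OF bl] in simp)

lemma gauss_div_borel:
  fixes \<phi> :: "'a::euclidean_space \<Rightarrow> 'a"
  assumes "bounded_lipschitz B \<phi>"
  shows "gauss_div \<alpha> \<phi> \<in> borel_measurable borel"
proof -
  note [measurable] = bounded_lipschitz_borel[OF assms]
  show ?thesis unfolding gauss_div_def by measurable
qed

definition gauss_div_const :: "'a::euclidean_space itself \<Rightarrow> real \<Rightarrow> real" where
  "gauss_div_const _ \<alpha> = (\<integral>N. 2 * norm N + (norm (N::'a))\<^sup>2 \<partial>gauss) * (\<integral>t. min 1 t \<partial>pw (- \<alpha>))"

lemma gauss_div_bound:
  fixes \<phi> :: "'a::euclidean_space \<Rightarrow> 'a"
  assumes \<alpha>: "0 < \<alpha>" "\<alpha> < 1" and bl: "bounded_lipschitz B \<phi>"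
  shows "\<bar>gauss_div \<alpha> \<phi> x\<bar> \<le> B * gauss_div_const TYPE('a) \<alpha>"
proof -
  have m: "integrable (pw (- \<alpha>)) (\<lambda>t. min 1 t)"
    by (rule integrable_pw_neg[OF \<alpha>, where C=1]) auto
  have "\<bar>gauss_div \<alpha> \<phi> x\<bar> \<le> (\<integral>t. \<bar>\<integral>N. N \<bullet> \<phi> (x + t *\<^sub>R N) \<partial>gauss\<bar> \<partial>pw (- \<alpha>))"
    unfolding gauss_div_def by (rule integral_abs_bound)
  also have "\<dots> \<le> (\<integral>t. B * (\<integral>N. 2 * norm N + (norm (N::'a))\<^sup>2 \<partial>gauss) * min 1 t \<partial>pw (- \<alpha>))"
  proof (rule integral_mono_AE)
    show "AE t in pw (- \<alpha>). \<bar>\<integral>N. N \<bullet> \<phi> (x + t *\<^sub>R N) \<partial>gauss\<bar> \<le> B * (\<integral>N. 2 * norm N + (norm (N::'a))\<^sup>2 \<partial>gauss) * min 1 t"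
      using AE_pw_pos by eventually_elim (rule gauss_inner_norm_bound[OF bl])
  qed (use gauss_div_integrable[OF \<alpha> bl, of x] m in auto)
  finally show ?thesis by (simp add: gauss_div_const_def mult.assoc)
qed

lemma gauss_div_diff:
  fixes \<phi> \<psi> :: "'a::euclidean_space \<Rightarrow> 'a"
  assumes \<alpha>: "0 < \<alpha>" "\<alpha> < 1" and bl: "bounded_lipschitz B \<phi>" "bounded_lipschitz B' \<psi>"
  shows "gauss_div \<alpha> (\<lambda>x. \<phi> x - \<psi> x) x = gauss_div \<alpha> \<phi> x - gauss_div \<alpha> \<psi> x"
  unfolding gauss_div_def
  using gauss_div_integrable[OF \<alpha> bl(1), of x] gauss_div_integrable[OF \<alpha> bl(2), of x]
    gauss_integrable_inner[OF bl(1)] gauss_integrable_inner[OF bl(2)]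
  by (simp add: inner_diff_right)

lemma gauss_div_scaleR: "gauss_div \<alpha> (\<lambda>x. c *\<^sub>R \<phi> x) x = c * gauss_div \<alpha> \<phi> x"
  by (simp add: gauss_div_def)

lemma gauss_div_dilate:
  fixes \<phi> :: "'a::euclidean_space \<Rightarrow> 'a"
  assumes c: "0 < c" and bl: "bounded_lipschitz B \<phi>"
  shows "gauss_div \<alpha> (\<lambda>x. \<phi> (c *\<^sub>R x)) x = c powr \<alpha> * gauss_div \<alpha> \<phi> (c *\<^sub>R x)"
proof -
  note [measurable] = bounded_lipschitz_borel[OF bl]
  have "gauss_div \<alpha> (\<lambda>x. \<phi> (c *\<^sub>R x)) x = (\<integral>t. (\<lambda>t. \<integral>N. N \<bullet> \<phi> (c *\<^sub>R x + t *\<^sub>R N) \<partial>gauss) (c * t) \<partial>pw (- \<alpha>))"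
    by (simp add: gauss_div_def scaleR_add_right)
  also have "\<dots> = c powr \<alpha> * gauss_div \<alpha> \<phi> (c *\<^sub>R x)"
    by (subst pw_scale[OF c]) (simp_all add: gauss_div_def)
  finally show ?thesis .
qed

subsection \<open>The Riesz kernel\<close>

lemma bounded_L1_borel: "bounded_L1 A g \<Longrightarrow> g \<in> borel_measurable borel"
  unfolding bounded_L1_def by (auto dest: borel_measurable_integrable)

lemma bounded_L1_average_decay:
  fixes g :: "'a::euclidean_space \<Rightarrow> real"
  assumes bd: "bounded_L1 A g" and s: "0 < s"
  shows "integrable gauss (\<lambda>N. norm N * \<bar>g (x + s *\<^sub>R N)\<bar>)"
    and "(\<integral>N. norm N * \<bar>g (x + s *\<^sub>R N)\<bar> \<partial>gauss) \<le> A * (1 + (\<integral>N. norm (N::'a) \<partial>gauss)) * min 1 (1 / s)"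
    and "integrable gauss (\<lambda>N. g (x + s *\<^sub>R N) *\<^sub>R N)"
    and "norm (\<integral>N. g (x + s *\<^sub>R N) *\<^sub>R N \<partial>gauss) \<le> A * (1 + (\<integral>N. norm (N::'a) \<partial>gauss)) * min 1 (1 / s)"
proof -
  note [measurable] = bounded_L1_borel[OF bd]
  have ne: "exp (- (norm N)\<^sup>2) * norm N \<le> 1" for N :: 'a
  proof -
    have "2 * norm N \<le> 1 + (norm N)\<^sup>2"
      using zero_le_power2[of "norm N - 1"] by (simp add: power2_eq_square algebra_simps)
    then have "norm N \<le> 1 + (norm N)\<^sup>2"
      using norm_ge_zero[of N] by linarith
    also have "\<dots> \<le> exp ((norm N)\<^sup>2)" by (rule exp_ge_add_one_self)
    finally show ?thesis by (simp add: exp_minus field_simps)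
  qed
  have *: "\<bar>g x\<bar> \<le> A" "integrable lborel g" "(\<integral>x. \<bar>g x\<bar> \<partial>lborel) \<le> A" for x
    using bd unfolding bounded_L1_def by auto
  show 1: "integrable gauss (\<lambda>N. norm N * \<bar>g (x + s *\<^sub>R N)\<bar>)"
    by (rule gauss_weighted_integral_decay(1)[where p=norm and C=1 and A=A]) (use * ne s integrable_gauss_norm in auto)
  show 2: "(\<integral>N. norm N * \<bar>g (x + s *\<^sub>R N)\<bar> \<partial>gauss) \<le> A * (1 + (\<integral>N. norm (N::'a) \<partial>gauss)) * min 1 (1 / s)"
    by (rule gauss_weighted_integral_decay(2)[where p=norm and C=1 and A=A]) (use * ne s integrable_gauss_norm in auto)
  show "integrable gauss (\<lambda>N. g (x + s *\<^sub>R N) *\<^sub>R N)"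
    by (rule Bochner_Integration.integrable_bound[OF 1]) (auto simp: mult.commute)
  have "norm (\<integral>N. g (x + s *\<^sub>R N) *\<^sub>R N \<partial>gauss) \<le> (\<integral>N. norm (g (x + s *\<^sub>R N) *\<^sub>R N) \<partial>gauss)"
    by (rule integral_norm_bound)
  also have "\<dots> = (\<integral>N. norm N * \<bar>g (x + s *\<^sub>R N)\<bar> \<partial>gauss)" by (simp add: mult.commute)
  finally show "norm (\<integral>N. g (x + s *\<^sub>R N) *\<^sub>R N \<partial>gauss) \<le> A * (1 + (\<integral>N. norm (N::'a) \<partial>gauss)) * min 1 (1 / s)"
    using 2 by linarith
qed

lemma riesz_integrable:
  fixes g :: "'a::euclidean_space \<Rightarrow> real"
  assumes \<alpha>: "0 < \<alpha>" "\<alpha> < 1" and bd: "bounded_L1 A g"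
  shows "integrable (pw \<alpha>) (\<lambda>s. \<integral>N. g (x + s *\<^sub>R N) *\<^sub>R N \<partial>gauss)"
proof (rule integrable_pw_bound[OF \<alpha>])
  note [measurable] = bounded_L1_borel[OF bd]
  show "(\<lambda>s. \<integral>N. g (x + s *\<^sub>R N) *\<^sub>R N \<partial>gauss) \<in> borel_measurable borel" by measurable
qed (rule bounded_L1_average_decay(4)[OF bd])

lemma riesz_bound:
  fixes g :: "'a::euclidean_space \<Rightarrow> real"
  assumes \<alpha>: "0 < \<alpha>" "\<alpha> < 1" and bd: "bounded_L1 A g"
  shows "norm (riesz \<alpha> g x) \<le> (1 + (\<integral>N. norm (N::'a) \<partial>gauss)) * pw_const \<alpha> * A"
proof -
  have "norm (riesz \<alpha> g x) \<le> (\<integral>s. norm (\<integral>N. g (x + s *\<^sub>R N) *\<^sub>R N \<partial>gauss) \<partial>pw \<alpha>)"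
    unfolding riesz_def by (rule integral_norm_bound)
  also have "\<dots> \<le> (\<integral>s. A * (1 + (\<integral>N. norm (N::'a) \<partial>gauss)) * min 1 (1 / s) \<partial>pw \<alpha>)"
  proof (rule integral_mono_AE)
    show "AE s in pw \<alpha>. norm (\<integral>N. g (x + s *\<^sub>R N) *\<^sub>R N \<partial>gauss) \<le> A * (1 + (\<integral>N. norm (N::'a) \<partial>gauss)) * min 1 (1 / s)"
      using AE_pw_pos by eventually_elim (rule bounded_L1_average_decay(4)[OF bd])
  qed (use riesz_integrable[OF \<alpha> bd, of x] integrable_pw_min[OF \<alpha>] in auto)
  finally show ?thesis by (simp add: pw_const_def mult_ac)
qed

lemma riesz_diff:
  fixes g :: "'a::euclidean_space \<Rightarrow> real"
  assumes \<alpha>: "0 < \<alpha>" "\<alpha> < 1" and bd: "bounded_L1 A g" "bounded_L1 B h"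
  shows "riesz \<alpha> (\<lambda>x. g x - h x) x = riesz \<alpha> g x - riesz \<alpha> h x"
proof -
  have "riesz \<alpha> (\<lambda>x. g x - h x) x = (\<integral>s. (\<integral>N. g (x + s *\<^sub>R N) *\<^sub>R N \<partial>gauss) - (\<integral>N. h (x + s *\<^sub>R N) *\<^sub>R N \<partial>gauss) \<partial>pw \<alpha>)"
    unfolding riesz_def
  proof (rule integral_cong_AE)
    show "AE s in pw \<alpha>. (\<integral>N. (g (x + s *\<^sub>R N) - h (x + s *\<^sub>R N)) *\<^sub>R N \<partial>gauss)
       = (\<integral>N. g (x + s *\<^sub>R N) *\<^sub>R N \<partial>gauss) - (\<integral>N. h (x + s *\<^sub>R N) *\<^sub>R N \<partial>gauss)"
      using AE_pw_pos
      by eventually_elim (use bounded_L1_average_decay(3)[OF bd(1)] bounded_L1_average_decay(3)[OF bd(2)] in \<open>simp add: scaleR_diff_left\<close>)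
  qed (use bounded_L1_borel[OF bd(1), measurable] bounded_L1_borel[OF bd(2), measurable] in measurable)
  then show ?thesis
    using riesz_integrable[OF \<alpha> bd(1)] riesz_integrable[OF \<alpha> bd(2)] by (simp add: riesz_def)
qed

lemma bounded_L1_translate:
  assumes "bounded_L1 A g" shows "bounded_L1 A (\<lambda>x. g (x + v))"
  using assms integrable_lborel_translation_iff[of g v] integral_lborel_translation[of "\<lambda>x. \<bar>g x\<bar>" v]
    bounded_L1_borel[OF assms]
  by (auto simp: bounded_L1_def add.commute)

text \<open>Scales and Gaussian vectors are both cut off, which gives a kernel of bounded support.
  The truncation is chosen before A and g: it can then be applied to g and to all its increments at
  once, and this controls the Lipschitz constant of the error too.\<close>

lemma riesz_truncation:
  assumes \<alpha>: "0 < \<alpha>" "\<alpha> < 1" and e: "0 < e"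
  obtains m :: "real \<times> 'a::euclidean_space \<Rightarrow> 'a" and R
  where "integrable (pw \<alpha> \<Otimes>\<^sub>M gauss) m" and "\<forall>w. m w \<noteq> 0 \<longrightarrow> norm (fst w *\<^sub>R snd w) \<le> R"
    and "\<forall>A g x. bounded_L1 A g \<longrightarrow>
      norm (riesz \<alpha> g x - (\<integral>w. g (x + fst w *\<^sub>R snd w) *\<^sub>R m w \<partial>(pw \<alpha> \<Otimes>\<^sub>M gauss))) \<le> e * A"
proof -
  define G1 where "G1 = 1 + (\<integral>N. norm (N::'a) \<partial>gauss)"
  define G2 where "G2 = (\<integral>N. (norm (N::'a))\<^sup>2 \<partial>gauss)"
  have G1: "1 \<le> G1" by (simp add: G1_def)
  have G2: "0 \<le> G2" by (simp add: G2_def)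
  \<comment> \<open>\<open>A * E S s\<close> will bound the error at scale s. Beyond S the whole
    average is lost; below S only vectors with |N| > S are, and there |N| \<le> |N|^2 / S gives
    \<open>G2 / S\<close>. Dominated convergence makes the total small.\<close>
  define E where "E S s = (if s > S then G1 * min 1 (1 / s) else min (G1 * min 1 (1 / s)) (G2 / S))" for S s :: real
  have Em [measurable]: "E S \<in> borel_measurable borel" for S unfolding E_def by measurable
  have E0: "0 \<le> E S s" and E1: "E S s \<le> G1 * min 1 (1 / s)" if "0 < s" "0 < S" for S s
    using that G1 G2 by (auto simp: E_def)
  have Ei: "integrable (pw \<alpha>) (E S)" if "0 < S" for S
    by (rule integrable_pw_bound[OF \<alpha>, where C=G1]) (use E0 E1 that in auto)
  have "(\<lambda>k. \<integral>s. E (real (Suc k)) s \<partial>pw \<alpha>) \<longlonglongrightarrow> (\<integral>s. 0 \<partial>pw \<alpha>)"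
  proof (rule integral_dominated_convergence[where w="\<lambda>s. G1 * min 1 (1 / s)"])
    show "integrable (pw \<alpha>) (\<lambda>s. G1 * min 1 (1 / s))" using integrable_pw_min[OF \<alpha>] by simp
    show "AE s in pw \<alpha>. norm (E (real (Suc k)) s) \<le> G1 * min 1 (1 / s)" for k
      using AE_pw_pos by eventually_elim (use E0 E1 in auto)
    show "AE s in pw \<alpha>. (\<lambda>k. E (real (Suc k)) s) \<longlonglongrightarrow> 0"
      using AE_pw_pos
    proof eventually_elim
      case (elim s)
      have "(\<lambda>k. G2 / real (Suc k)) \<longlonglongrightarrow> 0"
        using LIMSEQ_Suc[OF lim_const_over_n[of G2]] by simp
      moreover have "eventually (\<lambda>k. norm (E (real (Suc k)) s) \<le> G2 / real (Suc k)) sequentially"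
        using eventually_ge_at_top[of "nat \<lceil>s\<rceil>"]
      proof eventually_elim
        case (elim k)
        then have "s \<le> real (Suc k)" by linarith
        then show ?case using E0[OF \<open>0 < s\<close>, of "real (Suc k)"] by (simp add: E_def)
      qed
      ultimately show ?case by (rule Lim_null_comparison[rotated])
    qed
  qed auto
  then have "eventually (\<lambda>k. (\<integral>s. E (real (Suc k)) s \<partial>pw \<alpha>) < e) sequentially"
    by (intro order_tendstoD[where a=e]) (use e in auto)
  then obtain k where k: "(\<integral>s. E (real (Suc k)) s \<partial>pw \<alpha>) < e"
    by (meson eventually_happens trivial_limit_sequentially)
  define S where "S = real (Suc k)"
  have S: "1 \<le> S" "0 < S" by (auto simp: S_def)
  define m where "m w = (if 0 < fst w \<and> fst w \<le> S \<and> norm (snd w) \<le> S then snd w else 0)" for w :: "real \<times> 'a"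
  have [measurable]: "m \<in> borel_measurable (borel \<Otimes>\<^sub>M borel)" unfolding m_def by measurable
  have mi: "integrable (pw \<alpha> \<Otimes>\<^sub>M gauss) m"
  proof (rule pw_gauss.integrable_pair_dominated[where B="\<lambda>s. S * (\<integral>N. norm (N::'a) \<partial>gauss) * min 1 (1 / s)"])
    show "integrable (pw \<alpha>) (\<lambda>s. S * (\<integral>N. norm (N::'a) \<partial>gauss) * min 1 (1 / s))"
      using integrable_pw_min[OF \<alpha>] by simp
    show "AE s in pw \<alpha>. integrable gauss (\<lambda>N. m (s, N)) \<and> (\<integral>N. norm (m (s, N)) \<partial>gauss) \<le> S * (\<integral>N. norm (N::'a) \<partial>gauss) * min 1 (1 / s)"
      using AE_pw_pos
    proof eventually_elim
      case (elim s)
      have i: "integrable gauss (\<lambda>N. m (s, N))"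
        by (rule integrable_gauss_bound[where k=1 and C=1]) (measurable, auto simp: m_def)
      have "norm (m (s, N)) \<le> S * min 1 (1 / s) * norm N" for N
      proof (cases "s \<le> S \<and> norm N \<le> S")
        case True
        then have "1 \<le> S * min 1 (1 / s)" using S elim by (auto simp: min_def field_simps)
        then have "1 * norm N \<le> S * min 1 (1 / s) * norm N" by (intro mult_right_mono) auto
        then show ?thesis using True elim by (simp add: m_def)
      qed (use S elim in \<open>auto simp: m_def\<close>)
      then have "(\<integral>N. norm (m (s, N)) \<partial>gauss) \<le> (\<integral>N. S * min 1 (1 / s) * norm (N::'a) \<partial>gauss)"
        using i integrable_gauss_norm by (intro integral_mono) auto
      also have "\<dots> = S * (\<integral>N. norm (N::'a) \<partial>gauss) * min 1 (1 / s)"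
        by (simp add: mult_ac)
      finally show ?case using i by blast
    qed
  qed measurable
  have supp: "\<forall>w. m w \<noteq> 0 \<longrightarrow> norm (fst w *\<^sub>R snd w) \<le> S * S"
    by (auto simp: m_def indicator_def abs_mult intro!: mult_mono split: if_splits)
  have "norm (riesz \<alpha> g x - (\<integral>w. g (x + fst w *\<^sub>R snd w) *\<^sub>R m w \<partial>(pw \<alpha> \<Otimes>\<^sub>M gauss))) \<le> e * A"
    if bd: "bounded_L1 A g" for A g and x :: 'a
  proof -
    note [measurable] = bounded_L1_borel[OF bd]
    have gA: "\<bar>g y\<bar> \<le> A" for y using bd by (auto simp: bounded_L1_def)
    then have A: "0 \<le> A" using abs_ge_zero order_trans by blast
    have gi: "integrable (pw \<alpha> \<Otimes>\<^sub>M gauss) (\<lambda>w. g (x + fst w *\<^sub>R snd w) *\<^sub>R m w)"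
      by (rule Bochner_Integration.integrable_bound[where f="\<lambda>w. A *\<^sub>R m w"])
        (use mi gA A in \<open>auto intro!: mult_right_mono\<close>)
    have it: "(\<integral>w. g (x + fst w *\<^sub>R snd w) *\<^sub>R m w \<partial>(pw \<alpha> \<Otimes>\<^sub>M gauss)) = (\<integral>s. (\<integral>N. g (x + s *\<^sub>R N) *\<^sub>R m (s, N) \<partial>gauss) \<partial>pw \<alpha>)"
      using pw_gauss.integral_fst'[OF gi] by simp
    have i2: "integrable (pw \<alpha>) (\<lambda>s. \<integral>N. g (x + s *\<^sub>R N) *\<^sub>R m (s, N) \<partial>gauss)"
      using pw_gauss.integrable_fst'[OF gi] by simp
    have "norm (riesz \<alpha> g x - (\<integral>w. g (x + fst w *\<^sub>R snd w) *\<^sub>R m w \<partial>(pw \<alpha> \<Otimes>\<^sub>M gauss)))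
      = norm (\<integral>s. (\<integral>N. g (x + s *\<^sub>R N) *\<^sub>R N \<partial>gauss) - (\<integral>N. g (x + s *\<^sub>R N) *\<^sub>R m (s, N) \<partial>gauss) \<partial>pw \<alpha>)"
      unfolding it riesz_def using riesz_integrable[OF \<alpha> bd] i2 by simp
    also have "\<dots> \<le> (\<integral>s. norm ((\<integral>N. g (x + s *\<^sub>R N) *\<^sub>R N \<partial>gauss) - (\<integral>N. g (x + s *\<^sub>R N) *\<^sub>R m (s, N) \<partial>gauss)) \<partial>pw \<alpha>)"
      by (rule integral_norm_bound)
    also have "\<dots> \<le> (\<integral>s. A * E S s \<partial>pw \<alpha>)"
    proof (rule integral_mono_AE)
      show "AE s in pw \<alpha>. norm ((\<integral>N. g (x + s *\<^sub>R N) *\<^sub>R N \<partial>gauss) - (\<integral>N. g (x + s *\<^sub>R N) *\<^sub>R m (s, N) \<partial>gauss)) \<le> A * E S s"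
        using AE_pw_pos
      proof eventually_elim
        case (elim s)
        note dec = bounded_L1_average_decay[OF bd elim, of x]
        have ms: "integrable gauss (\<lambda>N. g (x + s *\<^sub>R N) *\<^sub>R m (s, N))"
          by (rule Bochner_Integration.integrable_bound[OF dec(1)])
            (measurable, auto simp: m_def mult.commute)
        have "norm ((\<integral>N. g (x + s *\<^sub>R N) *\<^sub>R N \<partial>gauss) - (\<integral>N. g (x + s *\<^sub>R N) *\<^sub>R m (s, N) \<partial>gauss))
          = norm (\<integral>N. g (x + s *\<^sub>R N) *\<^sub>R (N - m (s, N)) \<partial>gauss)"
          using dec(3) ms by (simp add: scaleR_diff_right)
        also have "\<dots> \<le> (\<integral>N. \<bar>g (x + s *\<^sub>R N)\<bar> * norm (N - m (s, N)) \<partial>gauss)"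
          using integral_norm_bound[of gauss "\<lambda>N. g (x + s *\<^sub>R N) *\<^sub>R (N - m (s, N))"] by simp
        finally have le: "norm ((\<integral>N. g (x + s *\<^sub>R N) *\<^sub>R N \<partial>gauss) - (\<integral>N. g (x + s *\<^sub>R N) *\<^sub>R m (s, N) \<partial>gauss))
          \<le> (\<integral>N. \<bar>g (x + s *\<^sub>R N)\<bar> * norm (N - m (s, N)) \<partial>gauss)" .
        have di: "integrable gauss (\<lambda>N. \<bar>g (x + s *\<^sub>R N)\<bar> * norm (N - m (s, N)))"
          by (rule Bochner_Integration.integrable_bound[OF dec(1)])
            (measurable, auto simp: m_def mult.commute)
        have "(\<integral>N. \<bar>g (x + s *\<^sub>R N)\<bar> * norm (N - m (s, N)) \<partial>gauss) \<le> (\<integral>N. norm N * \<bar>g (x + s *\<^sub>R N)\<bar> \<partial>gauss)"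
          by (rule integral_mono[OF di dec(1)]) (auto simp: m_def mult.commute)
        also have "\<dots> \<le> A * (G1 * min 1 (1 / s))" using dec(2) by (simp add: G1_def mult.assoc)
        finally have b1: "(\<integral>N. \<bar>g (x + s *\<^sub>R N)\<bar> * norm (N - m (s, N)) \<partial>gauss) \<le> A * (G1 * min 1 (1 / s))" .
        have b2: "(\<integral>N. \<bar>g (x + s *\<^sub>R N)\<bar> * norm (N - m (s, N)) \<partial>gauss) \<le> A * (G2 / S)" if sS: "s \<le> S"
        proof -
          have "(\<integral>N. \<bar>g (x + s *\<^sub>R N)\<bar> * norm (N - m (s, N)) \<partial>gauss) \<le> (\<integral>N. A / S * (norm (N::'a))\<^sup>2 \<partial>gauss)"
          proof (rule integral_mono[OF di])
            show "integrable gauss (\<lambda>N. A / S * (norm (N::'a))\<^sup>2)"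
              using integrable_gauss_norm_power[where k=2] by (intro integrable_mult_right)
            fix N :: 'a
            have "norm (N - m (s, N)) \<le> (norm N)\<^sup>2 / S"
            proof (cases "norm N \<le> S")
              case True
              then show ?thesis using sS elim S by (simp add: m_def)
            next
              case False
              then have "norm N * S \<le> norm N * norm N" by (intro mult_left_mono) auto
              then show ?thesis using S False by (simp add: m_def power2_eq_square field_simps)
            qed
            then have "\<bar>g (x + s *\<^sub>R N)\<bar> * norm (N - m (s, N)) \<le> A * ((norm N)\<^sup>2 / S)"
              using gA A by (intro mult_mono) auto
            then show "\<bar>g (x + s *\<^sub>R N)\<bar> * norm (N - m (s, N)) \<le> A / S * (norm N)\<^sup>2" by simp
          qed
          then show ?thesis by (simp add: G2_def)
        qed
        show ?case
        proof (cases "s \<le> S")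
          case True
          then have "(\<integral>N. \<bar>g (x + s *\<^sub>R N)\<bar> * norm (N - m (s, N)) \<partial>gauss) \<le> A * E S s"
            using b1 b2 by (simp add: E_def min_def)
          then show ?thesis using le by linarith
        next
          case False
          then show ?thesis using le b1 by (simp add: E_def)
        qed
      qed
    qed (use riesz_integrable[OF \<alpha> bd, of x] i2 Ei[OF S(2)] in auto)
    also have "\<dots> \<le> A * e"
      using k A by (simp add: S_def mult_left_mono less_imp_le)
    finally show ?thesis by (simp add: mult.commute)
  qed
  then show ?thesis using that[OF mi supp] by blast
qed

subsection \<open>Gaussian double averages\<close>

lemma integrable_gauss_rotation:
  fixes F :: "'a::euclidean_space \<times> 'a \<Rightarrow> 'b::{banach,second_countable_topology}"
  assumes cs: "c\<^sup>2 + s\<^sup>2 = 1" "s \<noteq> 0" and F: "integrable (gauss \<Otimes>\<^sub>M gauss) F"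
  shows "integrable (gauss \<Otimes>\<^sub>M gauss) (\<lambda>p. F (c *\<^sub>R fst p - s *\<^sub>R snd p, s *\<^sub>R fst p + c *\<^sub>R snd p))"
proof -
  let ?r = "\<lambda>(a, b). (c *\<^sub>R a - s *\<^sub>R b, s *\<^sub>R a + c *\<^sub>R b) :: 'a \<times> 'a"
  have r: "?r \<in> (gauss \<Otimes>\<^sub>M gauss) \<rightarrow>\<^sub>M (gauss \<Otimes>\<^sub>M gauss)" by measurable
  have "integrable (distr (gauss \<Otimes>\<^sub>M gauss) (gauss \<Otimes>\<^sub>M gauss) ?r) F"
    unfolding distr_gauss_rotation[OF cs] by (rule F)
  from integrable_distr[OF r this] show ?thesis by (simp add: case_prod_beta)
qed

text \<open>With cosine t/r and sine s/r, the rotation turns the combination t a + s b into r times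
  the first rotated vector.\<close>

lemma pythagoras_quotients:
  fixes s t :: real
  assumes "0 < s" "0 < t" and r: "r = sqrt (s\<^sup>2 + t\<^sup>2)"
  shows "0 < r" "(t / r)\<^sup>2 + (s / r)\<^sup>2 = 1" "s / r \<noteq> 0" "t * (t / r) + s * (s / r) = r"
proof -
  have rr: "r\<^sup>2 = s\<^sup>2 + t\<^sup>2" unfolding r by simp
  show r0: "0 < r" unfolding r using assms by (simp add: add_pos_pos)
  then show "s / r \<noteq> 0" using assms by simp
  show "(t / r)\<^sup>2 + (s / r)\<^sup>2 = 1"
  proof -
    have "(t / r)\<^sup>2 + (s / r)\<^sup>2 = (s\<^sup>2 + t\<^sup>2) / r\<^sup>2" by (simp add: power_divide add_divide_distrib)
    also have "\<dots> = 1" unfolding rr[symmetric] using r0 by simp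
    finally show ?thesis .
  qed
  show "t * (t / r) + s * (s / r) = r"
    using rr r0 by (simp add: field_simps power2_eq_square)
qed

text \<open>After the rotation g depends on the first vector only, and a \<bullet> b becomes c d
  (|a|^2 - |b|^2) + (c^2 - d^2) (a \<bullet> b). Integrating out the second vector removes the odd
  term and replaces |b|^2 by its mean, which leaves the weight of the heat equation.\<close>

lemma gauss_double_average_inner:
  fixes g :: "'a::euclidean_space \<Rightarrow> real"
  assumes [measurable]: "g \<in> borel_measurable borel" and gA: "\<And>x. \<bar>g x\<bar> \<le> A"
    and st: "0 < s" "0 < t"
  defines "r \<equiv> sqrt (s\<^sup>2 + t\<^sup>2)"
  shows "(\<integral>a. (\<integral>b. g (x + t *\<^sub>R a + s *\<^sub>R b) * (a \<bullet> b) \<partial>gauss) \<partial>gauss)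
    = s * t / r\<^sup>2 * measure (gauss :: 'a measure) UNIV * (\<integral>M. ((norm M)\<^sup>2 - DIM('a) / 2) * g (x + r *\<^sub>R M) \<partial>gauss)"
proof -
  let ?G = "measure (gauss :: 'a measure) UNIV"
  define F where "F p = g (x + t *\<^sub>R fst p + s *\<^sub>R snd p) * (fst p \<bullet> snd p)" for p
  define c where "c = t / r"
  define d where "d = s / r"
  note py = pythagoras_quotients[OF st r_def[THEN meta_eq_to_obj_eq], folded c_def d_def]
  have [measurable]: "F \<in> borel_measurable (borel \<Otimes>\<^sub>M borel)" unfolding F_def by measurable
  have A: "0 \<le> A" using gA[of x] by linarith
  have bd: "\<bar>g y * (a \<bullet> b)\<bar> \<le> A * norm a * norm b" for y and a b :: 'a
    using mult_mono[OF gA[of y] Cauchy_Schwarz_ineq2[of a b]] A by (simp add: abs_mult mult.assoc)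
  have Fi: "integrable (gauss \<Otimes>\<^sub>M gauss) F"
  proof (rule gauss2.integrable_pair_dominated[where B="\<lambda>a. A * norm a * (\<integral>b. norm (b::'a) \<partial>gauss)"])
    show "integrable gauss (\<lambda>a::'a. A * norm a * (\<integral>b. norm (b::'a) \<partial>gauss))"
      by (intro integrable_mult_left integrable_mult_right integrable_gauss_norm)
    show "AE a in gauss. integrable gauss (\<lambda>b. F (a, b)) \<and> (\<integral>b. norm (F (a, b)) \<partial>gauss) \<le> A * norm a * (\<integral>b. norm (b::'a) \<partial>gauss)"
    proof (rule AE_I2)
      fix a :: 'a
      have i: "integrable gauss (\<lambda>b. F (a, b))"
        by (rule integrable_gauss_bound[where k=1 and C="A * norm a"]) (measurable, use bd in \<open>simp add: F_def\<close>)
      have "(\<integral>b. norm (F (a, b)) \<partial>gauss) \<le> (\<integral>b. A * norm a * norm (b::'a) \<partial>gauss)"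
        by (rule integral_mono) (use i bd integrable_gauss_norm in \<open>auto simp: F_def\<close>)
      then show "integrable gauss (\<lambda>b. F (a, b)) \<and> (\<integral>b. norm (F (a, b)) \<partial>gauss) \<le> A * norm a * (\<integral>b. norm (b::'a) \<partial>gauss)"
        using i by simp
    qed
  qed measurable
  define F' where "F' p = F (c *\<^sub>R fst p - d *\<^sub>R snd p, d *\<^sub>R fst p + c *\<^sub>R snd p)" for p
  have F'i: "integrable (gauss \<Otimes>\<^sub>M gauss) F'"
    unfolding F'_def by (rule integrable_gauss_rotation[OF py(2,3) Fi])
  have F': "F' (a, b) = g (x + r *\<^sub>R a) * (c * d * (norm a)\<^sup>2 - c * d * (norm b)\<^sup>2 + (c\<^sup>2 - d\<^sup>2) * (a \<bullet> b))" for a b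
  proof -
    have "t *\<^sub>R (c *\<^sub>R a - d *\<^sub>R b) + s *\<^sub>R (d *\<^sub>R a + c *\<^sub>R b) = (t * c + s * d) *\<^sub>R a + (s * c - t * d) *\<^sub>R b"
      by (simp add: algebra_simps)
    also have "s * c - t * d = 0" by (simp add: c_def d_def)
    finally have "x + t *\<^sub>R (c *\<^sub>R a - d *\<^sub>R b) + s *\<^sub>R (d *\<^sub>R a + c *\<^sub>R b) = x + r *\<^sub>R a"
      using py(4) by (simp add: add.assoc)
    moreover have "(c *\<^sub>R a - d *\<^sub>R b) \<bullet> (d *\<^sub>R a + c *\<^sub>R b) = c * d * (norm a)\<^sup>2 - c * d * (norm b)\<^sup>2 + (c\<^sup>2 - d\<^sup>2) * (a \<bullet> b)"
      unfolding power2_norm_eq_inner by (simp add: inner_simps inner_commute algebra_simps power2_eq_square)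
    ultimately show ?thesis unfolding F'_def F_def fst_conv snd_conv by (simp only:)
  qed
  have sq: "integrable gauss (\<lambda>b::'a. (norm b)\<^sup>2)" by (rule integrable_gauss_norm_power)
  have ip: "integrable gauss (\<lambda>b::'a. a \<bullet> b)" for a
    by (rule integrable_gauss_bound[where k=1 and C="norm a"]) (use Cauchy_Schwarz_ineq2 in auto)
  have ip0: "(\<integral>b. a \<bullet> b \<partial>gauss) = 0" for a :: 'a
    by (rule integral_gauss_odd) auto
  have m2: "(\<integral>b. (norm (b::'a))\<^sup>2 \<partial>gauss) = DIM('a) / 2 * ?G"
    using gauss_second_moment[where 'a='a] sq by (simp add: mult.commute)
  have inner: "(\<integral>b. F' (a, b) \<partial>gauss) = c * d * ?G * (((norm a)\<^sup>2 - DIM('a) / 2) * g (x + r *\<^sub>R a))" for a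
  proof -
    have "(\<integral>b. F' (a, b) \<partial>gauss) = g (x + r *\<^sub>R a) * (\<integral>b. c * d * (norm a)\<^sup>2 - c * d * (norm b)\<^sup>2 + (c\<^sup>2 - d\<^sup>2) * (a \<bullet> b) \<partial>gauss)"
      unfolding F' by (rule integral_mult_right_zero)
    also have "(\<integral>b. c * d * (norm a)\<^sup>2 - c * d * (norm b)\<^sup>2 + (c\<^sup>2 - d\<^sup>2) * (a \<bullet> b) \<partial>gauss)
      = c * d * (norm a)\<^sup>2 * ?G - c * d * (DIM('a) / 2 * ?G)"
      using sq ip by (simp add: ip0 m2 mult_ac)
    finally show ?thesis by (simp add: algebra_simps)
  qed
  have "(\<integral>a. (\<integral>b. g (x + t *\<^sub>R a + s *\<^sub>R b) * (a \<bullet> b) \<partial>gauss) \<partial>gauss) = (\<integral>p. F p \<partial>(gauss \<Otimes>\<^sub>M gauss))"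
  proof -
    have eq: "F (a, b) = g (x + t *\<^sub>R a + s *\<^sub>R b) * (a \<bullet> b)" for a b by (simp add: F_def)
    show ?thesis using gauss2.integral_fst'[OF Fi] unfolding eq .
  qed
  also have "\<dots> = (\<integral>p. F' p \<partial>(gauss \<Otimes>\<^sub>M gauss))"
    unfolding F'_def by (rule integral_gauss_rotation[OF py(2,3)]) measurable
  also have "\<dots> = (\<integral>a. (\<integral>b. F' (a, b) \<partial>gauss) \<partial>gauss)"
    using gauss2.integral_fst'[OF F'i] by simp
  also have "\<dots> = c * d * ?G * (\<integral>M. ((norm M)\<^sup>2 - DIM('a) / 2) * g (x + r *\<^sub>R M) \<partial>gauss)"
    unfolding inner by (rule integral_mult_right_zero)
  also have "c * d = s * t / r\<^sup>2" by (simp add: c_def d_def power2_eq_square)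
  finally show ?thesis .
qed

text \<open>The same rotation for a vector field: the component of the weight along the second
  vector is odd and drops out. This gives the sign of the Gaussian averages of a divergence in the
  strictness part.\<close>

lemma gauss_double_average_field:
  fixes \<phi> :: "'a::euclidean_space \<Rightarrow> 'a"
  assumes [measurable]: "\<phi> \<in> borel_measurable borel" and \<phi>B: "\<And>x. norm (\<phi> x) \<le> B"
    and st: "0 < s" "0 < t"
  defines "r \<equiv> sqrt (s\<^sup>2 + t\<^sup>2)"
  shows "(\<integral>b. (\<integral>a. a \<bullet> \<phi> (s *\<^sub>R b + t *\<^sub>R a) \<partial>gauss) \<partial>gauss)
    = t / r * measure (gauss :: 'a measure) UNIV * (\<integral>M. M \<bullet> \<phi> (r *\<^sub>R M) \<partial>gauss)"
proof -
  let ?G = "measure (gauss :: 'a measure) UNIV"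
  define F where "F p = fst p \<bullet> \<phi> (s *\<^sub>R snd p + t *\<^sub>R fst p)" for p
  define c where "c = t / r"
  define d where "d = s / r"
  note py = pythagoras_quotients[OF st r_def[THEN meta_eq_to_obj_eq], folded c_def d_def]
  have [measurable]: "F \<in> borel_measurable (borel \<Otimes>\<^sub>M borel)" unfolding F_def by measurable
  have bd: "\<bar>a \<bullet> \<phi> y\<bar> \<le> B * norm a" for y and a :: 'a
    using order_trans[OF Cauchy_Schwarz_ineq2[of a "\<phi> y"] mult_left_mono[OF \<phi>B[of y]]] by (simp add: mult.commute)
  have B: "0 \<le> B" using \<phi>B[of 0] norm_ge_zero order_trans by blast
  have Fi: "integrable (gauss \<Otimes>\<^sub>M gauss) F"
  proof (rule gauss2.integrable_pair_dominated[where B="\<lambda>a. B * norm a * ?G"])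
    show "integrable gauss (\<lambda>a::'a. B * norm a * ?G)"
      by (intro integrable_mult_left integrable_mult_right integrable_gauss_norm)
    show "AE a in gauss. integrable gauss (\<lambda>b. F (a, b)) \<and> (\<integral>b. norm (F (a, b)) \<partial>gauss) \<le> B * norm a * ?G"
    proof (rule AE_I2)
      fix a :: 'a
      have i: "integrable gauss (\<lambda>b. F (a, b))"
        by (rule gauss.integrable_const_bound[where B="B * norm a"]) (use bd in \<open>simp add: F_def\<close>, measurable)
      have "(\<integral>b. norm (F (a, b)) \<partial>gauss) \<le> (\<integral>b. B * norm a \<partial>(gauss :: 'a measure))"
        by (rule integral_mono) (use i bd in \<open>auto simp: F_def\<close>)
      then show "integrable gauss (\<lambda>b. F (a, b)) \<and> (\<integral>b. norm (F (a, b)) \<partial>gauss) \<le> B * norm a * ?G"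
        using i by (simp add: mult_ac)
    qed
  qed measurable
  define F' where "F' p = F (c *\<^sub>R fst p - d *\<^sub>R snd p, d *\<^sub>R fst p + c *\<^sub>R snd p)" for p
  have F'i: "integrable (gauss \<Otimes>\<^sub>M gauss) F'"
    unfolding F'_def by (rule integrable_gauss_rotation[OF py(2,3) Fi])
  have F': "F' (a, b) = c * (a \<bullet> \<phi> (r *\<^sub>R a)) - d * (b \<bullet> \<phi> (r *\<^sub>R a))" for a b
  proof -
    have "s *\<^sub>R (d *\<^sub>R a + c *\<^sub>R b) + t *\<^sub>R (c *\<^sub>R a - d *\<^sub>R b) = (t * c + s * d) *\<^sub>R a + (s * c - t * d) *\<^sub>R b"
      by (simp add: algebra_simps)
    also have "s * c - t * d = 0" by (simp add: c_def d_def)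
    finally have "s *\<^sub>R (d *\<^sub>R a + c *\<^sub>R b) + t *\<^sub>R (c *\<^sub>R a - d *\<^sub>R b) = r *\<^sub>R a"
      using py(4) by simp
    then show ?thesis by (simp add: F'_def F_def inner_diff_left)
  qed
  have ip: "integrable gauss (\<lambda>b::'a. b \<bullet> a)" for a
    by (rule integrable_gauss_bound[where k=1 and C="norm a"]) (use Cauchy_Schwarz_ineq2 in \<open>auto simp: mult.commute\<close>)
  have ip0: "(\<integral>b. b \<bullet> a \<partial>gauss) = 0" for a :: 'a
    by (rule integral_gauss_odd) auto
  have "(\<integral>b. (\<integral>a. a \<bullet> \<phi> (s *\<^sub>R b + t *\<^sub>R a) \<partial>gauss) \<partial>gauss) = (\<integral>p. F p \<partial>(gauss \<Otimes>\<^sub>M gauss))"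
  proof -
    have eq: "F (a, b) = a \<bullet> \<phi> (s *\<^sub>R b + t *\<^sub>R a)" for a b by (simp add: F_def)
    have "integrable (gauss \<Otimes>\<^sub>M gauss) (case_prod (\<lambda>a b. F (a, b)))" using Fi by simp
    from gauss2.integral_snd[OF this] show ?thesis by (simp add: eq[symmetric])
  qed
  also have "\<dots> = (\<integral>p. F' p \<partial>(gauss \<Otimes>\<^sub>M gauss))"
    unfolding F'_def by (rule integral_gauss_rotation[OF py(2,3)]) measurable
  also have "\<dots> = (\<integral>a. (\<integral>b. F' (a, b) \<partial>gauss) \<partial>gauss)"
    using gauss2.integral_fst'[OF F'i] by simp
  also have "\<dots> = (\<integral>a. c * ?G * (a \<bullet> \<phi> (r *\<^sub>R a)) \<partial>gauss)"
    unfolding F' using ip by (simp add: ip0 mult_ac)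
  also have "\<dots> = c * ?G * (\<integral>M. M \<bullet> \<phi> (r *\<^sub>R M) \<partial>gauss)"
    by (rule integral_mult_right_zero)
  finally show ?thesis unfolding c_def .
qed

subsection \<open>Inversion\<close>

text \<open>Half of the logarithmic derivative r d/dr of the Gaussian average of \<open>g\<close>
  around \<open>x\<close> at scale \<open>r\<close>, in the form given by the heat equation.\<close>

definition heat_avg :: "('a::euclidean_space \<Rightarrow> real) \<Rightarrow> 'a \<Rightarrow> real \<Rightarrow> real" where
  "heat_avg g x r = (\<integral>M. ((norm M)\<^sup>2 - DIM('a) / 2) * g (x + r *\<^sub>R M) \<partial>gauss)"

lemma heat_avg_borel:
  assumes [measurable]: "g \<in> borel_measurable borel"
  shows "heat_avg g x \<in> borel_measurable borel"
  unfolding heat_avg_def by measurable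

text \<open>The measure dt/t needs decay at both ends. Multiplication by t^(-1/2) shifts the weight
  to \<open>pw (1/2)\<close> and leaves a function below the usual majorant.\<close>

lemma integrable_pw_0:
  assumes [measurable]: "f \<in> borel_measurable borel" and le: "\<And>t. 0 < t \<Longrightarrow> \<bar>f t\<bar> \<le> K * min t (1 / t)"
  shows "integrable (pw 0) (f :: real \<Rightarrow> real)"
proof -
  have K: "0 \<le> K" using le[of 1] by simp
  have "integrable (pw (1/2)) (\<lambda>t. t powr (- 1/2) *\<^sub>R f t)"
  proof (rule integrable_pw_bound[where C=K])
    fix t :: real assume t: "0 < t"
    have "t powr (- 1/2) * min t (1 / t) \<le> min 1 (1 / t)"
    proof (cases "t \<le> 1")
      case True
      have "t powr (- 1/2) * t = t powr (1/2)"
        using t powr_mult_base[of t "- 1/2"] by (simp add: mult.commute)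
      also have "\<dots> \<le> 1" using True t by (simp add: powr_le1)
      moreover have "t \<le> 1 / t" "1 \<le> 1 / t"
        using True t mult_le_one[of t t] by (simp_all add: field_simps)
      ultimately show ?thesis by (simp add: min_def)
    next
      case False
      have "t powr (- 1/2) \<le> 1"
        using False powr_mono[of "-1/2" 0 t] by simp
      then have "t powr (- 1/2) * (1 / t) \<le> 1 * (1 / t)" using t by (intro mult_right_mono) auto
      moreover have "1 / t \<le> 1" using False by simp
      then have "min t (1 / t) = 1 / t" "min 1 (1 / t) = 1 / t" using False by linarith+
      ultimately show ?thesis by simp
    qed
    from mult_left_mono[OF this K] have "t powr (- 1/2) * (K * min t (1 / t)) \<le> K * min 1 (1 / t)"
      by (simp only: mult.left_commute)
    moreover have "norm (t powr (- 1/2) *\<^sub>R f t) \<le> t powr (- 1/2) * (K * min t (1 / t))"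
      using le[OF t] by (simp add: abs_mult mult_left_mono)
    ultimately show "norm (t powr (- 1/2) *\<^sub>R f t) \<le> K * min 1 (1 / t)" by linarith
  qed auto
  then show ?thesis by (subst (asm) pw_shift) auto
qed

text \<open>The weight |M|^2 - n/2 has mean zero, so g x can be subtracted and the Lipschitz bound
  yields the factor r at small scales. At large scales the integrability of g yields 1/r.\<close>

lemma heat_avg_bound:
  fixes g :: "'a::euclidean_space \<Rightarrow> real"
  assumes bd: "bounded_L1 A g" and bl: "bounded_lipschitz B g"
  obtains K where "\<forall>r>0. \<bar>heat_avg g x r\<bar> \<le> K * min r (1 / r)"
proof -
  note [measurable] = bounded_L1_borel[OF bd]
  have g: "\<bar>g x\<bar> \<le> A" "integrable lborel g" "(\<integral>x. \<bar>g x\<bar> \<partial>lborel) \<le> A" for x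
    using bd unfolding bounded_L1_def by auto
  have L: "\<bar>g y - g z\<bar> \<le> B * norm (y - z)" "\<bar>g y\<bar> \<le> B" for y z using bl by (auto simp: bounded_lipschitz_def)
  have B: "0 \<le> B" using L(2)[of 0] by linarith
  define p where "p N = (norm N)\<^sup>2 + DIM('a) / 2" for N :: 'a
  have p0: "0 \<le> p N" for N by (simp add: p_def)
  have [measurable]: "p \<in> borel_measurable borel" unfolding p_def by measurable
  have pi: "integrable gauss p"
    unfolding p_def using integrable_gauss_norm_power[where k=2] gauss.integrable_const by auto
  have pe: "exp (- (norm N)\<^sup>2) * p N \<le> 1 + DIM('a) / 2" for N
  proof -
    have "(norm N)\<^sup>2 \<le> exp ((norm N)\<^sup>2)" using exp_ge_add_one_self[of "(norm N)\<^sup>2"] by linarith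
    then have "exp (- (norm N)\<^sup>2) * (norm N)\<^sup>2 \<le> 1" by (simp add: exp_minus field_simps)
    moreover have "exp (- (norm N)\<^sup>2) * (DIM('a) / 2) \<le> 1 * (DIM('a) / 2)" by (intro mult_right_mono) auto
    ultimately show ?thesis unfolding p_def distrib_left by linarith
  qed
  define K1 where "K1 = A * (1 + DIM('a) / 2 + (\<integral>N. p N \<partial>gauss))"
  define K2 where "K2 = B * (\<integral>N. p N * norm N \<partial>gauss)"
  have A: "0 \<le> A" using g(1)[of 0] by linarith
  have K1: "0 \<le> K1" using A p0 by (simp add: K1_def)
  have K2: "0 \<le> K2" using B p0 by (simp add: K2_def)
  have qle: "\<bar>(norm N)\<^sup>2 - DIM('a) / 2\<bar> \<le> p N" for N by (simp add: p_def abs_le_iff)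
  have "\<bar>heat_avg g x r\<bar> \<le> (K1 + K2) * min r (1 / r)" if r: "r > 0" for r
  proof -
    have dec: "integrable gauss (\<lambda>N. p N * \<bar>g (x + r *\<^sub>R N)\<bar>)"
      "(\<integral>N. p N * \<bar>g (x + r *\<^sub>R N)\<bar> \<partial>gauss) \<le> K1 * min 1 (1 / r)"
      unfolding K1_def
      by (rule gauss_weighted_integral_decay[where p=p and C="1 + DIM('a) / 2" and A=A]; use p0 pi pe g r in simp)+
    have i: "integrable gauss (\<lambda>M. ((norm M)\<^sup>2 - DIM('a) / 2) * g (x + r *\<^sub>R M))"
      by (rule Bochner_Integration.integrable_bound[OF dec(1)])
        (use qle p0 in \<open>auto simp: abs_mult intro!: mult_right_mono intro: order_trans[OF _ abs_ge_self]\<close>)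
    have 1: "\<bar>heat_avg g x r\<bar> \<le> K1 * (1 / r)"
    proof -
      have "\<bar>heat_avg g x r\<bar> \<le> (\<integral>M. \<bar>((norm M)\<^sup>2 - DIM('a) / 2) * g (x + r *\<^sub>R M)\<bar> \<partial>gauss)"
        unfolding heat_avg_def by (rule integral_abs_bound)
      also have "\<dots> \<le> (\<integral>N. p N * \<bar>g (x + r *\<^sub>R N)\<bar> \<partial>gauss)"
        by (rule integral_mono[OF integrable_abs[OF i] dec(1)]) (use qle in \<open>auto simp: abs_mult intro!: mult_right_mono\<close>)
      also have "\<dots> \<le> K1 * (1 / r)"
        using dec(2) K1 by (meson min.cobounded2 mult_left_mono order_trans)
      finally show ?thesis .
    qed
    have 2: "\<bar>heat_avg g x r\<bar> \<le> K2 * r"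
    proof -
      have ci: "integrable gauss (\<lambda>M. ((norm M)\<^sup>2 - DIM('a) / 2) * g x)"
        using integrable_gauss_norm_power[where k=2] gauss.integrable_const by (intro integrable_mult_left Bochner_Integration.integrable_diff) auto
      have c0: "(\<integral>M. ((norm (M::'a))\<^sup>2 - DIM('a) / 2) * g x \<partial>gauss) = 0"
        using gauss_second_moment[where 'a='a] by (subst integral_mult_left_zero) simp
      have e: "heat_avg g x r = (\<integral>M. ((norm M)\<^sup>2 - DIM('a) / 2) * g (x + r *\<^sub>R M) - ((norm M)\<^sup>2 - DIM('a) / 2) * g x \<partial>gauss)"
        unfolding Bochner_Integration.integral_diff[OF i ci] c0 heat_avg_def by simp
      have "\<bar>heat_avg g x r\<bar> \<le> (\<integral>M. \<bar>((norm M)\<^sup>2 - DIM('a) / 2) * g (x + r *\<^sub>R M) - ((norm M)\<^sup>2 - DIM('a) / 2) * g x\<bar> \<partial>gauss)"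
        unfolding e by (rule integral_abs_bound)
      also have "\<dots> \<le> (\<integral>M. B * r * (p M * norm M) \<partial>gauss)"
      proof (rule integral_mono)
        have "integrable gauss (\<lambda>M::'a. norm M ^ 3 + DIM('a) / 2 * norm M)"
          by (intro Bochner_Integration.integrable_add integrable_mult_right integrable_gauss_norm integrable_gauss_norm_power)
        then show "integrable gauss (\<lambda>M::'a. B * r * (p M * norm M))"
          by (intro integrable_mult_right) (simp add: p_def algebra_simps power3_eq_cube power2_eq_square)
        fix M :: 'a
        have "\<bar>((norm M)\<^sup>2 - DIM('a) / 2) * g (x + r *\<^sub>R M) - ((norm M)\<^sup>2 - DIM('a) / 2) * g x\<bar>
          = \<bar>(norm M)\<^sup>2 - DIM('a) / 2\<bar> * \<bar>g (x + r *\<^sub>R M) - g x\<bar>"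
          by (simp flip: abs_mult add: right_diff_distrib)
        also have "\<dots> \<le> p M * (B * (r * norm M))"
          using qle L(1)[of "x + r *\<^sub>R M" x] r p0 by (intro mult_mono) auto
        finally show "\<bar>((norm M)\<^sup>2 - DIM('a) / 2) * g (x + r *\<^sub>R M) - ((norm M)\<^sup>2 - DIM('a) / 2) * g x\<bar> \<le> B * r * (p M * norm M)"
          by (simp add: mult_ac)
        show "integrable gauss (\<lambda>M. \<bar>((norm M)\<^sup>2 - DIM('a) / 2) * g (x + r *\<^sub>R M) - ((norm M)\<^sup>2 - DIM('a) / 2) * g x\<bar>)"
          by (intro integrable_abs Bochner_Integration.integrable_diff i ci)
      qed
      also have "\<dots> = K2 * r" by (simp add: K2_def)
      finally show ?thesis .
    qed
    show ?thesis
    proof (cases "r \<le> 1 / r")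
      case True
      then have m: "min r (1 / r) = r" by (rule min_absorb1)
      have "K2 * r \<le> (K1 + K2) * r" using K1 r by (intro mult_right_mono) auto
      then show ?thesis unfolding m using 2 by linarith
    next
      case False
      then have m: "min r (1 / r) = 1 / r" by (intro min_absorb2) linarith
      have "K1 * (1 / r) \<le> (K1 + K2) * (1 / r)" using K2 r by (intro mult_right_mono) auto
      then show ?thesis unfolding m using 1 by linarith
    qed
  qed
  then show ?thesis using that[of "K1 + K2"] by blast
qed

lemma gauss_average_decay:
  fixes g :: "'a::euclidean_space \<Rightarrow> real"
  assumes bd: "bounded_L1 A g"
  shows "(\<lambda>k. \<integral>M. g (x + real (Suc k) *\<^sub>R M) \<partial>gauss) \<longlonglongrightarrow> 0"
proof (rule Lim_null_comparison)
  note [measurable] = bounded_L1_borel[OF bd]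
  have g: "\<bar>g x\<bar> \<le> A" "integrable lborel g" "(\<integral>x. \<bar>g x\<bar> \<partial>lborel) \<le> A" for x
    using bd unfolding bounded_L1_def by auto
  define C where "C = A * (1 + measure (gauss :: 'a measure) UNIV)"
  have "norm (\<integral>M. g (x + real (Suc k) *\<^sub>R M) \<partial>gauss) \<le> C / real (Suc k)" for k
  proof -
    have "norm (\<integral>M. g (x + real (Suc k) *\<^sub>R M) \<partial>gauss) \<le> (\<integral>M. 1 * \<bar>g (x + real (Suc k) *\<^sub>R M)\<bar> \<partial>gauss)"
      using integral_norm_bound[of gauss "\<lambda>M. g (x + real (Suc k) *\<^sub>R M)"] by simp
    also have "\<dots> \<le> A * (1 + (\<integral>M. 1 \<partial>(gauss :: 'a measure))) * min 1 (1 / real (Suc k))"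
      by (rule gauss_weighted_integral_decay(2)[where p="\<lambda>_. 1"]) (use g in auto)
    also have "\<dots> = C / real (Suc k)" by (simp add: C_def min_def)
    finally show ?thesis .
  qed
  then show "eventually (\<lambda>k. norm (\<integral>M. g (x + real (Suc k) *\<^sub>R M) \<partial>gauss) \<le> C / real (Suc k)) sequentially"
    by simp
  show "(\<lambda>k. C / real (Suc k)) \<longlonglongrightarrow> 0" using LIMSEQ_Suc[OF lim_const_over_n[of C]] by simp
qed

lemma gauss_average_small:
  fixes g :: "'a::euclidean_space \<Rightarrow> real"
  assumes bl: "bounded_lipschitz B g"
  shows "(\<lambda>k. \<integral>M. g (x + (1 / real (Suc k)) *\<^sub>R M) \<partial>gauss) \<longlonglongrightarrow> measure (gauss :: 'a measure) UNIV * g x"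
proof -
  note [measurable] = bounded_lipschitz_borel[OF bl]
  have L: "\<bar>g y - g z\<bar> \<le> B * norm (y - z)" "\<bar>g y\<bar> \<le> B" for y z using bl by (auto simp: bounded_lipschitz_def)
  have "(\<lambda>k. \<integral>M. g (x + (1 / real (Suc k)) *\<^sub>R M) \<partial>gauss) \<longlonglongrightarrow> (\<integral>M. g x \<partial>(gauss :: 'a measure))"
  proof (rule integral_dominated_convergence[where w="\<lambda>_. B"])
    show "AE M in gauss. (\<lambda>k. g (x + (1 / real (Suc k)) *\<^sub>R M)) \<longlonglongrightarrow> g x"
    proof (rule AE_I2)
      fix M :: 'a
      have "(\<lambda>k. 1 / real (Suc k)) \<longlonglongrightarrow> 0" using LIMSEQ_Suc[OF lim_const_over_n[of 1]] by simp
      then have "(\<lambda>k. B * ((1 / real (Suc k)) * norm M)) \<longlonglongrightarrow> B * (0 * norm M)" by (intro tendsto_intros)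
      then have z: "(\<lambda>k. B * ((1 / real (Suc k)) * norm M)) \<longlonglongrightarrow> 0" by simp
      have "(\<lambda>k. g (x + (1 / real (Suc k)) *\<^sub>R M) - g x) \<longlonglongrightarrow> 0"
      proof (rule Lim_null_comparison[OF _ z])
        have "norm (g (x + (1 / real (Suc k)) *\<^sub>R M) - g x) \<le> B * ((1 / real (Suc k)) * norm M)" for k
          using L(1)[of "x + (1 / real (Suc k)) *\<^sub>R M" x] by simp
        then show "eventually (\<lambda>k. norm (g (x + (1 / real (Suc k)) *\<^sub>R M) - g x) \<le> B * ((1 / real (Suc k)) * norm M)) sequentially"
          by simp
      qed
      then show "(\<lambda>k. g (x + (1 / real (Suc k)) *\<^sub>R M)) \<longlonglongrightarrow> g x" by (simp add: LIM_zero_iff)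
    qed
  qed (use L in auto)
  then show ?thesis by simp
qed

text \<open>The logarithmic derivative telescopes over the scales [1/k, k]. As k grows, the average
  at the large end vanishes because g is integrable, and the one at the small end tends to the
  Gaussian mass times g x.\<close>

lemma integral_heat_avg:
  fixes g :: "'a::euclidean_space \<Rightarrow> real"
  assumes bd: "bounded_L1 A g" and bl: "bounded_lipschitz B g"
  shows "integrable (pw 0) (heat_avg g x)"
    and "(\<integral>r. heat_avg g x r \<partial>pw 0) = - (measure (gauss :: 'a measure) UNIV * g x / 2)"
proof -
  note [measurable] = bounded_L1_borel[OF bd] heat_avg_borel[OF bounded_L1_borel[OF bd]]
  obtain K where K: "\<forall>r>0. \<bar>heat_avg g x r\<bar> \<le> K * min r (1 / r)"
    by (rule heat_avg_bound[OF bd bl])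
  show i: "integrable (pw 0) (heat_avg g x)"
    by (rule integrable_pw_0[where K=K]) (use K in auto)
  let ?I = "\<lambda>k. {1 / real (Suc k)..real (Suc k)}"
  have "(\<lambda>k. \<integral>r. indicator (?I k) r * heat_avg g x r \<partial>pw 0) \<longlonglongrightarrow> (\<integral>r. heat_avg g x r \<partial>pw 0)"
  proof (rule integral_dominated_convergence[where w="\<lambda>r. \<bar>heat_avg g x r\<bar>"])
    show "AE r in pw 0. (\<lambda>k. indicator (?I k) r * heat_avg g x r) \<longlonglongrightarrow> heat_avg g x r"
      using AE_pw_pos
    proof eventually_elim
      case (elim r)
      have "eventually (\<lambda>k. indicator (?I k) r * heat_avg g x r = heat_avg g x r) sequentially"
        using eventually_ge_at_top[of "nat \<lceil>r\<rceil> + nat \<lceil>1 / r\<rceil>"]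
      proof eventually_elim
        case (elim k)
        then have "r \<le> real (Suc k)" "1 / r \<le> real (Suc k)" by linarith+
        then show ?case using \<open>0 < r\<close> by (simp add: field_simps)
      qed
      then show ?case by (rule tendsto_eventually)
    qed
    show "AE r in pw 0. norm (indicator (?I k) r * heat_avg g x r) \<le> \<bar>heat_avg g x r\<bar>" for k
      by (auto simp: indicator_def)
  qed (use i in auto)
  moreover have "(\<integral>r. indicator (?I k) r * heat_avg g x r \<partial>pw 0)
     = ((\<integral>M. g (x + real (Suc k) *\<^sub>R M) \<partial>gauss) - (\<integral>M. g (x + (1 / real (Suc k)) *\<^sub>R M) \<partial>gauss)) / 2" for k
    unfolding heat_avg_def
    by (rule gauss_average_FTC[where g="\<lambda>y. g (x + y)" and A=A])
      (use bd in \<open>auto simp: bounded_L1_def field_simps\<close>)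
  ultimately have "(\<lambda>k. ((\<integral>M. g (x + real (Suc k) *\<^sub>R M) \<partial>gauss) - (\<integral>M. g (x + (1 / real (Suc k)) *\<^sub>R M) \<partial>gauss)) / 2)
      \<longlonglongrightarrow> (\<integral>r. heat_avg g x r \<partial>pw 0)"
    by (simp only:)
  moreover have "(\<lambda>k. ((\<integral>M. g (x + real (Suc k) *\<^sub>R M) \<partial>gauss) - (\<integral>M. g (x + (1 / real (Suc k)) *\<^sub>R M) \<partial>gauss)) / 2)
      \<longlonglongrightarrow> (0 - measure (gauss :: 'a measure) UNIV * g x) / 2"
    by (intro tendsto_intros gauss_average_decay[OF bd] gauss_average_small[OF bl]) auto
  ultimately show "(\<integral>r. heat_avg g x r \<partial>pw 0) = - (measure (gauss :: 'a measure) UNIV * g x / 2)"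
    using LIMSEQ_unique by fastforce
qed

text \<open>One Gaussian mass comes from integrating out the second rotated vector, the other with
  the factor 1/2 from \<open>integral_heat_avg\<close>; the remaining integral runs over the ratio v
  = s / t of the two scales.\<close>

definition inv_const :: "'a::euclidean_space itself \<Rightarrow> real \<Rightarrow> real" where
  "inv_const _ \<alpha> = (measure (gauss :: 'a measure) UNIV)\<^sup>2 / 2 * (\<integral>v. v / (1 + v\<^sup>2) \<partial>pw \<alpha>)"

lemma pw_integral_pos:
  fixes f :: "real \<Rightarrow> real"
  assumes i: "integrable (pw a) f" and nonneg: "\<And>t. 0 < t \<Longrightarrow> 0 \<le> f t"
    and pos: "\<And>t. 0 < t \<Longrightarrow> t < 1 \<Longrightarrow> 0 < f t"
  shows "0 < (\<integral>t. f t \<partial>pw a)"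
proof -
  have nn: "AE t in pw a. 0 \<le> f t"
    using AE_pw_pos by eventually_elim (rule nonneg)
  have "(\<integral>t. f t \<partial>pw a) \<noteq> 0"
  proof
    assume "(\<integral>t. f t \<partial>pw a) = 0"
    then have "AE t in pw a. f t = 0"
      using integral_nonneg_eq_0_iff_AE[OF i nn] by simp
    then have "AE t in pw a. t \<notin> {0<..<1}"
      by eventually_elim (use pos in fastforce)
    then have "AE t in lborel. t \<notin> {0<..<1::real}"
      unfolding pw_def by (subst (asm) AE_density) (auto simp: indicator_def elim!: eventually_mono)
    then have "emeasure lborel {0<..<1::real} = 0"
      by (subst (asm) AE_iff_measurable[where N="{0<..<1}"]) auto
    then show False by simp
  qed
  then show ?thesis
    using integral_nonneg_AE[OF nn] by linarith
qed

lemma inv_kernel: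
  assumes \<alpha>: "0 < \<alpha>" "\<alpha> < 1"
  shows "integrable (pw \<alpha>) (\<lambda>v. v / (1 + v\<^sup>2))" "0 < (\<integral>v. v / (1 + v\<^sup>2) \<partial>pw \<alpha>)"
proof -
  show i: "integrable (pw \<alpha>) (\<lambda>v. v / (1 + v\<^sup>2))"
  proof (rule integrable_pw_bound[OF \<alpha>, where C=1])
    fix v :: real assume v: "0 < v"
    have "2 * v \<le> 1 + v\<^sup>2"
      using zero_le_power2[of "v - 1"] by (simp add: power2_eq_square algebra_simps)
    then have v1: "v \<le> 1 + v\<^sup>2" using v by linarith
    have pos: "0 < 1 + v\<^sup>2" by (simp add: add_pos_nonneg)
    have "v / (1 + v\<^sup>2) \<le> 1" using v1 pos by (simp add: divide_le_eq)
    moreover have "v / (1 + v\<^sup>2) \<le> 1 / v" using v pos by (simp add: field_simps power2_eq_square)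
    ultimately show "norm (v / (1 + v\<^sup>2)) \<le> 1 * min 1 (1 / v)" using v pos by simp
  qed auto
  show "0 < (\<integral>v. v / (1 + v\<^sup>2) \<partial>pw \<alpha>)"
    by (rule pw_integral_pos[OF i]) (simp_all add: add_pos_nonneg add_nonneg_nonneg)
qed

lemma inv_const_pos: "0 < \<alpha> \<Longrightarrow> \<alpha> < 1 \<Longrightarrow> 0 < inv_const TYPE('a::euclidean_space) \<alpha>"
  unfolding inv_const_def using inv_kernel(2) gauss_mass_pos[where 'a='a] by simp

text \<open>Both operators are integrals over scales, t for the divergence and s for the potential.
  For fixed s and t the two Gaussian averages merge into one at scale sqrt (s^2 + t^2); separating
  the ratio s / t from the common size then leaves a telescoping integral.\<close>

theorem gauss_div_riesz:
  fixes g :: "'a::euclidean_space \<Rightarrow> real"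
  assumes \<alpha>: "0 < \<alpha>" "\<alpha> < 1" and bd: "bounded_L1 A g" and bl: "bounded_lipschitz B g"
  shows "gauss_div \<alpha> (riesz \<alpha> g) x = - inv_const TYPE('a) \<alpha> * g x"
proof -
  let ?G = "measure (gauss :: 'a measure) UNIV"
  note [measurable] = bounded_L1_borel[OF bd] heat_avg_borel[OF bounded_L1_borel[OF bd]]
  have gA: "\<bar>g y\<bar> \<le> A" for y using bd by (auto simp: bounded_L1_def)
  define G1 where "G1 = 1 + (\<integral>N. norm (N::'a) \<partial>gauss)"
  define V where "V s y = (\<integral>N. g (y + s *\<^sub>R N) *\<^sub>R N \<partial>gauss)" for s y
  have [measurable]: "(\<lambda>p. V (fst p) (snd p)) \<in> borel_measurable (borel \<Otimes>\<^sub>M borel)"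
    unfolding V_def by measurable
  have Vb: "norm (V s y) \<le> A * G1 * min 1 (1 / s)" if "0 < s" for s y
    unfolding V_def G1_def by (rule bounded_L1_average_decay(4)[OF bd that])
  have Vi: "integrable (pw \<alpha>) (\<lambda>s. V s y)" for y
    unfolding V_def by (rule riesz_integrable[OF \<alpha> bd])
  have inner: "(\<integral>N. N \<bullet> riesz \<alpha> g (x + t *\<^sub>R N) \<partial>gauss)
      = (\<integral>s. s * t / (s\<^sup>2 + t\<^sup>2) * ?G * heat_avg g x (sqrt (s\<^sup>2 + t\<^sup>2)) \<partial>pw \<alpha>)" if t: "0 < t" for t
  proof -
    have int: "integrable (gauss \<Otimes>\<^sub>M pw \<alpha>) (\<lambda>(N, s). N \<bullet> V s (x + t *\<^sub>R N))"
    proof (rule gauss_pw.integrable_pair_dominated[where B="\<lambda>N. norm N * (A * G1 * pw_const \<alpha>)"])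
      show "AE N in gauss. integrable (pw \<alpha>) (\<lambda>s. case (N, s) of (N, s) \<Rightarrow> N \<bullet> V s (x + t *\<^sub>R N)) \<and>
        (\<integral>s. norm (case (N, s) of (N, s) \<Rightarrow> N \<bullet> V s (x + t *\<^sub>R N)) \<partial>pw \<alpha>) \<le> norm N * (A * G1 * pw_const \<alpha>)"
      proof (rule AE_I2)
        fix N :: 'a
        have i: "integrable (pw \<alpha>) (\<lambda>s. N \<bullet> V s (x + t *\<^sub>R N))"
          using Vi by (rule integrable_inner_right)
        have "(\<integral>s. \<bar>N \<bullet> V s (x + t *\<^sub>R N)\<bar> \<partial>pw \<alpha>) \<le> (\<integral>s. norm N * (A * G1) * min 1 (1 / s) \<partial>pw \<alpha>)"
        proof (rule integral_mono_AE)
          show "AE s in pw \<alpha>. \<bar>N \<bullet> V s (x + t *\<^sub>R N)\<bar> \<le> norm N * (A * G1) * min 1 (1 / s)"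
            using AE_pw_pos
          proof eventually_elim
            case (elim s)
            show ?case
              using order_trans[OF Cauchy_Schwarz_ineq2[of N "V s (x + t *\<^sub>R N)"] mult_left_mono[OF Vb[OF elim]]]
              by (simp add: mult.assoc)
          qed
        qed (use i integrable_pw_min[OF \<alpha>] in auto)
        then show "integrable (pw \<alpha>) (\<lambda>s. case (N, s) of (N, s) \<Rightarrow> N \<bullet> V s (x + t *\<^sub>R N)) \<and>
          (\<integral>s. norm (case (N, s) of (N, s) \<Rightarrow> N \<bullet> V s (x + t *\<^sub>R N)) \<partial>pw \<alpha>) \<le> norm N * (A * G1 * pw_const \<alpha>)"
          using i by (simp add: pw_const_def mult.assoc)
      qed
      show "(\<lambda>(N, s). N \<bullet> V s (x + t *\<^sub>R N)) \<in> borel_measurable (gauss \<Otimes>\<^sub>M pw \<alpha>)"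
        unfolding V_def case_prod_beta by measurable
      show "integrable gauss (\<lambda>N::'a. norm N * (A * G1 * pw_const \<alpha>))"
        by (intro integrable_mult_left integrable_gauss_norm)
    qed
    have "(\<integral>N. N \<bullet> riesz \<alpha> g (x + t *\<^sub>R N) \<partial>gauss) = (\<integral>N. (\<integral>s. N \<bullet> V s (x + t *\<^sub>R N) \<partial>pw \<alpha>) \<partial>gauss)"
      unfolding riesz_def V_def[symmetric] using Vi by simp
    also have "\<dots> = (\<integral>s. (\<integral>N. N \<bullet> V s (x + t *\<^sub>R N) \<partial>gauss) \<partial>pw \<alpha>)"
      by (rule gauss_pw.Fubini_integral[symmetric]) (use int in simp)
    also have "\<dots> = (\<integral>s. s * t / (s\<^sup>2 + t\<^sup>2) * ?G * heat_avg g x (sqrt (s\<^sup>2 + t\<^sup>2)) \<partial>pw \<alpha>)"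
    proof (rule integral_cong_AE)
      show "AE s in pw \<alpha>. (\<integral>N. N \<bullet> V s (x + t *\<^sub>R N) \<partial>gauss) = s * t / (s\<^sup>2 + t\<^sup>2) * ?G * heat_avg g x (sqrt (s\<^sup>2 + t\<^sup>2))"
        using AE_pw_pos
      proof eventually_elim
        case (elim s)
        have "(\<integral>N. N \<bullet> V s (x + t *\<^sub>R N) \<partial>gauss) = (\<integral>a. (\<integral>b. g (x + t *\<^sub>R a + s *\<^sub>R b) * (a \<bullet> b) \<partial>gauss) \<partial>gauss)"
          unfolding V_def using bounded_L1_average_decay(3)[OF bd elim]
          by (subst integral_inner_right[symmetric]) auto
        also have "\<dots> = s * t / (s\<^sup>2 + t\<^sup>2) * ?G * heat_avg g x (sqrt (s\<^sup>2 + t\<^sup>2))"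
          using gauss_double_average_inner[of g A s t x] gA elim t by (simp add: heat_avg_def)
        finally show ?case .
      qed
      show "(\<lambda>s. \<integral>N. N \<bullet> V s (x + t *\<^sub>R N) \<partial>gauss) \<in> borel_measurable (pw \<alpha>)"
        unfolding V_def by measurable
    qed measurable
    finally show ?thesis .
  qed
  \<comment> \<open>\<open>W\<close> is the integrand after substituting s = t v: the weight s t /
    (s^2 + t^2) depends on v alone and the radius becomes t sqrt (1 + v^2). Scaling
    \<open>pw \<alpha>\<close> leaves t^\<alpha>, which turns \<open>pw (- \<alpha>)\<close> into
    dt/t.\<close>
  define W where "W v t = v / (1 + v\<^sup>2) * heat_avg g x (sqrt (1 + v\<^sup>2) * t)" for v t
  have [measurable]: "(\<lambda>t. \<integral>v. W v t \<partial>pw \<alpha>) \<in> borel_measurable borel"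
    unfolding W_def by measurable
  have inner2: "(\<integral>N. N \<bullet> riesz \<alpha> g (x + t *\<^sub>R N) \<partial>gauss) = t powr \<alpha> *\<^sub>R (?G * (\<integral>v. W v t \<partial>pw \<alpha>))" if t: "0 < t" for t
  proof -
    let ?F = "\<lambda>s. s * t / (s\<^sup>2 + t\<^sup>2) * heat_avg g x (sqrt (s\<^sup>2 + t\<^sup>2))"
    have "?F (t * v) = W v t" for v
    proof -
      have e: "(t * v)\<^sup>2 + t\<^sup>2 = t\<^sup>2 * (1 + v\<^sup>2)" by (simp add: power2_eq_square algebra_simps)
      have "sqrt ((t * v)\<^sup>2 + t\<^sup>2) = sqrt (1 + v\<^sup>2) * t"
        unfolding e using t by (simp add: real_sqrt_mult)
      moreover have "t * v * t / ((t * v)\<^sup>2 + t\<^sup>2) = v / (1 + v\<^sup>2)"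
        unfolding e using t by (simp add: power2_eq_square)
      ultimately show ?thesis by (simp add: W_def)
    qed
    then have "(\<integral>v. W v t \<partial>pw \<alpha>) = t powr (- \<alpha>) *\<^sub>R (\<integral>s. ?F s \<partial>pw \<alpha>)"
      using pw_scale(2)[OF t, of ?F \<alpha>] by simp
    then have "(\<integral>s. ?F s \<partial>pw \<alpha>) = t powr \<alpha> * (\<integral>v. W v t \<partial>pw \<alpha>)"
      using t by (simp add: powr_minus)
    moreover have "(\<integral>N. N \<bullet> riesz \<alpha> g (x + t *\<^sub>R N) \<partial>gauss) = ?G * (\<integral>s. ?F s \<partial>pw \<alpha>)"
      unfolding inner[OF t] by (simp add: mult_ac flip: integral_mult_right_zero)
    ultimately show ?thesis by simp
  qed
  have sq: "0 < sqrt (1 + v\<^sup>2)" for v :: real by (simp add: add_pos_nonneg)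
  note hi = integral_heat_avg[OF bd bl, of x]
  have Wi: "integrable (pw \<alpha> \<Otimes>\<^sub>M pw 0) (\<lambda>(v, t). W v t)"
  proof (rule pw_pw.integrable_pair_dominated[where B="\<lambda>v. v / (1 + v\<^sup>2) * (\<integral>r. \<bar>heat_avg g x r\<bar> \<partial>pw 0)"])
    show "AE v in pw \<alpha>. integrable (pw 0) (\<lambda>t. case (v, t) of (v, t) \<Rightarrow> W v t) \<and>
       (\<integral>t. norm (case (v, t) of (v, t) \<Rightarrow> W v t) \<partial>pw 0) \<le> v / (1 + v\<^sup>2) * (\<integral>r. \<bar>heat_avg g x r\<bar> \<partial>pw 0)"
      using AE_pw_pos
    proof eventually_elim
      case (elim v)
      have i: "integrable (pw 0) (\<lambda>t. W v t)"
        unfolding W_def using pw_scale(1)[OF sq[of v], of "heat_avg g x" 0] hi(1) by simp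
      have "(\<integral>t. \<bar>heat_avg g x (sqrt (1 + v\<^sup>2) * t)\<bar> \<partial>pw 0) = (\<integral>r. \<bar>heat_avg g x r\<bar> \<partial>pw 0)"
        using pw_scale(2)[OF sq[of v], of "\<lambda>r. \<bar>heat_avg g x r\<bar>" 0] sq[of v] by simp
      moreover have "0 \<le> v / (1 + v\<^sup>2)" using elim by (simp add: add_nonneg_nonneg)
      ultimately show ?case using i elim by (simp add: W_def abs_mult)
    qed
    show "integrable (pw \<alpha>) (\<lambda>v. v / (1 + v\<^sup>2) * (\<integral>r. \<bar>heat_avg g x r\<bar> \<partial>pw 0))"
      by (intro integrable_mult_left inv_kernel(1)[OF \<alpha>])
    show "(\<lambda>(v, t). W v t) \<in> borel_measurable (pw \<alpha> \<Otimes>\<^sub>M pw 0)"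
      unfolding W_def case_prod_beta by measurable
  qed
  have "gauss_div \<alpha> (riesz \<alpha> g) x = (\<integral>t. t powr \<alpha> *\<^sub>R (?G * (\<integral>v. W v t \<partial>pw \<alpha>)) \<partial>pw (- \<alpha>))"
    unfolding gauss_div_def
  proof (rule integral_cong_AE)
    show "(\<lambda>t. \<integral>N. N \<bullet> riesz \<alpha> g (x + t *\<^sub>R N) \<partial>gauss) \<in> borel_measurable (pw (- \<alpha>))"
      unfolding riesz_def by measurable
    show "(\<lambda>t. t powr \<alpha> *\<^sub>R (?G * (\<integral>v. W v t \<partial>pw \<alpha>))) \<in> borel_measurable (pw (- \<alpha>))"
      by measurable
    show "AE t in pw (- \<alpha>). (\<integral>N. N \<bullet> riesz \<alpha> g (x + t *\<^sub>R N) \<partial>gauss) = t powr \<alpha> *\<^sub>R (?G * (\<integral>v. W v t \<partial>pw \<alpha>))"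
      using AE_pw_pos by eventually_elim (rule inner2)
  qed
  also have "\<dots> = (\<integral>t. ?G * (\<integral>v. W v t \<partial>pw \<alpha>) \<partial>pw 0)"
    by (subst pw_shift) simp_all
  also have "\<dots> = ?G * (\<integral>t. (\<integral>v. W v t \<partial>pw \<alpha>) \<partial>pw 0)"
    by (rule integral_mult_right_zero)
  also have "(\<integral>t. (\<integral>v. W v t \<partial>pw \<alpha>) \<partial>pw 0) = (\<integral>v. (\<integral>t. W v t \<partial>pw 0) \<partial>pw \<alpha>)"
    by (rule pw_pw.Fubini_integral[OF Wi])
  \<comment> \<open>Since dt/t is dilation invariant, the factor sqrt (1 + v^2) disappears and the
    inner integral no longer depends on v.\<close>
  also have "\<dots> = (\<integral>v. v / (1 + v\<^sup>2) * (\<integral>r. heat_avg g x r \<partial>pw 0) \<partial>pw \<alpha>)"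
    unfolding W_def using pw_scale(2)[OF sq, of "heat_avg g x" 0] sq by (simp add: less_imp_neq[symmetric])
  also have "\<dots> = (\<integral>v. v / (1 + v\<^sup>2) \<partial>pw \<alpha>) * (\<integral>r. heat_avg g x r \<partial>pw 0)"
    by (rule integral_mult_left_zero)
  finally show ?thesis
    unfolding hi(2) inv_const_def by (simp add: power2_eq_square)
qed

section \<open>The fractional divergence\<close>

definition kernel_const :: "'a::euclidean_space itself \<Rightarrow> real \<Rightarrow> real" where
  "kernel_const _ \<alpha> = (\<integral>t. exp (- (1 / t)\<^sup>2) / t ^ (DIM('a) + 1) \<partial>pw (- \<alpha>))"

lemma kernel_const_pos:
  assumes \<alpha>: "0 < \<alpha>" "\<alpha> < 1"
  shows "0 < kernel_const TYPE('a::euclidean_space) \<alpha>"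
proof -
  let ?n = "DIM('a)"
  obtain C1 where C1: "C1 > 0" "\<forall>x::real. norm x ^ (?n + 1) * exp (- ((norm x)\<^sup>2 / 2)) \<le> C1"
    by (rule norm_power_exp_bounded)
  \<comment> \<open>The extra power of 1/t compared with \<open>C1\<close> pays for the factor t
    that is needed near 0.\<close>
  obtain C2 where C2: "C2 > 0" "\<forall>x::real. norm x ^ (?n + 2) * exp (- ((norm x)\<^sup>2 / 2)) \<le> C2"
    by (rule norm_power_exp_bounded)
  have "integrable (pw (- \<alpha>)) (\<lambda>t. exp (- (1 / t)\<^sup>2) / t ^ (?n + 1))"
  proof (rule integrable_pw_neg[OF \<alpha>, where C="C1 + C2"])
    fix t :: real assume t: "0 < t"
    have e: "exp (- (1 / t)\<^sup>2) \<le> exp (- ((norm (1 / t))\<^sup>2 / 2))" using t by simp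
    have "exp (- (1 / t)\<^sup>2) / t ^ (?n + 1) = norm (1 / t) ^ (?n + 1) * exp (- (1 / t)\<^sup>2)"
      using t by (simp add: power_divide)
    also have "\<dots> \<le> norm (1 / t) ^ (?n + 1) * exp (- ((norm (1 / t))\<^sup>2 / 2))"
      using e t by (intro mult_left_mono) auto
    also have "\<dots> \<le> C1" using C1(2) by blast
    finally have 1: "exp (- (1 / t)\<^sup>2) / t ^ (?n + 1) \<le> C1" .
    have "exp (- (1 / t)\<^sup>2) / t ^ (?n + 1) = t * (norm (1 / t) ^ (?n + 2) * exp (- (1 / t)\<^sup>2))"
      using t by (simp add: power_divide field_simps)
    also have "\<dots> \<le> t * (norm (1 / t) ^ (?n + 2) * exp (- ((norm (1 / t))\<^sup>2 / 2)))"
      using e t by (intro mult_left_mono) auto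
    also have "\<dots> \<le> t * C2" by (rule mult_left_mono[OF C2(2)[rule_format]]) (use t in simp)
    finally have 2: "exp (- (1 / t)\<^sup>2) / t ^ (?n + 1) \<le> t * C2" .
    have "exp (- (1 / t)\<^sup>2) / t ^ (?n + 1) \<le> (C1 + C2) * min 1 t"
    proof (cases "t \<le> 1")
      case True
      have "t * C2 \<le> (C1 + C2) * t" using C1(1) t by (simp add: algebra_simps)
      then show ?thesis using 2 True by (simp add: min_def)
    next
      case False
      then show ?thesis using 1 C2(1) by (simp add: min_def)
    qed
    then show "norm (exp (- (1 / t)\<^sup>2) / t ^ (?n + 1)) \<le> (C1 + C2) * min 1 t"
      using t by simp
  qed auto
  then show ?thesis
    unfolding kernel_const_def by (rule pw_integral_pos) simp_all
qed

text \<open>Homogeneity reduces the scale integral at distance \<open>r\<close> to the one at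
  distance 1, so the power law needs no evaluation of the constant.\<close>

lemma kernel_superposition:
  fixes \<alpha> :: real
  assumes r: "0 < r"
  shows "(\<integral>t. exp (- (r / t)\<^sup>2) / t ^ (DIM('a) + 1) \<partial>pw (- \<alpha>))
    = kernel_const TYPE('a::euclidean_space) \<alpha> / r powr (real DIM('a) + \<alpha> + 1)"
proof -
  let ?F = "\<lambda>t. exp (- (r / t)\<^sup>2) / t ^ (DIM('a) + 1)"
  have "?F (r * t) = exp (- (1 / t)\<^sup>2) / t ^ (DIM('a) + 1) / r ^ (DIM('a) + 1)" for t
    using r by (simp add: power_mult_distrib)
  then have "(\<integral>t. ?F (r * t) \<partial>pw (- \<alpha>)) = kernel_const TYPE('a) \<alpha> / r ^ (DIM('a) + 1)"
    unfolding kernel_const_def by (simp only: integral_divide_zero)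
  then have "r powr \<alpha> * (\<integral>t. ?F t \<partial>pw (- \<alpha>)) = kernel_const TYPE('a) \<alpha> / r ^ (DIM('a) + 1)"
    using pw_scale(2)[OF r, of ?F "- \<alpha>"] by simp
  then have "(\<integral>t. ?F t \<partial>pw (- \<alpha>)) = kernel_const TYPE('a) \<alpha> / (r ^ (DIM('a) + 1) * r powr \<alpha>)"
    using r by (simp add: field_simps)
  also have "r ^ (DIM('a) + 1) * r powr \<alpha> = r powr (real DIM('a) + \<alpha> + 1)"
    using r by (simp add: powr_add powr_realpow)
  finally show ?thesis .
qed

interpretation pw_lborel: pair_sigma_finite "pw a" "lborel :: 'a::euclidean_space measure" for a ..

text \<open>Integrating the Gaussian kernels over all scales first produces the power kernel. The
  exchange is made after \<phi> x has been subtracted, when the absolute integral at scale t is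
  bounded by a multiple of min 1 t.\<close>

lemma gauss_div_eq_singular_integral:
  fixes \<phi> :: "'a::euclidean_space \<Rightarrow> 'a"
  assumes \<alpha>: "0 < \<alpha>" "\<alpha> < 1" and bl: "bounded_lipschitz B \<phi>"
  shows "gauss_div \<alpha> \<phi> x = kernel_const TYPE('a) \<alpha> *
    (\<integral>w. (w \<bullet> (\<phi> (x + w) - \<phi> x)) / norm w powr (real DIM('a) + \<alpha> + 1) \<partial>lborel)"
proof -
  let ?n = "DIM('a)"
  note [measurable] = bounded_lipschitz_borel[OF bl]
  define \<Delta> where "\<Delta> w = w \<bullet> (\<phi> (x + w) - \<phi> x)" for w
  have [measurable]: "\<Delta> \<in> borel_measurable borel" unfolding \<Delta>_def by measurable
  define k where "k t w = exp (- (norm w / t)\<^sup>2) / t ^ (?n + 1) * \<Delta> w" for t w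
  define m where "m = (\<integral>N. 2 * norm N + (norm (N::'a))\<^sup>2 \<partial>gauss)"
  have inner: "(\<integral>N. N \<bullet> \<phi> (x + t *\<^sub>R N) \<partial>gauss) = (\<integral>w. k t w \<partial>lborel)"
    "integrable lborel (k t)" "(\<integral>w. norm (k t w) \<partial>lborel) \<le> B * m * min 1 t" if t: "0 < t" for t
  proof -
    let ?f = "\<lambda>w. \<Delta> w / t"
    have f: "N \<bullet> (\<phi> (x + t *\<^sub>R N) - \<phi> x) = ?f (t *\<^sub>R N)" for N using t by (simp add: \<Delta>_def)
    have kf: "(exp (- (norm w / t)\<^sup>2) / t ^ ?n) *\<^sub>R ?f w = k t w" for w
      by (simp add: k_def)
    have kf': "(exp (- (norm w / t)\<^sup>2) / t ^ ?n) *\<^sub>R \<bar>?f w\<bar> = norm (k t w)" for w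
      using t by (simp add: k_def abs_mult)
    note gb = gauss_inner_bound[OF bl t, of x]
    show "(\<integral>N. N \<bullet> \<phi> (x + t *\<^sub>R N) \<partial>gauss) = (\<integral>w. k t w \<partial>lborel)"
      unfolding gb(3) f kf[symmetric] by (rule integral_gauss_scale(1)[OF t]) measurable
    show "integrable lborel (k t)"
      using gb(2) integral_gauss_scale(2)[OF t, of ?f] unfolding f kf by simp
    show "(\<integral>w. norm (k t w) \<partial>lborel) \<le> B * m * min 1 t"
      using gb(1) integral_gauss_scale(1)[OF t, of "\<lambda>w. \<bar>?f w\<bar>"] unfolding f kf' m_def by simp
  qed
  have ki: "integrable (pw (- \<alpha>) \<Otimes>\<^sub>M lborel) (\<lambda>(t, w). k t w)"
  proof (rule pw_lborel.integrable_pair_dominated[where B="\<lambda>t. B * m * min 1 t"])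
    show "(\<lambda>(t, w). k t w) \<in> borel_measurable (pw (- \<alpha>) \<Otimes>\<^sub>M lborel)"
      unfolding k_def case_prod_beta by measurable
    show "integrable (pw (- \<alpha>)) (\<lambda>t. B * m * min 1 t)"
      by (intro integrable_mult_right integrable_pw_neg[OF \<alpha>, where C=1]) auto
    show "AE t in pw (- \<alpha>). integrable lborel (\<lambda>w. case (t, w) of (t, w) \<Rightarrow> k t w) \<and>
        (\<integral>w. norm (case (t, w) of (t, w) \<Rightarrow> k t w) \<partial>lborel) \<le> B * m * min 1 t"
      using AE_pw_pos by eventually_elim (use inner(2,3) in auto)
  qed
  have "gauss_div \<alpha> \<phi> x = (\<integral>t. (\<integral>w. k t w \<partial>lborel) \<partial>pw (- \<alpha>))"
    unfolding gauss_div_def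
  proof (rule integral_cong_AE)
    show "(\<lambda>t. \<integral>w. k t w \<partial>lborel) \<in> borel_measurable (pw (- \<alpha>))"
      unfolding k_def by measurable
    show "AE t in pw (- \<alpha>). (\<integral>N. N \<bullet> \<phi> (x + t *\<^sub>R N) \<partial>gauss) = (\<integral>w. k t w \<partial>lborel)"
      using AE_pw_pos by eventually_elim (rule inner(1))
  qed measurable
  also have "\<dots> = (\<integral>w. (\<integral>t. k t w \<partial>pw (- \<alpha>)) \<partial>lborel)"
    by (rule pw_lborel.Fubini_integral[symmetric, OF ki])
  also have "\<dots> = (\<integral>w. kernel_const TYPE('a) \<alpha> * (\<Delta> w / norm w powr (real ?n + \<alpha> + 1)) \<partial>lborel)"
  proof (rule Bochner_Integration.integral_cong[OF refl])
    fix w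
    have "(\<integral>t. k t w \<partial>pw (- \<alpha>)) = (\<integral>t. exp (- (norm w / t)\<^sup>2) / t ^ (?n + 1) \<partial>pw (- \<alpha>)) * \<Delta> w"
      unfolding k_def by (rule integral_mult_left_zero)
    also have "\<dots> = kernel_const TYPE('a) \<alpha> * (\<Delta> w / norm w powr (real ?n + \<alpha> + 1))"
    proof (cases "w = 0")
      case False
      then have "0 < norm w" by simp
      then show ?thesis unfolding kernel_superposition[OF \<open>0 < norm w\<close>] by simp
    qed (simp add: \<Delta>_def)
    finally show "(\<integral>t. k t w \<partial>pw (- \<alpha>)) = kernel_const TYPE('a) \<alpha> * (\<Delta> w / norm w powr (real ?n + \<alpha> + 1))" .
  qed
  also have "\<dots> = kernel_const TYPE('a) \<alpha> * (\<integral>w. \<Delta> w / norm w powr (real ?n + \<alpha> + 1) \<partial>lborel)"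
    by (rule integral_mult_right_zero)
  finally show ?thesis by (simp add: \<Delta>_def)
qed

text \<open>The factor is positive and does not depend on \<phi>, so both the upper bound for the
  inclusion and the divergence for strictness can be proved for \<open>gauss_div\<close>.\<close>

lemma div_frac_eq_gauss_div:
  fixes \<phi> :: "real ^ 'n \<Rightarrow> real ^ 'n"
  assumes \<alpha>: "0 < \<alpha>" "\<alpha> < 1" and bl: "bounded_lipschitz B \<phi>"
  shows "div_frac \<alpha> \<phi> x = mu_frac CARD('n) \<alpha> / kernel_const TYPE(real ^ 'n) \<alpha> * gauss_div \<alpha> \<phi> x"
proof -
  note [measurable] = bounded_lipschitz_borel[OF bl]
  let ?h = "\<lambda>y. ((y - x) \<bullet> (\<phi> y - \<phi> x)) / norm (y - x) powr (real CARD('n) + \<alpha> + 1)"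
  have [measurable]: "?h \<in> borel_measurable borel" by measurable
  have "(\<integral>y. ?h y \<partial>lebesgue) = (\<integral>y. ?h y \<partial>lborel)"
    by (rule integral_completion) simp
  also have "\<dots> = (\<integral>w. ?h (x + w) \<partial>lborel)"
    by (rule integral_lborel_translation[symmetric]) simp
  finally have "(\<integral>y. ?h y \<partial>lebesgue) = (\<integral>w. (w \<bullet> (\<phi> (x + w) - \<phi> x)) / norm w powr (real CARD('n) + \<alpha> + 1) \<partial>lborel)"
    by simp
  moreover have "gauss_div \<alpha> \<phi> x = kernel_const TYPE(real ^ 'n) \<alpha> *
      (\<integral>w. (w \<bullet> (\<phi> (x + w) - \<phi> x)) / norm w powr (real CARD('n) + \<alpha> + 1) \<partial>lborel)"
    using gauss_div_eq_singular_integral[OF \<alpha> bl, of x] by simp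
  ultimately show ?thesis
    using kernel_const_pos[OF \<alpha>, where 'a="real ^ 'n"] by (simp add: div_frac_def)
qed

lemma mu_frac_pos:
  assumes "0 < \<alpha>" "\<alpha> < 1" shows "0 < mu_frac n \<alpha>"
  unfolding mu_frac_def using assms by (intro mult_pos_pos divide_pos_pos Gamma_real_pos) auto

section \<open>The inclusion\<close>

subsection \<open>Smooth test functions determine the \<open>L\<^sup>1\<close> norm\<close>

lemma mollify:
  fixes \<theta> :: "'a::euclidean_space \<Rightarrow> real"
  assumes cont: "continuous_on UNIV \<theta>" and supp: "\<forall>x. R < norm x \<longrightarrow> \<theta> x = 0"
    and le1: "\<And>x. \<bar>\<theta> x\<bar> \<le> 1" and e: "0 < e"
  obtains \<psi> where "\<psi> \<in> Cc_infinity" and "\<forall>x. \<bar>\<psi> x\<bar> \<le> 1" and "\<forall>x. \<bar>\<psi> x - \<theta> x\<bar> \<le> e"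
proof -
  have [measurable]: "\<theta> \<in> borel_measurable borel" using cont by (rule borel_measurable_continuous_onI)
  have "uniformly_continuous_on (cball 0 (R + 1)) \<theta>"
    using cont by (intro compact_uniformly_continuous) (auto intro: continuous_on_subset)
  then obtain d0 where d0: "d0 > 0" "\<And>x y. x \<in> cball 0 (R+1) \<Longrightarrow> y \<in> cball 0 (R+1) \<Longrightarrow> dist y x < d0 \<Longrightarrow> dist (\<theta> y) (\<theta> x) < e"
    unfolding uniformly_continuous_on_def using e by metis
  \<comment> \<open>The bound d \<le> 1 ensures that two points closer than d either both lie in the
    ball of radius R + 1, where \<theta> is uniformly continuous, or both lie outside the ball of
    radius R.\<close>
  define d where "d = min d0 1"
  have d: "d > 0" using d0 by (simp add: d_def)
  have uc: "\<bar>\<theta> y - \<theta> x\<bar> \<le> e" if "norm (y - x) < d" for x y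
  proof (cases "x \<in> cball 0 (R + 1) \<and> y \<in> cball 0 (R + 1)")
    case True
    then show ?thesis using d0(2)[of x y] that by (simp add: d_def dist_norm)
  next
    case False
    have "norm x - norm y < 1" "norm y - norm x < 1"
      using that norm_triangle_ineq2[of x y] norm_triangle_ineq2[of y x] by (simp_all add: d_def norm_minus_commute)
    then have "R < norm x" "R < norm y" using False by auto
    then show ?thesis using supp e by simp
  qed
  note [measurable] = Cc_infinity_borel[OF bump_Cc_infinity[where 'a='a]]
  have bi: "integrable lborel (bump :: 'a \<Rightarrow> real)" by (rule Cc_infinity_integrable[OF bump_Cc_infinity])
  define c0 where "c0 = (\<integral>u. bump (u::'a) \<partial>lborel)"
  have c0: "c0 > 0"
  proof -
    have "c0 \<noteq> 0"
    proof
      assume "c0 = 0"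
      then have "AE u in lborel. bump (u::'a) = 0"
        unfolding c0_def using integral_nonneg_eq_0_iff_AE[OF bi] bump_nonneg by auto
      then have "AE u in lborel. (u::'a) \<notin> ball 0 1"
        by eventually_elim (metis bump_pos_iff dist_0_norm less_irrefl mem_ball)
      then have "emeasure lborel (ball (0::'a) 1) = 0"
        by (subst (asm) AE_iff_measurable[where N="ball 0 1"]) auto
      then show False using content_ball_pos[of 1 "0::'a"] by (simp add: measure_def)
    qed
    moreover have "0 \<le> c0" unfolding c0_def by (rule integral_nonneg_AE) (simp add: bump_nonneg)
    ultimately show ?thesis by simp
  qed
  define \<rho> where "\<rho> y = (1 / (c0 * d ^ DIM('a))) *\<^sub>R bump (0 + (1 / d) *\<^sub>R y)" for y :: 'a
  have \<rho>C: "\<rho> \<in> Cc_infinity"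
    unfolding \<rho>_def using d by (intro Cc_infinity_scaleR Cc_infinity_affine bump_Cc_infinity) auto
  note [measurable] = Cc_infinity_borel[OF \<rho>C]
  have \<rho>0: "0 \<le> \<rho> y" for y using c0 d by (simp add: \<rho>_def bump_nonneg)
  have \<rho>s: "\<rho> y = 0" if "d \<le> norm y" for y using that d by (simp add: \<rho>_def bump_eq_0 field_simps)
  have \<rho>i: "integrable lborel (\<lambda>w. \<rho> (x + (-1) *\<^sub>R w))" for x
    by (subst integrable_lborel_affine_iff) (use Cc_infinity_integrable[OF \<rho>C] in auto)
  have \<rho>1: "(\<integral>w. \<rho> (x + (-1) *\<^sub>R w) \<partial>lborel) = 1" for x
  proof -
    have "(\<integral>w. \<rho> (x + (-1) *\<^sub>R w) \<partial>lborel) = (\<integral>w. \<rho> w \<partial>lborel)"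
      using integral_lborel_affine[of "-1" \<rho> x] by simp
    also have "\<dots> = (\<bar>d\<bar> ^ DIM('a)) *\<^sub>R (\<integral>w. \<rho> (0 + d *\<^sub>R w) \<partial>lborel)"
      using d by (intro integral_lborel_affine) auto
    also have "\<dots> = 1" using d c0 by (simp add: \<rho>_def c0_def[symmetric])
    finally show ?thesis .
  qed
  have \<theta>i: "integrable lborel \<theta>"
  proof -
    have "integrable lborel (\<lambda>x. indicator (cball 0 R) x *\<^sub>R \<theta> x)"
      using cont by (intro borel_integrable_compact) (auto intro: continuous_on_subset)
    also have "(\<lambda>x. indicator (cball 0 R) x *\<^sub>R \<theta> x) = \<theta>"
      using supp by (force simp: indicator_def)
    finally show ?thesis .
  qed
  \<comment> \<open>The convolution is written with the smooth factor shifted and \<theta> as the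
    integrable density, the form required for differentiating a superposition.\<close>
  define \<psi> where "\<psi> x = (\<integral>w. \<rho> (x + (-1) *\<^sub>R w) *\<^sub>R \<theta> w \<partial>lborel)" for x
  have \<psi>C: "\<psi> \<in> Cc_infinity"
    unfolding \<psi>_def
  proof (rule Cc_infinity_superposition[OF \<rho>C \<theta>i, where R=R])
    show "norm ((- 1) *\<^sub>R w) \<le> R" if "\<theta> w \<noteq> 0" for w using that supp by force
  qed simp
  have pi: "integrable lborel (\<lambda>w. \<rho> (x + (-1) *\<^sub>R w) *\<^sub>R \<theta> w)" for x
    by (rule Bochner_Integration.integrable_bound[OF \<rho>i[of x]])
      (use le1 \<rho>0 in \<open>auto simp: abs_mult mult_left_le\<close>)
  have "\<bar>\<psi> x\<bar> \<le> 1" for x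
  proof -
    have "norm (\<psi> x) \<le> (\<integral>w. \<rho> (x + (-1) *\<^sub>R w) \<partial>lborel)"
      unfolding \<psi>_def by (rule norm_integral_le_integral[OF pi \<rho>i]) (use le1 \<rho>0 in \<open>auto simp: abs_mult mult_left_le\<close>)
    then show ?thesis using \<rho>1 by simp
  qed
  moreover have "\<bar>\<psi> x - \<theta> x\<bar> \<le> e" for x
  proof -
    have xi: "integrable lborel (\<lambda>w. \<rho> (x + (-1) *\<^sub>R w) * \<theta> x)" using \<rho>i[of x] by (rule integrable_mult_left)
    have "\<theta> x = (\<integral>w. \<rho> (x + (-1) *\<^sub>R w) * \<theta> x \<partial>lborel)"
      using \<rho>1[of x] by (subst integral_mult_left_zero) simp
    then have "\<psi> x - \<theta> x = (\<integral>w. \<rho> (x + (-1) *\<^sub>R w) *\<^sub>R \<theta> w \<partial>lborel) - (\<integral>w. \<rho> (x + (-1) *\<^sub>R w) * \<theta> x \<partial>lborel)"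
      unfolding \<psi>_def by simp
    also have "\<dots> = (\<integral>w. \<rho> (x + (-1) *\<^sub>R w) *\<^sub>R \<theta> w - \<rho> (x + (-1) *\<^sub>R w) * \<theta> x \<partial>lborel)"
      by (rule Bochner_Integration.integral_diff[symmetric, OF pi xi])
    finally have eq: "\<psi> x - \<theta> x = (\<integral>w. \<rho> (x + (-1) *\<^sub>R w) *\<^sub>R \<theta> w - \<rho> (x + (-1) *\<^sub>R w) * \<theta> x \<partial>lborel)" .
    have "norm (\<psi> x - \<theta> x) \<le> (\<integral>w. \<rho> (x + (-1) *\<^sub>R w) * e \<partial>lborel)"
      unfolding eq
    proof (rule norm_integral_le_integral[OF Bochner_Integration.integrable_diff[OF pi xi]])
      show "integrable lborel (\<lambda>w. \<rho> (x + (-1) *\<^sub>R w) * e)" using \<rho>i[of x] by (rule integrable_mult_left)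
      fix w
      have "norm (\<rho> (x + (-1) *\<^sub>R w) *\<^sub>R \<theta> w - \<rho> (x + (-1) *\<^sub>R w) * \<theta> x) = \<rho> (x + (-1) *\<^sub>R w) * \<bar>\<theta> w - \<theta> x\<bar>"
        using \<rho>0 by (simp add: abs_mult flip: right_diff_distrib)
      also have "\<dots> \<le> \<rho> (x + (-1) *\<^sub>R w) * e"
      proof (cases "norm (w - x) < d")
        case True
        then show ?thesis using uc \<rho>0 by (intro mult_left_mono) auto
      next
        case False
        then have "\<rho> (x + (-1) *\<^sub>R w) = 0" by (intro \<rho>s) (simp add: norm_minus_commute)
        then show ?thesis by simp
      qed
      finally show "norm (\<rho> (x + (-1) *\<^sub>R w) *\<^sub>R \<theta> w - \<rho> (x + (-1) *\<^sub>R w) * \<theta> x) \<le> \<rho> (x + (-1) *\<^sub>R w) * e" .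
    qed
    also have "\<dots> = e" using \<rho>1[of x] by (subst integral_mult_left_zero) simp
    finally show ?thesis by simp
  qed
  ultimately show ?thesis using that[OF \<psi>C] by blast
qed

text \<open>The optimal test function is the sign of d. It is an almost everywhere limit of
  continuous functions of bounded support with values in [-1, 1], and each of these is a uniform
  limit of smooth ones.\<close>

lemma L1_norm_le_of_smooth_tests:
  fixes d :: "'a::euclidean_space \<Rightarrow> real"
  assumes di: "integrable lborel d"
    and test: "\<And>\<psi>. \<psi> \<in> Cc_infinity \<Longrightarrow> \<forall>x. \<bar>\<psi> x\<bar> \<le> 1 \<Longrightarrow> (\<integral>x. d x * \<psi> x \<partial>lborel) \<le> C"
  shows "(\<integral>x. \<bar>d x\<bar> \<partial>lborel) \<le> C"
proof -
  have [measurable]: "d \<in> borel_measurable borel" using di by auto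
  have cont_test: "(\<integral>x. d x * \<theta> x \<partial>lborel) \<le> C"
    if cont: "continuous_on UNIV \<theta>" and supp: "\<forall>x. R < norm x \<longrightarrow> \<theta> x = 0" and le1: "\<And>x. \<bar>\<theta> x\<bar> \<le> 1" for \<theta> R
  proof (rule field_le_epsilon)
    fix e :: real assume e: "0 < e"
    have [measurable]: "\<theta> \<in> borel_measurable borel" using cont by (rule borel_measurable_continuous_onI)
    define N where "N = (\<integral>x. \<bar>d x\<bar> \<partial>lborel) + 1"
    have N: "0 < N" unfolding N_def by (simp add: add_nonneg_pos)
    then have "0 < e / N" using e by simp
    then obtain \<psi> where \<psi>: "\<psi> \<in> Cc_infinity" "\<forall>x. \<bar>\<psi> x\<bar> \<le> 1" "\<forall>x. \<bar>\<psi> x - \<theta> x\<bar> \<le> e / N"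
      by (rule mollify[OF cont supp le1])
    note [measurable] = Cc_infinity_borel[OF \<psi>(1)]
    have i1: "integrable lborel (\<lambda>x. d x * \<theta> x)"
      by (rule Bochner_Integration.integrable_bound[OF di]) (use le1 in \<open>auto simp: abs_mult mult_left_le\<close>)
    have i2: "integrable lborel (\<lambda>x. d x * \<psi> x)"
      by (rule Bochner_Integration.integrable_bound[OF di]) (use \<psi>(2) in \<open>auto simp: abs_mult mult_left_le\<close>)
    have "(\<integral>x. d x * \<theta> x \<partial>lborel) - (\<integral>x. d x * \<psi> x \<partial>lborel) = (\<integral>x. d x * \<theta> x - d x * \<psi> x \<partial>lborel)"
      by (rule Bochner_Integration.integral_diff[symmetric, OF i1 i2])
    also have "\<dots> \<le> (\<integral>x. \<bar>d x\<bar> * (e / N) \<partial>lborel)"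
    proof (rule integral_mono)
      show "integrable lborel (\<lambda>x. \<bar>d x\<bar> * (e / N))" using integrable_abs[OF di] by (rule integrable_mult_left)
      fix x
      have "d x * \<theta> x - d x * \<psi> x \<le> \<bar>d x\<bar> * \<bar>\<psi> x - \<theta> x\<bar>"
        by (metis abs_ge_self abs_minus_commute abs_mult right_diff_distrib)
      also have "\<dots> \<le> \<bar>d x\<bar> * (e / N)" using \<psi>(3) by (intro mult_left_mono) auto
      finally show "d x * \<theta> x - d x * \<psi> x \<le> \<bar>d x\<bar> * (e / N)" .
    qed (use i1 i2 in auto)
    also have "\<dots> = (N - 1) * (e / N)" by (subst integral_mult_left_zero) (simp add: N_def)
    also have "\<dots> \<le> e" using N e by (simp add: field_simps)
    finally show "(\<integral>x. d x * \<theta> x \<partial>lborel) \<le> C + e"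
      using test[OF \<psi>(1,2)] by linarith
  qed
  have "(\<lambda>x. sgn (d x)) \<in> borel_measurable lborel" by (simp add: borel_measurable_sgn)
  then have "(\<lambda>x. sgn (d x)) \<in> borel_measurable lebesgue" by (rule measurable_completion)
  then have "(\<lambda>x. sgn (d x)) measurable_on UNIV"
    by (rule lebesgue_measurable_imp_measurable_on_real) simp
  then obtain Z g where Z: "negligible Z" and gc: "\<And>n. continuous_on UNIV (g n)"
    and gl: "\<And>x. x \<notin> Z \<Longrightarrow> (\<lambda>n. g n x) \<longlonglongrightarrow> sgn (d x)"
    unfolding measurable_on_def by auto
  \<comment> \<open>Clamping to [-1, 1] does not disturb the convergence, as the limit is a sign;
    the second factor cuts off at radius n + 1 and equals 1 on the ball of radius n.\<close>
  define \<theta> where "\<theta> n x = max (- 1) (min 1 (g n x)) * max 0 (min 1 (real n + 1 - norm x))" for n :: nat and x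
  have \<theta>c: "continuous_on UNIV (\<theta> n)" for n
    unfolding \<theta>_def using gc[of n] by (intro continuous_intros) auto
  note [measurable] = borel_measurable_continuous_onI[OF \<theta>c]
  have \<theta>1: "\<bar>\<theta> n x\<bar> \<le> 1" for n x
  proof -
    have "\<bar>max (- 1) (min 1 (g n x))\<bar> * \<bar>max 0 (min 1 (real n + 1 - norm x))\<bar> \<le> 1 * 1"
      by (intro mult_mono) auto
    then show ?thesis by (simp add: \<theta>_def abs_mult)
  qed
  have \<theta>s: "\<forall>x. real n + 1 < norm x \<longrightarrow> \<theta> n x = 0" for n by (simp add: \<theta>_def)
  have AEZ: "AE x in lborel. x \<notin> Z"
    using Z by (metis AE_completion_iff AE_not_in negligible_iff_null_sets)
  have "(\<lambda>n. \<integral>x. d x * \<theta> n x \<partial>lborel) \<longlonglongrightarrow> (\<integral>x. d x * sgn (d x) \<partial>lborel)"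
  proof (rule integral_dominated_convergence[where w="\<lambda>x. \<bar>d x\<bar>"])
    show "AE x in lborel. (\<lambda>n. d x * \<theta> n x) \<longlonglongrightarrow> d x * sgn (d x)"
      using AEZ
    proof eventually_elim
      case (elim x)
      have "(\<lambda>n. max (- 1) (min 1 (g n x))) \<longlonglongrightarrow> max (- 1) (min 1 (sgn (d x)))"
        using gl[OF elim] by (intro tendsto_intros)
      moreover have "max (- 1) (min 1 (sgn (d x))) = sgn (d x)" by (simp add: sgn_if)
      moreover have "(\<lambda>n. max 0 (min 1 (real n + 1 - norm x))) \<longlonglongrightarrow> 1"
      proof (rule tendsto_eventually)
        show "eventually (\<lambda>n. max 0 (min 1 (real n + 1 - norm x)) = 1) sequentially"
          using eventually_ge_at_top[of "nat \<lceil>norm x\<rceil>"]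
        proof eventually_elim
          case (elim n)
          then have "norm x \<le> real n" by linarith
          then show ?case by simp
        qed
      qed
      ultimately have "(\<lambda>n. \<theta> n x) \<longlonglongrightarrow> sgn (d x) * 1"
        unfolding \<theta>_def by (intro tendsto_mult) simp_all
      then show ?case by (intro tendsto_intros) simp
    qed
    show "AE x in lborel. norm (d x * \<theta> n x) \<le> \<bar>d x\<bar>" for n
      using \<theta>1 by (auto simp: abs_mult mult_left_le)
  qed (use di in \<open>auto simp: borel_measurable_sgn\<close>)
  then have "(\<integral>x. d x * sgn (d x) \<partial>lborel) \<le> C"
    by (rule LIMSEQ_le_const2) (use cont_test[OF \<theta>c \<theta>s \<theta>1] in auto)
  moreover have "d x * sgn (d x) = \<bar>d x\<bar>" for x by (simp add: mult_sgn_abs abs_sgn)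
  ultimately show ?thesis by simp
qed

subsection \<open>Estimates for the Riesz kernel of smooth differences\<close>

lemma Cc_infinity_bounded_L1:
  fixes g :: "'a::euclidean_space \<Rightarrow> real"
  assumes g: "g \<in> Cc_infinity"
  obtains A where "A > 0" and "bounded_L1 A g" and "bounded_lipschitz A g"
    and "\<forall>v. bounded_L1 (A * norm v) (\<lambda>x. g (x + v) - g x)"
proof -
  obtain B where B: "B > 0" "bounded_lipschitz B g" by (rule Cc_infinity_bounded_lipschitz[OF g])
  obtain R where R: "\<forall>x. R < norm x \<longrightarrow> g x = 0" by (rule Cc_infinity_supportE[OF g])
  note [measurable] = Cc_infinity_borel[OF g]
  have gi: "integrable lborel g" by (rule Cc_infinity_integrable[OF g])
  define M where "M = measure lborel (cball (0::'a) R)"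
  have L: "\<bar>g y - g z\<bar> \<le> B * norm (y - z)" "\<bar>g y\<bar> \<le> B" for y z using B(2) by (auto simp: bounded_lipschitz_def)
  \<comment> \<open>Each summand serves one claim. The last is for increments: they are at most B
    |v| and live on two balls of measure M.\<close>
  define A where "A = B + (\<integral>x. \<bar>g x\<bar> \<partial>lborel) + 2 * B * M"
  have M: "0 \<le> M" by (simp add: M_def)
  have AB: "B \<le> A" unfolding A_def using M B(1) by simp
  have bd: "bounded_L1 A g"
    unfolding bounded_L1_def
  proof (intro conjI allI)
    show "\<bar>g x\<bar> \<le> A" for x using L(2)[of x] AB by linarith
    show "(\<integral>x. \<bar>g x\<bar> \<partial>lborel) \<le> A" unfolding A_def using M B(1) by simp
  qed (rule gi)
  have bl: "bounded_lipschitz A g"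
    unfolding bounded_lipschitz_def
  proof (intro conjI allI)
    show "norm (g x) \<le> A" for x using L(2)[of x] AB by simp
    show "norm (g x - g y) \<le> A * norm (x - y)" for x y
      using order_trans[OF L(1) mult_right_mono[OF AB]] by simp
  qed
  have "bounded_L1 (A * norm v) (\<lambda>x. g (x + v) - g x)" for v
    unfolding bounded_L1_def
  proof (intro conjI allI)
    have "\<bar>g (x + v) - g x\<bar> \<le> B * norm v" for x
      using L(1)[of "x + v" x] by simp
    then show "\<bar>g (x + v) - g x\<bar> \<le> A * norm v" for x
      using order_trans mult_right_mono[OF AB, of "norm v"] by fastforce
    have gv: "integrable lborel (\<lambda>x. g (x + v))"
      using integrable_lborel_translation_iff[of g v] gi by (simp add: add.commute)
    then show di: "integrable lborel (\<lambda>x. g (x + v) - g x)" using gi by (rule Bochner_Integration.integrable_diff)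
    have ci: "integrable lborel (indicator (cball a R) :: 'a \<Rightarrow> real)" for a
      by (rule integrable_real_indicator) (use emeasure_lborel_cball_finite[of a R] in simp_all)
    have mc: "measure lborel (cball (- v) R) = M"
    proof -
      have "(\<integral>x. indicator (cball (- v) R) x \<partial>lborel) = (\<integral>x. (indicator (cball 0 R) (v + x) :: real) \<partial>lborel)"
        by (rule Bochner_Integration.integral_cong[OF refl])
          (auto simp: indicator_def dist_norm norm_minus_commute add.commute)
      also have "\<dots> = (\<integral>x. (indicator (cball (0::'a) R) x :: real) \<partial>lborel)"
        by (rule integral_lborel_translation) (rule borel_measurable_indicator, simp)
      finally show ?thesis by (simp add: M_def)
    qed
    have "(\<integral>x. \<bar>g (x + v) - g x\<bar> \<partial>lborel) \<le> (\<integral>x. B * norm v * (indicator (cball 0 R) x + indicator (cball (- v) R) x) \<partial>lborel)"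
    proof (rule integral_mono)
      show "integrable lborel (\<lambda>x. B * norm v * (indicator (cball 0 R) x + indicator (cball (- v) R) x))"
        by (intro integrable_mult_right Bochner_Integration.integrable_add ci)
      show "\<bar>g (x + v) - g x\<bar> \<le> B * norm v * (indicator (cball 0 R) x + indicator (cball (- v) R) x)" for x
      proof (cases "norm x \<le> R \<or> norm (x + v) \<le> R")
        case True
        have "dist (- v) x = norm (x + v)" by (simp add: dist_norm norm_minus_commute add.commute)
        with True have "1 \<le> (indicator (cball 0 R) x + indicator (cball (- v) R) x :: real)"
          by (auto simp: indicator_def)
        then have "B * norm v * 1 \<le> B * norm v * (indicator (cball 0 R) x + indicator (cball (- v) R) x)"
          using B(1) by (intro mult_left_mono) auto
        then show ?thesis using L(1)[of "x + v" x] by simp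
      next
        case False
        then show ?thesis using R B(1) by auto
      qed
    qed (use di in auto)
    also have "\<dots> = B * norm v * (M + M)"
      using ci[of 0] ci[of "- v"] by (simp add: mc M_def[symmetric])
    also have "\<dots> \<le> A * norm v"
    proof -
      have "2 * B * M \<le> A" unfolding A_def using B(1) by simp
      then have "2 * B * M * norm v \<le> A * norm v" by (rule mult_right_mono) simp
      then show ?thesis by (simp add: mult_ac)
    qed
    finally show "(\<integral>x. \<bar>g (x + v) - g x\<bar> \<partial>lborel) \<le> A * norm v" .
  qed
  then show ?thesis using that[OF _ bd bl] AB B(1) by auto
qed

text \<open>The potential is linear and commutes with translations, so its increments are potentials
  of increments of g, and the sup bound applies to these.\<close>

lemma riesz_bounded_lipschitz:
  fixes g :: "'a::euclidean_space \<Rightarrow> real"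
  assumes \<alpha>: "0 < \<alpha>" "\<alpha> < 1" and bd: "bounded_L1 A g"
    and tr: "\<forall>v. bounded_L1 (A * norm v) (\<lambda>x. g (x + v) - g x)"
  shows "bounded_lipschitz ((1 + (\<integral>N. norm (N::'a) \<partial>gauss)) * pw_const \<alpha> * A) (riesz \<alpha> g)"
  unfolding bounded_lipschitz_def
proof (intro conjI allI)
  show "norm (riesz \<alpha> g x) \<le> (1 + (\<integral>N. norm (N::'a) \<partial>gauss)) * pw_const \<alpha> * A" for x
    by (rule riesz_bound[OF \<alpha> bd])
  fix x y
  have "riesz \<alpha> g x - riesz \<alpha> g y = riesz \<alpha> (\<lambda>z. g (z + (x - y)) - g z) y"
    unfolding riesz_diff[OF \<alpha> bounded_L1_translate[OF bd] bd]
    by (simp add: riesz_def algebra_simps)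
  then show "norm (riesz \<alpha> g x - riesz \<alpha> g y) \<le> (1 + (\<integral>N. norm (N::'a) \<partial>gauss)) * pw_const \<alpha> * A * norm (x - y)"
    using riesz_bound[OF \<alpha> tr[rule_format, of "x - y"], of y] by (simp add: mult.assoc)
qed

text \<open>At each scale the translation is moved from \<psi> onto the Gaussian kernel, so \<psi>
  enters only through |\<psi>| \<le> 1. The constant is therefore uniform in \<psi>, and summing
  over scales gives the power of |h|.\<close>

lemma riesz_difference_bound:
  assumes \<alpha>: "0 < \<alpha>" "\<alpha> < 1"
  obtains C where "C > 0" and "\<forall>\<psi> h (x::'a::euclidean_space). \<psi> \<in> Cc_infinity \<longrightarrow> (\<forall>x. \<bar>\<psi> x\<bar> \<le> 1) \<longrightarrow>
    h \<noteq> 0 \<longrightarrow> norm (riesz \<alpha> (\<lambda>x. \<psi> (x + h) - \<psi> x) x) \<le> C * norm h powr \<alpha>"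
proof -
  let ?q = "\<lambda>z::'a. exp (- (norm z)\<^sup>2) *\<^sub>R z"
  obtain K where K: "K \<ge> 0" "\<forall>h. (\<integral>z. norm (?q (z + h) - ?q z) \<partial>lborel) \<le> K * min 1 (norm h)"
    by (rule gauss_moment_kernel_translation_bound)
  have "norm (riesz \<alpha> (\<lambda>x. \<psi> (x + h) - \<psi> x) x) \<le> (K * pw_const \<alpha> + 1) * norm h powr \<alpha>"
    if \<psi>: "\<psi> \<in> Cc_infinity" "\<forall>x. \<bar>\<psi> x\<bar> \<le> 1" and h: "h \<noteq> 0" for \<psi> and h x :: 'a
  proof -
    note [measurable] = Cc_infinity_borel[OF \<psi>(1)]
    obtain A where A: "A > 0" "bounded_L1 A \<psi>" "bounded_lipschitz A \<psi>" "\<forall>v. bounded_L1 (A * norm v) (\<lambda>x. \<psi> (x + v) - \<psi> x)"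
      by (rule Cc_infinity_bounded_L1[OF \<psi>(1)])
    have qi: "integrable lborel ?q"
    proof -
      have "integrable gauss (\<lambda>x::'a. x)"
        by (rule integrable_gauss_bound[where C=1 and k=1]) auto
      then show ?thesis by (subst (asm) integrable_gauss_iff) auto
    qed
    have qh: "integrable lborel (\<lambda>z. ?q (z + v))" for v
      using integrable_lborel_translation_iff[of ?q v] qi by (simp add: add.commute)
    have inner: "norm (\<integral>N. (\<psi> (x + s *\<^sub>R N + h) - \<psi> (x + s *\<^sub>R N)) *\<^sub>R N \<partial>gauss) \<le> K * min 1 (norm h / s)" if s: "0 < s" for s
    proof -
      \<comment> \<open>A shift by h in space is a shift by h / s of the standard Gaussian vector at
        scale s.\<close>
      define v where "v = (1 / s) *\<^sub>R h"
      have sv: "s *\<^sub>R v = h" using s by (simp add: v_def)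
      have bi: "integrable lborel (\<lambda>z. \<psi> (x + s *\<^sub>R z) *\<^sub>R ?q (z + u))" for u
        by (rule Bochner_Integration.integrable_bound[OF qh[of u]]) (measurable, use \<psi>(2) in \<open>simp add: mult_left_le_one_le del: scaleR_scaleR\<close>)
      have i1: "integrable gauss (\<lambda>N. \<psi> (x + s *\<^sub>R N + h) *\<^sub>R N)"
        using bounded_L1_average_decay(3)[OF A(2) s, of "x + h"] by (simp add: add_ac)
      have i2: "integrable gauss (\<lambda>N. \<psi> (x + s *\<^sub>R N) *\<^sub>R N)"
        by (rule bounded_L1_average_decay(3)[OF A(2) s])
      have e1: "(\<integral>N. \<psi> (x + s *\<^sub>R N + h) *\<^sub>R N \<partial>gauss) = (\<integral>z. \<psi> (x + s *\<^sub>R z) *\<^sub>R ?q (z + - v) \<partial>lborel)"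
      proof -
        have "(\<integral>N. \<psi> (x + s *\<^sub>R N + h) *\<^sub>R N \<partial>gauss) = (\<integral>N. \<psi> (x + s *\<^sub>R (v + N)) *\<^sub>R ?q ((v + N) + - v) \<partial>lborel)"
          by (subst integral_gauss) (simp_all add: scaleR_add_right sv add_ac mult.commute)
        also have "\<dots> = (\<integral>z. \<psi> (x + s *\<^sub>R z) *\<^sub>R ?q (z + - v) \<partial>lborel)"
          by (rule integral_lborel_translation[where f="\<lambda>z. \<psi> (x + s *\<^sub>R z) *\<^sub>R ?q (z + - v)"]) measurable
        finally show ?thesis .
      qed
      have e2: "(\<integral>N. \<psi> (x + s *\<^sub>R N) *\<^sub>R N \<partial>gauss) = (\<integral>z. \<psi> (x + s *\<^sub>R z) *\<^sub>R ?q (z + 0) \<partial>lborel)"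
        by (subst integral_gauss) (simp_all add: mult.commute)
      have "(\<integral>N. (\<psi> (x + s *\<^sub>R N + h) - \<psi> (x + s *\<^sub>R N)) *\<^sub>R N \<partial>gauss)
        = (\<integral>N. \<psi> (x + s *\<^sub>R N + h) *\<^sub>R N \<partial>gauss) - (\<integral>N. \<psi> (x + s *\<^sub>R N) *\<^sub>R N \<partial>gauss)"
        unfolding scaleR_diff_left by (rule Bochner_Integration.integral_diff[OF i1 i2])
      also have "\<dots> = (\<integral>z. \<psi> (x + s *\<^sub>R z) *\<^sub>R ?q (z + - v) - \<psi> (x + s *\<^sub>R z) *\<^sub>R ?q (z + 0) \<partial>lborel)"
        unfolding e1 e2 by (rule Bochner_Integration.integral_diff[symmetric, OF bi bi])
      finally have eq: "(\<integral>N. (\<psi> (x + s *\<^sub>R N + h) - \<psi> (x + s *\<^sub>R N)) *\<^sub>R N \<partial>gauss)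
        = (\<integral>z. \<psi> (x + s *\<^sub>R z) *\<^sub>R ?q (z + - v) - \<psi> (x + s *\<^sub>R z) *\<^sub>R ?q (z + 0) \<partial>lborel)" .
      have "norm (\<integral>N. (\<psi> (x + s *\<^sub>R N + h) - \<psi> (x + s *\<^sub>R N)) *\<^sub>R N \<partial>gauss) \<le> (\<integral>z. norm (?q (z + - v) - ?q z) \<partial>lborel)"
        unfolding eq
      proof (rule norm_integral_le_integral[OF Bochner_Integration.integrable_diff[OF bi bi]])
        show "integrable lborel (\<lambda>z. norm (?q (z + - v) - ?q z))"
          by (intro integrable_norm Bochner_Integration.integrable_diff qh qi)
        fix z
        have "norm (\<psi> (x + s *\<^sub>R z) *\<^sub>R ?q (z + - v) - \<psi> (x + s *\<^sub>R z) *\<^sub>R ?q (z + 0)) = \<bar>\<psi> (x + s *\<^sub>R z)\<bar> * norm (?q (z + - v) - ?q z)"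
          unfolding scaleR_diff_right[symmetric] norm_scaleR by simp
        also have "\<dots> \<le> 1 * norm (?q (z + - v) - ?q z)" using \<psi>(2) by (intro mult_right_mono) auto
        finally show "norm (\<psi> (x + s *\<^sub>R z) *\<^sub>R ?q (z + - v) - \<psi> (x + s *\<^sub>R z) *\<^sub>R ?q (z + 0)) \<le> norm (?q (z + - v) - ?q z)" by simp
      qed
      also have "\<dots> \<le> K * min 1 (norm (- v))" using K(2) by blast
      also have "norm (- v) = norm h / s" using s by (simp add: v_def)
      finally show ?thesis .
    qed
    have h0: "0 < norm h" using h by simp
    note mi = pw_min_scale[OF \<alpha> h0]
    have "norm (riesz \<alpha> (\<lambda>x. \<psi> (x + h) - \<psi> x) x) \<le> (\<integral>s. norm (\<integral>N. (\<psi> (x + s *\<^sub>R N + h) - \<psi> (x + s *\<^sub>R N)) *\<^sub>R N \<partial>gauss) \<partial>pw \<alpha>)"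
      unfolding riesz_def by (rule integral_norm_bound)
    also have "\<dots> \<le> (\<integral>s. K * min 1 (norm h / s) \<partial>pw \<alpha>)"
    proof (rule integral_mono_AE)
      show "AE s in pw \<alpha>. norm (\<integral>N. (\<psi> (x + s *\<^sub>R N + h) - \<psi> (x + s *\<^sub>R N)) *\<^sub>R N \<partial>gauss) \<le> K * min 1 (norm h / s)"
        using AE_pw_pos by eventually_elim (rule inner)
      show "integrable (pw \<alpha>) (\<lambda>s. norm (\<integral>N. (\<psi> (x + s *\<^sub>R N + h) - \<psi> (x + s *\<^sub>R N)) *\<^sub>R N \<partial>gauss))"
        using riesz_integrable[OF \<alpha> A(4)[rule_format, of h], of x] by (rule integrable_norm)
    qed (use mi(1) in auto)
    also have "\<dots> = K * pw_const \<alpha> * norm h powr \<alpha>" by (simp add: mi(2))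
    also have "\<dots> \<le> (K * pw_const \<alpha> + 1) * norm h powr \<alpha>" by (intro mult_right_mono) auto
    finally show ?thesis .
  qed
  moreover have "0 < K * pw_const \<alpha> + 1" using K(1) pw_const_nonneg by (simp add: add_nonneg_pos)
  ultimately show ?thesis using that by blast
qed

section \<open>Duality: from bounded variation to differences in L^1\<close>

lemma gauss_div_mult_integrable:
  fixes f :: "'a::euclidean_space \<Rightarrow> real"
  assumes \<alpha>: "0 < \<alpha>" "\<alpha> < 1" and bl: "bounded_lipschitz B \<phi>" and fi: "integrable lborel f"
  shows "integrable lborel (\<lambda>x. f x * gauss_div \<alpha> \<phi> x)"
    and "\<bar>\<integral>x. f x * gauss_div \<alpha> \<phi> x \<partial>lborel\<bar> \<le> (\<integral>x. \<bar>f x\<bar> \<partial>lborel) * (B * gauss_div_const TYPE('a) \<alpha>)"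
proof -
  let ?D = "B * gauss_div_const TYPE('a) \<alpha>"
  note [measurable] = gauss_div_borel[OF bl]
  have le: "\<bar>f x * gauss_div \<alpha> \<phi> x\<bar> \<le> \<bar>f x\<bar> * ?D" for x
    unfolding abs_mult by (intro mult_left_mono gauss_div_bound[OF \<alpha> bl]) simp
  have Di: "integrable lborel (\<lambda>x. \<bar>f x\<bar> * ?D)"
    using integrable_abs[OF fi] by (rule integrable_mult_left)
  show i: "integrable lborel (\<lambda>x. f x * gauss_div \<alpha> \<phi> x)"
    by (rule Bochner_Integration.integrable_bound[OF Di])
      (measurable, use fi in simp, use le in \<open>auto intro: order_trans[OF _ abs_ge_self]\<close>)
  have "norm (\<integral>x. f x * gauss_div \<alpha> \<phi> x \<partial>lborel) \<le> (\<integral>x. \<bar>f x\<bar> * ?D \<partial>lborel)"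
    by (rule norm_integral_le_integral[OF i Di]) (use le in simp)
  then show "\<bar>\<integral>x. f x * gauss_div \<alpha> \<phi> x \<partial>lborel\<bar> \<le> (\<integral>x. \<bar>f x\<bar> \<partial>lborel) * ?D"
    by (subst (asm) integral_mult_left_zero) simp
qed

text \<open>The error is measured in the norm that controls \<open>gauss_div\<close> uniformly, so
  the divergence of the approximating test field is uniformly close to that of the
  potential.\<close>

lemma riesz_approximation:
  fixes g :: "'a::euclidean_space \<Rightarrow> real"
  assumes \<alpha>: "0 < \<alpha>" "\<alpha> < 1" and g: "g \<in> Cc_infinity" and e: "0 < e"
  obtains \<phi> where "\<phi> \<in> Cc_infinity" and "bounded_lipschitz e (\<lambda>x. riesz \<alpha> g x - \<phi> x)"
proof -
  obtain A where A: "A > 0" "bounded_L1 A g" "bounded_lipschitz A g" "\<forall>v. bounded_L1 (A * norm v) (\<lambda>x. g (x + v) - g x)"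
    by (rule Cc_infinity_bounded_L1[OF g])
  note [measurable] = Cc_infinity_borel[OF g]
  have eA: "0 < e / A" using e A(1) by simp
  obtain m :: "real \<times> 'a \<Rightarrow> 'a" and R where m: "integrable (pw \<alpha> \<Otimes>\<^sub>M gauss) m"
    and mR: "\<forall>w. m w \<noteq> 0 \<longrightarrow> norm (fst w *\<^sub>R snd w) \<le> R"
    and tr: "\<forall>A' g x. bounded_L1 A' g \<longrightarrow>
      norm (riesz \<alpha> g x - (\<integral>w. g (x + fst w *\<^sub>R snd w) *\<^sub>R m w \<partial>(pw \<alpha> \<Otimes>\<^sub>M gauss))) \<le> e / A * A'"
    by (rule riesz_truncation[OF \<alpha> eA])
  define T where "T g x = (\<integral>w. g (x + fst w *\<^sub>R snd w) *\<^sub>R m w \<partial>(pw \<alpha> \<Otimes>\<^sub>M gauss))" for g :: "'a \<Rightarrow> real" and x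
  have [measurable]: "m \<in> borel_measurable (borel \<Otimes>\<^sub>M borel)"
    using borel_measurable_integrable[OF m] by (simp cong: measurable_cong_sets sets_pair_measure_cong)
  have gi: "integrable (pw \<alpha> \<Otimes>\<^sub>M gauss) (\<lambda>w. g (x + fst w *\<^sub>R snd w) *\<^sub>R m w)" for x
    by (rule Bochner_Integration.integrable_bound[where f="\<lambda>w. A *\<^sub>R m w"])
      (use m A in \<open>auto simp: bounded_L1_def intro!: mult_right_mono\<close>)
  have "T g \<in> Cc_infinity"
    unfolding T_def by (rule Cc_infinity_superposition[OF g m _, where R=R]) (use mR in auto)
  moreover have "bounded_lipschitz e (\<lambda>x. riesz \<alpha> g x - T g x)"
    unfolding bounded_lipschitz_def
  proof (intro conjI allI)
    show "norm (riesz \<alpha> g x - T g x) \<le> e" for x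
      using tr[rule_format, OF A(2), of x] A(1) by (simp add: T_def)
    fix x y
    \<comment> \<open>An increment of the error is the truncation error of an increment of g, and
      that increment has bound A |x - y|.\<close>
    let ?g = "\<lambda>z. g (z + (x - y)) - g z"
    have "T ?g y = T g x - T g y"
      using gi[of x] gi[of y] by (simp add: T_def scaleR_diff_left algebra_simps)
    moreover have "riesz \<alpha> ?g y = riesz \<alpha> g x - riesz \<alpha> g y"
      unfolding riesz_diff[OF \<alpha> bounded_L1_translate[OF A(2)] A(2)]
      by (simp add: riesz_def algebra_simps)
    ultimately have "riesz \<alpha> g x - T g x - (riesz \<alpha> g y - T g y) = riesz \<alpha> ?g y - T ?g y"
      by (simp add: algebra_simps)
    then show "norm (riesz \<alpha> g x - T g x - (riesz \<alpha> g y - T g y)) \<le> e * norm (x - y)"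
      using tr[rule_format, OF A(4)[rule_format, of "x - y"], of y] A(1) by (simp add: T_def)
  qed
  ultimately show ?thesis by (rule that)
qed

text \<open>Up to a constant, a test function g is the divergence of its Riesz potential, so a bound
  on the variation of f bounds the pairing of f with g by the sup norm of that potential. For g a
  difference of translates this sup norm is of order |h|^\<alpha>.\<close>

lemma frac_variation_imp_difference_bound:
  fixes f :: "real ^ 'n \<Rightarrow> real"
  assumes \<alpha>: "0 < \<alpha>" "\<alpha> < 1" and fi: "integrable lborel f"
    and V: "\<And>\<phi>. \<phi> \<in> Cc_infinity \<Longrightarrow> \<forall>x. norm (\<phi> x) \<le> 1 \<Longrightarrow> (\<integral>x. f x * div_frac \<alpha> \<phi> x \<partial>lborel) \<le> V"
  obtains C where "\<forall>h. h \<noteq> 0 \<longrightarrow> (\<integral>x. \<bar>f (x + h) - f x\<bar> \<partial>lborel) \<le> C * norm h powr \<alpha>"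
proof -
  define \<kappa> where "\<kappa> = mu_frac CARD('n) \<alpha> / kernel_const TYPE(real ^ 'n) \<alpha>"
  have \<kappa>: "0 < \<kappa>"
    unfolding \<kappa>_def using mu_frac_pos[OF \<alpha>] kernel_const_pos[OF \<alpha>] by (rule divide_pos_pos)
  define c where "c = inv_const TYPE(real ^ 'n) \<alpha>"
  have c: "0 < c" unfolding c_def by (rule inv_const_pos[OF \<alpha>])
  define D where "D = (\<integral>x. \<bar>f x\<bar> \<partial>lborel) * gauss_div_const TYPE(real ^ 'n) \<alpha>"
  have scaled: "\<bar>\<integral>x. f x * gauss_div \<alpha> \<phi> x \<partial>lborel\<bar> \<le> V * b / \<kappa>"
    if \<phi>: "\<phi> \<in> Cc_infinity" and b: "0 < b" "\<forall>x. norm (\<phi> x) \<le> b" for \<phi> b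
  proof -
    \<comment> \<open>The signs s = 1 and s = -1 turn the one-sided bound on test fields into a
      bound on the absolute value.\<close>
    have "s * (\<integral>x. f x * gauss_div \<alpha> \<phi> x \<partial>lborel) \<le> V * b / \<kappa>" if s: "\<bar>s\<bar> = 1" for s :: real
    proof -
      let ?\<phi> = "\<lambda>x. (s / b) *\<^sub>R \<phi> x"
      have C: "?\<phi> \<in> Cc_infinity" by (rule Cc_infinity_scaleR[OF \<phi>])
      obtain B where B: "bounded_lipschitz B ?\<phi>" by (rule Cc_infinity_bounded_lipschitz[OF C])
      have "f x * div_frac \<alpha> ?\<phi> x = \<kappa> * (s / b) * (f x * gauss_div \<alpha> \<phi> x)" for x
        unfolding div_frac_eq_gauss_div[OF \<alpha> B] gauss_div_scaleR \<kappa>_def by (simp add: mult_ac)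
      then have "(\<integral>x. f x * div_frac \<alpha> ?\<phi> x \<partial>lborel) = \<kappa> * (s / b) * (\<integral>x. f x * gauss_div \<alpha> \<phi> x \<partial>lborel)"
        by (simp only: integral_mult_right_zero)
      moreover have "\<forall>x. norm (?\<phi> x) \<le> 1" using b s by (simp add: abs_mult)
      ultimately have "\<kappa> * (s / b) * (\<integral>x. f x * gauss_div \<alpha> \<phi> x \<partial>lborel) \<le> V" using V[OF C] by simp
      then show ?thesis using \<kappa> b(1) by (simp add: field_simps)
    qed
    from this[of 1] this[of "- 1"] show ?thesis by (simp add: abs_le_iff)
  qed
  have V0: "0 \<le> V"
  proof -
    have "(\<lambda>_. 0 :: real ^ 'n) \<in> Cc_infinity" by (rule Cc_infinityI[where r=0]) (auto intro: Ck_const)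
    from scaled[OF this, of 1] have "0 \<le> V * 1 / \<kappa>" by (simp add: order_trans[OF abs_ge_zero])
    then show ?thesis using \<kappa> by (simp add: zero_le_divide_iff)
  qed
  \<comment> \<open>The bound sees g only through the sup norm of its potential; its other norms
    enter auxiliary estimates alone.\<close>
  have dual: "c * \<bar>\<integral>x. f x * g x \<partial>lborel\<bar> \<le> V * M / \<kappa>"
    if g: "g \<in> Cc_infinity" and M: "0 \<le> M" "\<forall>x. norm (riesz \<alpha> g x) \<le> M" for g M
  proof -
    obtain A where A: "A > 0" "bounded_L1 A g" "bounded_lipschitz A g" "\<forall>v. bounded_L1 (A * norm v) (\<lambda>x. g (x + v) - g x)"
      by (rule Cc_infinity_bounded_L1[OF g])
    note rbl = riesz_bounded_lipschitz[OF \<alpha> A(2,4)]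
    \<comment> \<open>The approximation quality e costs V e / \<kappa> for the enlarged sup bound M
      + e of the test field, and e D for the divergence of the error field.\<close>
    have est: "c * \<bar>\<integral>x. f x * g x \<partial>lborel\<bar> \<le> V * M / \<kappa> + e * (V / \<kappa> + D)" if e: "0 < e" for e
    proof -
      obtain \<phi> where \<phi>: "\<phi> \<in> Cc_infinity" and \<delta>: "bounded_lipschitz e (\<lambda>x. riesz \<alpha> g x - \<phi> x)"
        by (rule riesz_approximation[OF \<alpha> g e])
      let ?\<delta> = "\<lambda>x. riesz \<alpha> g x - \<phi> x"
      have "norm (\<phi> x) \<le> M + e" for x
      proof -
        have "norm (\<phi> x) \<le> norm (riesz \<alpha> g x) + norm (?\<delta> x)"
          using norm_triangle_ineq4[of "riesz \<alpha> g x" "?\<delta> x"] by simp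
        also have "\<dots> \<le> M + e" using M(2) \<delta> by (intro add_mono) (auto simp: bounded_lipschitz_def)
        finally show ?thesis .
      qed
      then have 1: "\<bar>\<integral>x. f x * gauss_div \<alpha> \<phi> x \<partial>lborel\<bar> \<le> V * (M + e) / \<kappa>"
        using M(1) e by (intro scaled[OF \<phi>]) auto
      have 2: "\<bar>\<integral>x. f x * gauss_div \<alpha> ?\<delta> x \<partial>lborel\<bar> \<le> e * D"
        using gauss_div_mult_integrable(2)[OF \<alpha> \<delta> fi] by (simp add: D_def mult_ac)
      obtain B where B: "bounded_lipschitz B \<phi>" by (rule Cc_infinity_bounded_lipschitz[OF \<phi>])
      have "c * g x = - gauss_div \<alpha> \<phi> x - gauss_div \<alpha> ?\<delta> x" for x
        unfolding gauss_div_diff[OF \<alpha> rbl B] gauss_div_riesz[OF \<alpha> A(2,3)] c_def by simp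
      then have "f x * (c * g x) = - (f x * gauss_div \<alpha> \<phi> x) - f x * gauss_div \<alpha> ?\<delta> x" for x
        by (simp only: right_diff_distrib mult_minus_right)
      then have "c * (f x * g x) = - (f x * gauss_div \<alpha> \<phi> x) - f x * gauss_div \<alpha> ?\<delta> x" for x
        by (simp add: mult_ac)
      then have "(\<integral>x. c * (f x * g x) \<partial>lborel) = - (\<integral>x. f x * gauss_div \<alpha> \<phi> x \<partial>lborel) - (\<integral>x. f x * gauss_div \<alpha> ?\<delta> x \<partial>lborel)"
        using gauss_div_mult_integrable(1)[OF \<alpha> B fi] gauss_div_mult_integrable(1)[OF \<alpha> \<delta> fi] by simp
      then have cX: "c * (\<integral>x. f x * g x \<partial>lborel) = - (\<integral>x. f x * gauss_div \<alpha> \<phi> x \<partial>lborel) - (\<integral>x. f x * gauss_div \<alpha> ?\<delta> x \<partial>lborel)"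
        unfolding integral_mult_right_zero .
      have "c * \<bar>\<integral>x. f x * g x \<partial>lborel\<bar> = \<bar>c * (\<integral>x. f x * g x \<partial>lborel)\<bar>"
        using c by (simp add: abs_mult)
      also have "\<dots> \<le> V * (M + e) / \<kappa> + e * D" unfolding cX using 1 2 by linarith
      also have "\<dots> = V * M / \<kappa> + e * (V / \<kappa> + D)" by (simp add: field_simps add_divide_distrib)
      finally show ?thesis .
    qed
    have "0 \<le> D"
    proof -
      have "bounded_lipschitz 1 (\<lambda>_. 0 :: real ^ 'n)" by (simp add: bounded_lipschitz_def)
      from gauss_div_mult_integrable(2)[OF \<alpha> this fi] show ?thesis by (simp add: D_def)
    qed
    then have S: "0 < V / \<kappa> + D + 1" using V0 \<kappa> by (simp add: add_nonneg_pos)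
    show ?thesis
    proof (rule field_le_epsilon)
      fix e :: real assume e: "0 < e"
      have "e / (V / \<kappa> + D + 1) * (V / \<kappa> + D) \<le> e"
        using S e by (simp add: pos_divide_le_eq divide_le_eq mult_left_mono)
      then show "c * \<bar>\<integral>x. f x * g x \<partial>lborel\<bar> \<le> V * M / \<kappa> + e"
        using est[of "e / (V / \<kappa> + D + 1)"] S e by simp
    qed
  qed
  obtain C where C: "C > 0" "\<forall>\<psi> h (x::real ^ 'n). \<psi> \<in> Cc_infinity \<longrightarrow> (\<forall>x. \<bar>\<psi> x\<bar> \<le> 1) \<longrightarrow>
    h \<noteq> 0 \<longrightarrow> norm (riesz \<alpha> (\<lambda>x. \<psi> (x + h) - \<psi> x) x) \<le> C * norm h powr \<alpha>"
    by (rule riesz_difference_bound[OF \<alpha>])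
  have fh: "integrable lborel (\<lambda>x. f (x + h))" for h
    using integrable_lborel_translation_iff[of f h] fi by (simp add: add.commute)
  have "(\<integral>x. \<bar>f (x + h) - f x\<bar> \<partial>lborel) \<le> V * C / (\<kappa> * c) * norm h powr \<alpha>" if h: "h \<noteq> 0" for h
  proof (rule L1_norm_le_of_smooth_tests)
    show "integrable lborel (\<lambda>x. f (x + h) - f x)" using fh fi by (rule Bochner_Integration.integrable_diff)
    fix \<psi> :: "real ^ 'n \<Rightarrow> real" assume \<psi>: "\<psi> \<in> Cc_infinity" "\<forall>x. \<bar>\<psi> x\<bar> \<le> 1"
    note [measurable] = Cc_infinity_borel[OF \<psi>(1)] borel_measurable_integrable[OF fi]
    \<comment> \<open>A change of variables moves the translation from f to \<psi>, which reverses
      its sign.\<close>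
    let ?g = "\<lambda>x. \<psi> (x + - h) - \<psi> x"
    have g: "?g \<in> Cc_infinity"
    proof -
      have "(\<lambda>x. \<psi> (- h + 1 *\<^sub>R x) + (- 1) *\<^sub>R \<psi> x) \<in> Cc_infinity"
        by (intro Cc_infinity_add Cc_infinity_scaleR Cc_infinity_affine \<psi>) simp
      then show ?thesis by (simp add: add.commute)
    qed
    have b: "integrable lborel (\<lambda>x. f (x + u) * \<psi> (x + v))" for u v
      by (rule Bochner_Integration.integrable_bound[OF fh[of u]]) (use \<psi>(2) in \<open>auto simp: abs_mult mult_left_le\<close>)
    have "(\<integral>x. (f (x + h) - f x) * \<psi> x \<partial>lborel) = (\<integral>x. f (x + h) * \<psi> x \<partial>lborel) - (\<integral>x. f x * \<psi> x \<partial>lborel)"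
      using b[of h 0] b[of 0 0] by (simp add: left_diff_distrib)
    also have "(\<integral>x. f (x + h) * \<psi> x \<partial>lborel) = (\<integral>x. (\<lambda>x. f x * \<psi> (x + - h)) (h + x) \<partial>lborel)"
      by (simp add: add.commute)
    also have "\<dots> = (\<integral>x. f x * \<psi> (x + - h) \<partial>lborel)"
      by (rule integral_lborel_translation) measurable
    also have "(\<integral>x. f x * \<psi> (x + - h) \<partial>lborel) - (\<integral>x. f x * \<psi> x \<partial>lborel) = (\<integral>x. f x * ?g x \<partial>lborel)"
      using b[of 0 "- h"] b[of 0 0] by (simp add: right_diff_distrib)
    finally have eq: "(\<integral>x. (f (x + h) - f x) * \<psi> x \<partial>lborel) = (\<integral>x. f x * ?g x \<partial>lborel)" .
    have "norm (riesz \<alpha> ?g x) \<le> C * norm h powr \<alpha>" for x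
      using C(2)[rule_format, OF \<psi>(1), of "- h" x] \<psi>(2) h by simp
    then have "c * \<bar>\<integral>x. f x * ?g x \<partial>lborel\<bar> \<le> V * (C * norm h powr \<alpha>) / \<kappa>"
      using C(1) by (intro dual[OF g]) auto
    then have "\<bar>\<integral>x. f x * ?g x \<partial>lborel\<bar> \<le> V * (C * norm h powr \<alpha>) / \<kappa> / c"
      by (subst pos_le_divide_eq[OF c]) (simp only: mult.commute)
    then show "(\<integral>x. (f (x + h) - f x) * \<psi> x \<partial>lborel) \<le> V * C / (\<kappa> * c) * norm h powr \<alpha>"
      unfolding eq by (simp add: mult_ac)
  qed
  then show ?thesis using that by blast
qed

subsection \<open>Representatives\<close>

lemma AE_lborel_translation:
  fixes h :: "'a::euclidean_space"
  assumes "AE x in lborel. P x" shows "AE x in lborel. P (x + h)"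
proof -
  obtain N where N: "N \<in> null_sets lborel" "{x \<in> space lborel. \<not> P x} \<subseteq> N"
    using assms by (auto simp: eventually_ae_filter)
  have [measurable]: "N \<in> sets borel" using N(1) by auto
  have "(\<integral>\<^sup>+x. indicator N (h + 1 *\<^sub>R x) \<partial>lborel) = (\<integral>\<^sup>+x. indicator N x \<partial>lborel)"
    by (subst nn_integral_lborel_affine[of 1 "indicator N" h]) auto
  also have "\<dots> = 0" using N(1) by auto
  finally have "AE x in lborel. indicator N (h + 1 *\<^sub>R x) = (0::ennreal)"
    by (subst (asm) nn_integral_0_iff_AE) auto
  then show ?thesis
    by eventually_elim (use N(2) in \<open>auto simp: add.commute split: split_indicator_asm\<close>)
qed

text \<open>The spaces are defined over \<open>lebesgue\<close>, whereas the translation and duality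
  arguments use Borel functions and \<open>lborel\<close>; a Borel representative bridges the
  two.\<close>

lemma L1_borel_representative:
  fixes f :: "'a::euclidean_space \<Rightarrow> real"
  assumes "f \<in> L1"
  obtains f' where "integrable lborel f'" and "AE x in lborel. f x = f' x"
proof -
  have f: "integrable lebesgue f" using assms by (simp add: L1_def)
  then obtain f' where f': "f' \<in> borel_measurable lborel" "AE x in lborel. f x = f' x"
    using completion_ex_borel_measurable_real[OF borel_measurable_integrable] by blast
  have "integrable lebesgue f \<longleftrightarrow> integrable lebesgue f'"
  proof (rule integrable_cong_AE)
    show "f' \<in> borel_measurable lebesgue" using f'(1) by (rule measurable_completion)
    show "AE x in lebesgue. f x = f' x" using f'(2) by (rule AE_completion)
  qed (use f in auto)
  then have "integrable lborel f'" using f integrable_completion[OF f'(1)] by simp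
  then show ?thesis using that f'(2) by blast
qed

lemma L1_norm_difference_representative:
  fixes f :: "'a::euclidean_space \<Rightarrow> real"
  assumes [measurable]: "f' \<in> borel_measurable borel" and ae: "AE x in lborel. f x = f' x"
  shows "L1_norm (\<lambda>x. f (x + h) - f x) = (\<integral>x. \<bar>f' (x + h) - f' x\<bar> \<partial>lborel)"
proof -
  have ae2: "AE x in lebesgue. \<bar>f' (x + h) - f' x\<bar> = \<bar>f (x + h) - f x\<bar>"
    using AE_completion[OF AE_lborel_translation[OF ae, of h]] AE_completion[OF ae]
    by eventually_elim simp
  have m': "(\<lambda>x. \<bar>f' (x + h) - f' x\<bar>) \<in> borel_measurable lebesgue"
    by (rule measurable_completion) simp
  have "L1_norm (\<lambda>x. f (x + h) - f x) = (\<integral>x. \<bar>f' (x + h) - f' x\<bar> \<partial>lebesgue)"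
    unfolding L1_norm_def
  proof (rule integral_cong_AE)
    show "(\<lambda>x. \<bar>f (x + h) - f x\<bar>) \<in> borel_measurable lebesgue"
      by (rule borel_measurable_AE[OF m' ae2])
  qed (use m' ae2 in \<open>auto elim!: eventually_mono\<close>)
  also have "\<dots> = (\<integral>x. \<bar>f' (x + h) - f' x\<bar> \<partial>lborel)"
    by (rule integral_completion) simp
  finally show ?thesis .
qed

lemma Linf_norm_le_1I:
  fixes \<phi> :: "'a::euclidean_space \<Rightarrow> 'b::real_normed_vector"
  assumes "\<phi> \<in> Cc_infinity" and "\<forall>x. norm (\<phi> x) \<le> 1"
  shows "Linf_norm \<phi> \<le> 1"
  unfolding Linf_norm_def
proof (rule esssup_I)
  have "continuous_on UNIV (\<lambda>x. norm (\<phi> x))"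
    by (intro continuous_on_norm Cc_infinity_continuous assms(1))
  then have "(\<lambda>x. norm (\<phi> x)) \<in> borel_measurable lborel"
    by (simp add: borel_measurable_continuous_onI)
  then have "(\<lambda>x. norm (\<phi> x)) \<in> borel_measurable lebesgue" by (rule measurable_completion)
  then show "(\<lambda>x. ereal (norm (\<phi> x))) \<in> borel_measurable lebesgue" by simp
qed (use assms(2) in \<open>simp add: one_ereal_def\<close>)

lemma frac_variation_pairing_le:
  fixes f :: "real ^ 'n \<Rightarrow> real"
  assumes \<alpha>: "0 < \<alpha>" "\<alpha> < 1" and f': "integrable lborel f'" "AE x in lborel. f x = f' x"
    and V: "frac_variation \<alpha> f \<le> ereal V" and \<phi>: "\<phi> \<in> Cc_infinity" "\<forall>x. norm (\<phi> x) \<le> 1"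
  shows "(\<integral>x. f' x * div_frac \<alpha> \<phi> x \<partial>lborel) \<le> V"
proof -
  have [measurable]: "f' \<in> borel_measurable borel" using f'(1) by auto
  have ae: "AE x in lebesgue. f' x = f x"
    using AE_completion[OF f'(2)] by eventually_elim simp
  obtain B where B: "bounded_lipschitz B \<phi>" by (rule Cc_infinity_bounded_lipschitz[OF \<phi>(1)])
  have [measurable]: "div_frac \<alpha> \<phi> \<in> borel_measurable borel"
    unfolding div_frac_eq_gauss_div[OF \<alpha> B, abs_def] using gauss_div_borel[OF B] by simp
  have m: "(\<lambda>x. f' x * div_frac \<alpha> \<phi> x) \<in> borel_measurable lborel" by simp
  then have m': "(\<lambda>x. f' x * div_frac \<alpha> \<phi> x) \<in> borel_measurable lebesgue" by (rule measurable_completion)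
  have ae': "AE x in lebesgue. f' x * div_frac \<alpha> \<phi> x = f x * div_frac \<alpha> \<phi> x"
    using ae by eventually_elim simp
  have "(\<integral>x. f' x * div_frac \<alpha> \<phi> x \<partial>lborel) = (\<integral>x. f' x * div_frac \<alpha> \<phi> x \<partial>lebesgue)"
    by (rule integral_completion[OF m, symmetric])
  also have "\<dots> = (\<integral>x. f x * div_frac \<alpha> \<phi> x \<partial>lebesgue)"
    by (rule integral_cong_AE[OF m' borel_measurable_AE[OF m' ae'] ae'])
  finally have eq: "(\<integral>x. f' x * div_frac \<alpha> \<phi> x \<partial>lborel) = (\<integral>x. f x * div_frac \<alpha> \<phi> x \<partial>lebesgue)" .
  have "ereal (\<integral>x. f x * div_frac \<alpha> \<phi> x \<partial>lebesgue) \<le> frac_variation \<alpha> f"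
    unfolding frac_variation_def using Linf_norm_le_1I[OF \<phi>] \<phi>(1) by (intro SUP_upper) auto
  then have "ereal (\<integral>x. f x * div_frac \<alpha> \<phi> x \<partial>lebesgue) \<le> ereal V" using V by (rule order_trans)
  then show ?thesis using eq by simp
qed

lemma besov_1_inftyI:
  fixes f :: "real ^ 'n \<Rightarrow> real"
  assumes f: "f \<in> L1" and f': "f' \<in> borel_measurable borel" "AE x in lborel. f x = f' x"
    and C: "\<forall>h. h \<noteq> 0 \<longrightarrow> (\<integral>x. \<bar>f' (x + h) - f' x\<bar> \<partial>lborel) \<le> C * norm h powr \<alpha>"
  shows "f \<in> besov_1_infty \<alpha>"
proof -
  have "(SUP h \<in> UNIV - {0}. ereal (norm h powr (- \<alpha>) * L1_norm (\<lambda>x. f (x + h) - f x))) \<le> ereal C"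
  proof (rule SUP_least)
    fix h :: "real ^ 'n" assume "h \<in> UNIV - {0}"
    then have h: "h \<noteq> 0" by simp
    have "L1_norm (\<lambda>x. f (x + h) - f x) \<le> C * norm h powr \<alpha>"
      using C h by (simp add: L1_norm_difference_representative[OF f'])
    then have "norm h powr (- \<alpha>) * L1_norm (\<lambda>x. f (x + h) - f x) \<le> norm h powr (- \<alpha>) * (C * norm h powr \<alpha>)"
      by (rule mult_left_mono) simp
    also have "\<dots> = C" using h by (simp add: powr_minus)
    finally show "ereal (norm h powr (- \<alpha>) * L1_norm (\<lambda>x. f (x + h) - f x)) \<le> ereal C" by simp
  qed
  then have "(SUP h \<in> UNIV - {0}. ereal (norm h powr (- \<alpha>) * L1_norm (\<lambda>x. f (x + h) - f x))) < \<infinity>"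
    by (rule le_less_trans) simp
  then show ?thesis using f by (simp add: besov_1_infty_def)
qed

theorem BV_frac_subset_besov:
  assumes \<alpha>: "0 < \<alpha>" "\<alpha> < 1"
  shows "(BV_frac \<alpha> :: (real ^ 'n \<Rightarrow> real) set) \<subseteq> besov_1_infty \<alpha>"
proof
  fix f :: "real ^ 'n \<Rightarrow> real" assume f: "f \<in> BV_frac \<alpha>"
  then have fL: "f \<in> L1" and fin: "frac_variation \<alpha> f < \<infinity>" by (auto simp: BV_frac_def)
  obtain f' where f': "integrable lborel f'" "AE x in lborel. f x = f' x"
    by (rule L1_borel_representative[OF fL])
  obtain V where V: "frac_variation \<alpha> f \<le> ereal V"
    using fin by (cases "frac_variation \<alpha> f") (auto intro: that)
  obtain C where C: "\<forall>h. h \<noteq> 0 \<longrightarrow> (\<integral>x. \<bar>f' (x + h) - f' x\<bar> \<partial>lborel) \<le> C * norm h powr \<alpha>"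
    by (rule frac_variation_imp_difference_bound[OF \<alpha> f'(1) frac_variation_pairing_le[OF \<alpha> f' V]])
  show "f \<in> besov_1_infty \<alpha>"
    by (rule besov_1_inftyI[OF fL _ f'(2) C]) (use f'(1) in auto)
qed

section \<open>Strictness\<close>

text \<open>
  Near the origin \<open>bessel_bump \<alpha>\<close> behaves like \<open>|x|\<^sup>\<alpha>\<^sup>-\<^sup>n\<close>, whose fractional gradient
  is a multiple of the non-integrable kernel \<open>x/|x|\<^sup>n\<^sup>+\<^sup>1\<close>.
\<close>

definition bessel_kernel :: "real \<Rightarrow> 'a::euclidean_space \<Rightarrow> real" where
  "bessel_kernel s x = indicator {..1} s * (exp (- (norm x / s)\<^sup>2) / s ^ DIM('a))"

definition bessel_bump :: "real \<Rightarrow> 'a::euclidean_space \<Rightarrow> real" where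
  "bessel_bump \<alpha> x = (\<integral>s. bessel_kernel s x \<partial>pw \<alpha>)"

text \<open>The cutoff \<open>l\<close> is general because dilating a test field enlarges the window
  of scales from {..1} to {..l}.\<close>

lemma integrable_pw_indicator:
  assumes \<alpha>: "0 < \<alpha>" "\<alpha> < 1" and l: "1 \<le> l"
    and [measurable]: "F \<in> borel_measurable borel" and F: "\<And>s. 0 < s \<Longrightarrow> \<bar>F s\<bar> \<le> K"
  shows "integrable (pw \<alpha>) (\<lambda>s. indicator {..l} s * F s :: real)"
proof (rule integrable_pw_bound[OF \<alpha>, where C="l * K"])
  have K: "0 \<le> K" using F[of 1] by linarith
  fix s :: real assume s: "0 < s"
  show "norm (indicator {..l} s * F s) \<le> l * K * min 1 (1 / s)"
  proof (cases "s \<le> l")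
    case True
    then have "1 \<le> l * min 1 (1 / s)" using s l by (auto simp: min_def field_simps)
    then have "K * 1 \<le> K * (l * min 1 (1 / s))" using K by (rule mult_left_mono)
    then show ?thesis using F[OF s] True by (simp add: mult_ac)
  next
    case False
    then show ?thesis using K l s by simp
  qed
qed measurable

lemma bessel_slice:
  fixes G :: "'a::euclidean_space \<Rightarrow> real"
  assumes [measurable]: "G \<in> borel_measurable borel" and GK: "\<And>x. \<bar>G x\<bar> \<le> K" and s: "0 < s"
  shows "(\<integral>x. bessel_kernel s x * G x \<partial>lborel) = indicator {..1} s * (\<integral>N. G (s *\<^sub>R N) \<partial>gauss)"
    and "integrable lborel (\<lambda>x. bessel_kernel s x * G x)"
    and "(\<integral>x. norm (bessel_kernel s x * G x) \<partial>lborel) \<le> indicator {..1} s * (K * measure (gauss :: 'a measure) UNIV)"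
proof -
  have e: "bessel_kernel s x * G x = indicator {..1} s *\<^sub>R ((exp (- (norm x / s)\<^sup>2) / s ^ DIM('a)) *\<^sub>R G x)" for x
    by (simp add: bessel_kernel_def)
  have e': "norm (bessel_kernel s x * G x) = indicator {..1} s *\<^sub>R ((exp (- (norm x / s)\<^sup>2) / s ^ DIM('a)) *\<^sub>R \<bar>G x\<bar>)" for x
    using s by (simp add: bessel_kernel_def abs_mult)
  have gi: "integrable gauss (\<lambda>N. G (s *\<^sub>R N))"
    by (rule gauss.integrable_const_bound[where B=K]) (use GK in auto)
  show "(\<integral>x. bessel_kernel s x * G x \<partial>lborel) = indicator {..1} s * (\<integral>N. G (s *\<^sub>R N) \<partial>gauss)"
    unfolding e integral_scaleR_right by (subst integral_gauss_scale(1)[OF s]) simp_all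
  show "integrable lborel (\<lambda>x. bessel_kernel s x * G x)"
    unfolding e using gi by (intro integrable_scaleR_right) (subst (asm) integral_gauss_scale(2)[OF s], simp_all)
  have "(\<integral>x. norm (bessel_kernel s x * G x) \<partial>lborel) = indicator {..1} s * (\<integral>N. \<bar>G (s *\<^sub>R N)\<bar> \<partial>gauss)"
    unfolding e' integral_scaleR_right by (subst integral_gauss_scale(1)[OF s, of "\<lambda>x. \<bar>G x\<bar>"]) simp_all
  also have "\<dots> \<le> indicator {..1} s * (\<integral>N. K \<partial>(gauss :: 'a measure))"
    by (intro mult_left_mono integral_mono) (use gi GK in auto)
  finally show "(\<integral>x. norm (bessel_kernel s x * G x) \<partial>lborel) \<le> indicator {..1} s * (K * measure (gauss :: 'a measure) UNIV)"
    by (simp add: mult_ac)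
qed

lemma bessel_kernel_mult_integrable:
  fixes G :: "'a::euclidean_space \<Rightarrow> real"
  assumes \<alpha>: "0 < \<alpha>" "\<alpha> < 1" and Gm[measurable]: "G \<in> borel_measurable borel" and GK: "\<And>x. \<bar>G x\<bar> \<le> K"
  shows "integrable (pw \<alpha> \<Otimes>\<^sub>M lborel) (\<lambda>(s, x). bessel_kernel s x * G x)"
proof (rule pw_lborel.integrable_pair_dominated[where B="\<lambda>s. indicator {..1} s * (K * measure (gauss :: 'a measure) UNIV)"])
  show "(\<lambda>(s, x). bessel_kernel s x * G x) \<in> borel_measurable (pw \<alpha> \<Otimes>\<^sub>M lborel)"
    unfolding bessel_kernel_def case_prod_beta by measurable
  show "integrable (pw \<alpha>) (\<lambda>s. indicator {..1} s * (K * measure (gauss :: 'a measure) UNIV))"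
    by (rule integrable_pw_indicator[OF \<alpha>]) auto
  show "AE s in pw \<alpha>. integrable lborel (\<lambda>x. case (s, x) of (s, x) \<Rightarrow> bessel_kernel s x * G x) \<and>
      (\<integral>x. norm (case (s, x) of (s, x) \<Rightarrow> bessel_kernel s x * G x) \<partial>lborel)
        \<le> indicator {..1} s * (K * measure (gauss :: 'a measure) UNIV)"
    using AE_pw_pos
  proof eventually_elim
    case (elim s)
    show ?case using bessel_slice(2,3)[OF Gm GK elim] by simp
  qed
qed

lemma bessel_kernel_integrable:
  assumes \<alpha>: "0 < \<alpha>" "\<alpha> < 1"
  shows "integrable (pw \<alpha> \<Otimes>\<^sub>M lborel) (\<lambda>(s, x::'a::euclidean_space). bessel_kernel s x)"
  using bessel_kernel_mult_integrable[OF \<alpha>, of "\<lambda>_::'a. 1" 1] by simp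

text \<open>Every slice has at most the Gaussian mass, and the scales up to 1 have finite weight.
  Without the cut at scale 1 the superposition would be a multiple of |x|^(\<alpha>-n), which is not
  integrable at infinity.\<close>

lemma bessel_bump_integrable:
  assumes \<alpha>: "0 < \<alpha>" "\<alpha> < 1"
  shows "integrable lborel (bessel_bump \<alpha> :: 'a::euclidean_space \<Rightarrow> real)"
  unfolding bessel_bump_def[abs_def] by (rule pw_lborel.integrable_snd[OF bessel_kernel_integrable[OF \<alpha>]])

lemma bessel_bump_pairing:
  fixes G :: "'a::euclidean_space \<Rightarrow> real"
  assumes \<alpha>: "0 < \<alpha>" "\<alpha> < 1" and Gm[measurable]: "G \<in> borel_measurable borel" and GK: "\<And>x. \<bar>G x\<bar> \<le> K"
  shows "(\<integral>x. bessel_bump \<alpha> x * G x \<partial>lborel) = (\<integral>s. indicator {..1} s * (\<integral>N. G (s *\<^sub>R N) \<partial>gauss) \<partial>pw \<alpha>)"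
proof -
  have "(\<integral>x. bessel_bump \<alpha> x * G x \<partial>lborel) = (\<integral>x. (\<integral>s. bessel_kernel s x * G x \<partial>pw \<alpha>) \<partial>lborel)"
    unfolding bessel_bump_def by simp
  also have "\<dots> = (\<integral>s. (\<integral>x. bessel_kernel s x * G x \<partial>lborel) \<partial>pw \<alpha>)"
    by (rule pw_lborel.Fubini_integral[OF bessel_kernel_mult_integrable[OF \<alpha> Gm GK]])
  also have "\<dots> = (\<integral>s. indicator {..1} s * (\<integral>N. G (s *\<^sub>R N) \<partial>gauss) \<partial>pw \<alpha>)"
  proof (rule integral_cong_AE)
    show "(\<lambda>s. \<integral>x. bessel_kernel s x * G x \<partial>lborel) \<in> borel_measurable (pw \<alpha>)"
      unfolding bessel_kernel_def by measurable
    show "AE s in pw \<alpha>. (\<integral>x. bessel_kernel s x * G x \<partial>lborel) = indicator {..1} s * (\<integral>N. G (s *\<^sub>R N) \<partial>gauss)"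
      using AE_pw_pos by eventually_elim (rule bessel_slice(1)[OF Gm GK])
  qed measurable
  finally show ?thesis .
qed

text \<open>A translation by h changes the slice at scale s by at most K min 1 (|h|/s) in L^1, and
  the cut at scale 1 only helps. Summing over scales again gives |h|^\<alpha>.\<close>

lemma bessel_bump_difference_bound:
  assumes \<alpha>: "0 < \<alpha>" "\<alpha> < 1"
  obtains C where "\<forall>h::'a::euclidean_space. h \<noteq> 0 \<longrightarrow>
    (\<integral>x. \<bar>bessel_bump \<alpha> (x + h) - bessel_bump \<alpha> x\<bar> \<partial>lborel) \<le> C * norm h powr \<alpha>"
proof -
  let ?q = "\<lambda>z::'a. exp (- (norm z)\<^sup>2)"
  obtain K where K: "K \<ge> 0" "\<forall>h. (\<integral>z. norm (?q (z + h) - ?q z) \<partial>lborel) \<le> K * min 1 (norm h)"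
    by (rule gauss_kernel_translation_bound)
  have qi: "integrable lborel ?q"
    using integrable_exp_norm_square[of 1] by simp
  have "(\<integral>x. \<bar>bessel_bump \<alpha> (x + h) - bessel_bump \<alpha> x\<bar> \<partial>lborel) \<le> K * pw_const \<alpha> * norm h powr \<alpha>"
    if h: "h \<noteq> 0" for h :: 'a
  proof -
    have h0: "0 < norm h" using h by simp
    note mi = pw_min_scale[OF \<alpha> h0]
    define d where "d s x = bessel_kernel s (x + h) - bessel_kernel s x" for s and x :: 'a
    have slice: "integrable lborel (\<lambda>x. d s x)" "(\<integral>x. \<bar>d s x\<bar> \<partial>lborel) \<le> K * min 1 (norm h / s)" if s: "0 < s" for s
    proof -
      have k: "integrable lborel (\<lambda>x::'a. bessel_kernel s x)"
        using bessel_slice(2)[of "\<lambda>_. 1" 1 s] s by simp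
      have [measurable]: "(\<lambda>x::'a. bessel_kernel s x) \<in> borel_measurable borel" using k by auto
      have kh: "integrable lborel (\<lambda>x. bessel_kernel s (x + h))"
        using integrable_lborel_translation_iff[of "\<lambda>x. bessel_kernel s x" h] k by (simp add: add.commute)
      show di: "integrable lborel (\<lambda>x. d s x)"
        unfolding d_def using kh k by (rule Bochner_Integration.integrable_diff)
      define v where "v = (1 / s) *\<^sub>R h"
      have ds: "\<bar>d s (0 + s *\<^sub>R z)\<bar> = indicator {..1} s / s ^ DIM('a) * norm (?q (z + v) - ?q z)" for z
      proof -
        have "s *\<^sub>R z + h = s *\<^sub>R (z + v)" using s by (simp add: v_def scaleR_add_right)
        then have "d s (0 + s *\<^sub>R z) = indicator {..1} s / s ^ DIM('a) * (?q (z + v) - ?q z)"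
          using s by (simp add: d_def bessel_kernel_def diff_divide_distrib right_diff_distrib)
        then show ?thesis using s by (simp add: abs_mult)
      qed
      have "(\<integral>x. \<bar>d s x\<bar> \<partial>lborel) = (\<bar>s\<bar> ^ DIM('a)) *\<^sub>R (\<integral>z. \<bar>d s (0 + s *\<^sub>R z)\<bar> \<partial>lborel)"
        using s di by (intro integral_lborel_affine) auto
      also have "\<dots> = indicator {..1} s * (\<integral>z. norm (?q (z + v) - ?q z) \<partial>lborel)"
        unfolding ds integral_mult_right_zero using s by simp
      also have "\<dots> \<le> 1 * (\<integral>z. norm (?q (z + v) - ?q z) \<partial>lborel)"
        by (intro mult_right_mono integral_nonneg_AE) (auto simp: indicator_def)
      also have "\<dots> \<le> K * min 1 (norm v)" using K(2) by simp
      also have "norm v = norm h / s" using s by (simp add: v_def)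
      finally show "(\<integral>x. \<bar>d s x\<bar> \<partial>lborel) \<le> K * min 1 (norm h / s)" .
    qed
    have di: "integrable (pw \<alpha> \<Otimes>\<^sub>M lborel) (\<lambda>(s, x). d s x)"
    proof (rule pw_lborel.integrable_pair_dominated[where B="\<lambda>s. K * min 1 (norm h / s)"])
      show "(\<lambda>(s, x). d s x) \<in> borel_measurable (pw \<alpha> \<Otimes>\<^sub>M lborel)"
        unfolding d_def bessel_kernel_def case_prod_beta by measurable
      show "AE s in pw \<alpha>. integrable lborel (\<lambda>x. case (s, x) of (s, x) \<Rightarrow> d s x) \<and>
        (\<integral>x. norm (case (s, x) of (s, x) \<Rightarrow> d s x) \<partial>lborel) \<le> K * min 1 (norm h / s)"
        using AE_pw_pos by eventually_elim (use slice in simp)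
    qed (use mi(1) in simp)
    have dn: "integrable (pw \<alpha> \<Otimes>\<^sub>M lborel) (\<lambda>(s, x). \<bar>d s x\<bar>)"
      using integrable_abs[OF di] by (simp add: case_prod_beta')
    have AEi: "AE x in lborel. integrable (pw \<alpha>) (\<lambda>s. bessel_kernel s (x::'a))"
      by (rule pw_lborel.AE_integrable_snd[OF bessel_kernel_integrable[OF \<alpha>]])
    have "(\<integral>x. \<bar>bessel_bump \<alpha> (x + h) - bessel_bump \<alpha> x\<bar> \<partial>lborel) \<le> (\<integral>x. (\<integral>s. \<bar>d s x\<bar> \<partial>pw \<alpha>) \<partial>lborel)"
    proof (rule integral_mono_AE)
      have "integrable lborel (\<lambda>x. bessel_bump \<alpha> (x + h))"
        using integrable_lborel_translation_iff[of "bessel_bump \<alpha>" h] bessel_bump_integrable[OF \<alpha>, where 'a='a]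
        by (simp add: add.commute borel_measurable_integrable)
      then show "integrable lborel (\<lambda>x. \<bar>bessel_bump \<alpha> (x + h) - bessel_bump \<alpha> x\<bar>)"
        by (intro integrable_abs Bochner_Integration.integrable_diff bessel_bump_integrable[OF \<alpha>])
      show "integrable lborel (\<lambda>x. \<integral>s. \<bar>d s x\<bar> \<partial>pw \<alpha>)"
        by (rule pw_lborel.integrable_snd[OF dn])
      show "AE x in lborel. \<bar>bessel_bump \<alpha> (x + h) - bessel_bump \<alpha> x\<bar> \<le> (\<integral>s. \<bar>d s x\<bar> \<partial>pw \<alpha>)"
        using AEi AE_lborel_translation[OF AEi, of h]
      proof eventually_elim
        case (elim x)
        have "bessel_bump \<alpha> (x + h) - bessel_bump \<alpha> x = (\<integral>s. d s x \<partial>pw \<alpha>)"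
          unfolding bessel_bump_def d_def using elim by simp
        then show ?case using integral_abs_bound[of "pw \<alpha>" "\<lambda>s. d s x"] by simp
      qed
    qed
    also have "\<dots> = (\<integral>s. (\<integral>x. \<bar>d s x\<bar> \<partial>lborel) \<partial>pw \<alpha>)"
      by (rule pw_lborel.Fubini_integral[OF dn])
    also have "\<dots> \<le> (\<integral>s. K * min 1 (norm h / s) \<partial>pw \<alpha>)"
    proof (rule integral_mono_AE)
      show "integrable (pw \<alpha>) (\<lambda>s. \<integral>x. \<bar>d s x\<bar> \<partial>lborel)"
        by (rule pw_lborel.integrable_fst[OF dn])
      show "AE s in pw \<alpha>. (\<integral>x. \<bar>d s x\<bar> \<partial>lborel) \<le> K * min 1 (norm h / s)"
        using AE_pw_pos by eventually_elim (rule slice(2))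
    qed (use mi(1) in simp)
    also have "\<dots> = K * pw_const \<alpha> * norm h powr \<alpha>" by (simp add: mi(2))
    finally show ?thesis .
  qed
  then show ?thesis using that by blast
qed

section \<open>Bounded sums of dilated radial fields\<close>

definition radial_field :: "'a::euclidean_space \<Rightarrow> 'a" where
  "radial_field x = bump x *\<^sub>R x"

lemma radial_field_Cc_infinity: "radial_field \<in> Cc_infinity"
  unfolding radial_field_def
  by (intro Cc_infinity_scaleR_left bump_Cc_infinity Ck_bounded_linear bounded_linear_ident)

lemma norm_radial_field_le: "norm (radial_field x) \<le> (if norm x < 1 then norm x else 0)"
proof -
  have "bump x \<le> 1" by (simp add: bump_def bump_aux_def)
  then show ?thesis
    using bump_nonneg[of x] by (auto simp: radial_field_def bump_eq_0 mult_left_le_one_le)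
qed

definition radial_stack :: "nat \<Rightarrow> 'a::euclidean_space \<Rightarrow> 'a" where
  "radial_stack m x = (\<Sum>k<m. radial_field (2 ^ k *\<^sub>R x))"

text \<open>Written as a difference so that \<open>gauss_div_diff\<close> applies directly.\<close>

lemma radial_stack_Suc: "radial_stack (Suc m) x = radial_stack m x - (- 1) *\<^sub>R radial_field (2 ^ m *\<^sub>R x)"
  by (simp add: radial_stack_def)

lemma radial_stack_Cc_infinity: "radial_stack m \<in> Cc_infinity"
proof -
  have "(\<lambda>x::'a. radial_field (0 + 2 ^ k *\<^sub>R x)) \<in> Cc_infinity" for k :: nat
    by (intro Cc_infinity_affine radial_field_Cc_infinity) simp
  then show ?thesis unfolding radial_stack_def by (intro Cc_infinity_sum) auto
qed

text \<open>At each point only a geometric series of the dilated fields is active.\<close>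

lemma norm_radial_stack_le: "norm (radial_stack m x) \<le> 2"
proof -
  \<comment> \<open>The linear bound is what makes the induction close: if the next field is active,
    then 2^m |x| < 1 and the sum at most doubles to 2^(m+1) |x| < 2; otherwise nothing is
    added.\<close>
  have "norm (radial_stack m x) \<le> min 2 (2 ^ m * norm x)"
  proof (induction m)
    case 0
    then show ?case by (simp add: radial_stack_def)
  next
    case (Suc m)
    have "norm (radial_stack (Suc m) x) \<le> norm (radial_stack m x) + norm (radial_field (2 ^ m *\<^sub>R x))"
      by (simp add: radial_stack_def norm_triangle_ineq)
    also have "\<dots> \<le> min 2 (2 ^ m * norm x) + (if 2 ^ m * norm x < 1 then 2 ^ m * norm x else 0)"
    proof (rule add_mono[OF Suc])
      have "norm (2 ^ m *\<^sub>R x) = 2 ^ m * norm x" by simp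
      then show "norm (radial_field (2 ^ m *\<^sub>R x)) \<le> (if 2 ^ m * norm x < 1 then 2 ^ m * norm x else 0)"
        using norm_radial_field_le[of "2 ^ m *\<^sub>R x"] by (simp only:)
    qed
    also have "\<dots> \<le> min 2 (2 ^ Suc m * norm x)" by (auto simp: min_def)
    finally show ?case .
  qed
  then show ?thesis by simp
qed

lemma radial_average_pos:
  assumes r: "0 < r"
  shows "0 < (\<integral>M. M \<bullet> radial_field (r *\<^sub>R M) \<partial>(gauss :: 'a::euclidean_space measure))"
proof -
  obtain B where B: "bounded_lipschitz B (radial_field :: 'a \<Rightarrow> 'a)"
    by (rule Cc_infinity_bounded_lipschitz[OF radial_field_Cc_infinity])
  let ?f = "\<lambda>M::'a. M \<bullet> radial_field (r *\<^sub>R M)"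
  have f: "?f M = r * (norm M)\<^sup>2 * bump (r *\<^sub>R M)" for M
    by (simp add: radial_field_def power2_norm_eq_inner)
  have i: "integrable gauss ?f" using gauss_integrable_inner[OF B, of 0 r] by simp
  have nn: "AE M in gauss. 0 \<le> ?f M" unfolding f using r by (auto simp: bump_nonneg)
  have "(\<integral>M. ?f M \<partial>gauss) \<noteq> 0"
  proof
    assume "(\<integral>M. ?f M \<partial>gauss) = 0"
    then have "AE M in gauss. ?f M = 0" using integral_nonneg_eq_0_iff_AE[OF i nn] by simp
    then have "AE M in (lborel :: 'a measure). ?f M = 0"
      unfolding gauss_def by (subst (asm) AE_density) auto
    moreover have "AE M in (lborel :: 'a measure). M \<noteq> 0" by (rule AE_lborel_singleton)
    ultimately have "AE M in lborel. M \<notin> ball (0::'a) (1 / r)"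
    proof eventually_elim
      case (elim M)
      then have "bump (r *\<^sub>R M) = 0" using r by (simp add: f)
      then have "\<not> norm (r *\<^sub>R M) < 1" using bump_pos_iff[of "r *\<^sub>R M"] by simp
      then show ?case using r by (simp add: field_simps)
    qed
    then have "emeasure lborel (ball (0::'a) (1 / r)) = 0"
      by (subst (asm) AE_iff_measurable[where N="ball 0 (1 / r)"]) auto
    then show False using content_ball_pos[of "1 / r" "0::'a"] r by (simp add: measure_def)
  qed
  then show ?thesis using integral_nonneg_AE[OF nn] by linarith
qed

section \<open>Pairing the singular function with the stacked fields\<close>

definition radial_profile :: "'a::euclidean_space itself \<Rightarrow> real \<Rightarrow> real \<Rightarrow> real" where
  "radial_profile _ \<alpha> s = (\<integral>N. gauss_div \<alpha> radial_field (s *\<^sub>R N) \<partial>(gauss :: 'a measure))"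

lemma radial_profile_borel:
  "radial_profile TYPE('a::euclidean_space) \<alpha> \<in> borel_measurable borel"
proof -
  obtain B where "bounded_lipschitz B (radial_field :: 'a \<Rightarrow> 'a)"
    by (rule Cc_infinity_bounded_lipschitz[OF radial_field_Cc_infinity])
  note [measurable] = gauss_div_borel[OF this]
  show ?thesis unfolding radial_profile_def by measurable
qed

lemma radial_profile_bounded:
  assumes \<alpha>: "0 < \<alpha>" "\<alpha> < 1"
  obtains K where "\<forall>s. \<bar>radial_profile TYPE('a::euclidean_space) \<alpha> s\<bar> \<le> K"
proof -
  obtain B where B: "bounded_lipschitz B (radial_field :: 'a \<Rightarrow> 'a)"
    by (rule Cc_infinity_bounded_lipschitz[OF radial_field_Cc_infinity])
  note [measurable] = gauss_div_borel[OF B]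
  let ?K = "B * gauss_div_const TYPE('a) \<alpha>"
  have i: "integrable gauss (\<lambda>N. gauss_div \<alpha> radial_field (s *\<^sub>R N :: 'a))" for s
    by (rule gauss.integrable_const_bound[where B="?K"]) (use gauss_div_bound[OF \<alpha> B] in auto)
  have "norm (radial_profile TYPE('a) \<alpha> s) \<le> (\<integral>N. ?K \<partial>(gauss :: 'a measure))" for s
    unfolding radial_profile_def
    by (rule norm_integral_le_integral[OF i]) (use gauss_div_bound[OF \<alpha> B] in auto)
  then show ?thesis
    by (intro that[of "\<integral>N. ?K \<partial>(gauss :: 'a measure)"] allI) (simp only: real_norm_def)
qed

text \<open>A Gaussian average of a Gaussian divergence is a double average. Combining the scales s
  and t leaves a positive multiple of the average of M \<bullet> \<open>radial_field\<close>, and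
  this is positive because the field points outward.\<close>

lemma radial_profile_pos:
  assumes \<alpha>: "0 < \<alpha>" "\<alpha> < 1" and s: "0 < s"
  shows "0 < radial_profile TYPE('a::euclidean_space) \<alpha> s"
proof -
  obtain B where B: "bounded_lipschitz B (radial_field :: 'a \<Rightarrow> 'a)"
    by (rule Cc_infinity_bounded_lipschitz[OF radial_field_Cc_infinity])
  note [measurable] = bounded_lipschitz_borel[OF B]
  define m where "m = (\<integral>N. 2 * norm N + (norm (N::'a))\<^sup>2 \<partial>gauss)"
  let ?G = "measure (gauss :: 'a measure) UNIV"
  let ?I = "\<lambda>t N. \<integral>a. a \<bullet> radial_field (s *\<^sub>R N + t *\<^sub>R a :: 'a) \<partial>gauss"
  have bd: "\<bar>?I t N\<bar> \<le> B * m * min 1 t" if "0 < t" for t N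
    unfolding m_def by (rule gauss_inner_norm_bound[OF B that])
  have int: "integrable (pw (- \<alpha>) \<Otimes>\<^sub>M gauss) (\<lambda>(t, N). ?I t N)"
  proof (rule pw_gauss.integrable_pair_dominated[where B="\<lambda>t. B * m * ?G * min 1 t"])
    show "integrable (pw (- \<alpha>)) (\<lambda>t. B * m * ?G * min 1 t)"
      by (intro integrable_mult_right integrable_pw_neg[OF \<alpha>, where C=1]) auto
    show "AE t in pw (- \<alpha>). integrable gauss (\<lambda>N. case (t, N) of (t, N) \<Rightarrow> ?I t N) \<and>
      (\<integral>N. norm (case (t, N) of (t, N) \<Rightarrow> ?I t N) \<partial>gauss) \<le> B * m * ?G * min 1 t"
      using AE_pw_pos
    proof eventually_elim
      case (elim t)
      have i: "integrable gauss (\<lambda>N. ?I t N)"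
        by (rule gauss.integrable_const_bound[where B="B * m * min 1 t"]) (use bd[OF elim] in auto)
      have "(\<integral>N. norm (?I t N) \<partial>gauss) \<le> (\<integral>N. B * m * min 1 t \<partial>(gauss :: 'a measure))"
        by (rule integral_mono) (use i bd[OF elim] in auto)
      then show ?case using i by (simp add: mult_ac)
    qed
  qed measurable
  have "radial_profile TYPE('a) \<alpha> s = (\<integral>t. (\<integral>N. ?I t N \<partial>gauss) \<partial>pw (- \<alpha>))"
    unfolding radial_profile_def gauss_div_def by (rule pw_gauss.Fubini_integral[OF int])
  also have "\<dots> > 0"
  proof (rule pw_integral_pos)
    show "integrable (pw (- \<alpha>)) (\<lambda>t. \<integral>N. ?I t N \<partial>gauss)" by (rule pw_gauss.integrable_fst[OF int])
    show pos: "0 < (\<integral>N. ?I t N \<partial>gauss)" if t: "0 < t" for t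
    proof -
      let ?r = "sqrt (s\<^sup>2 + t\<^sup>2)"
      have r: "0 < ?r" using s t by (simp add: add_pos_pos)
      have "(\<integral>N. ?I t N \<partial>gauss) = t / ?r * ?G * (\<integral>M. M \<bullet> radial_field (?r *\<^sub>R M) \<partial>(gauss :: 'a measure))"
        by (rule gauss_double_average_field[where B=B, OF _ _ s t]) (use B in \<open>auto simp: bounded_lipschitz_def\<close>)
      then show ?thesis using t r gauss_mass_pos[where 'a='a] radial_average_pos[OF r, where 'a='a] by simp
    qed
    show "0 \<le> (\<integral>N. ?I t N \<partial>gauss)" if "0 < t" for t using pos[OF that] by simp
  qed
  finally show ?thesis .
qed

text \<open>\<open>J\<close> is the pairing with the undilated field. A dilation only lets further
  scales take part, and these contribute nonnegative amounts by \<open>radial_profile_pos\<close>,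
  so each of the m fields yields at least \<open>J\<close>.\<close>

lemma bessel_bump_unbounded_pairing:
  assumes \<alpha>: "0 < \<alpha>" "\<alpha> < 1"
  obtains J where "0 < J" and
    "\<forall>m. real m * J \<le> (\<integral>x. bessel_bump \<alpha> x * gauss_div \<alpha> (radial_stack m) x \<partial>(lborel :: 'a::euclidean_space measure))"
proof -
  let ?E = "radial_profile TYPE('a) \<alpha>"
  note [measurable] = radial_profile_borel[of \<alpha>, where 'a='a]
  obtain K where K: "\<forall>s. \<bar>?E s\<bar> \<le> K" by (rule radial_profile_bounded[OF \<alpha>])
  have Ei: "integrable (pw \<alpha>) (\<lambda>s. indicator {..l} s * ?E s)" if "1 \<le> l" for l
    by (rule integrable_pw_indicator[OF \<alpha> that]) (use K in auto)
  have E0: "0 \<le> ?E s" if "0 < s" for s using radial_profile_pos[OF \<alpha> that, where 'a='a] by simp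
  define J where "J = (\<integral>s. indicator {..1} s * ?E s \<partial>pw \<alpha>)"
  have J: "0 < J"
    unfolding J_def
    by (rule pw_integral_pos[OF Ei]) (use E0 radial_profile_pos[OF \<alpha>, where 'a='a] in \<open>auto simp: indicator_def\<close>)
  obtain B where B: "bounded_lipschitz B (radial_field :: 'a \<Rightarrow> 'a)"
    by (rule Cc_infinity_bounded_lipschitz[OF radial_field_Cc_infinity])
  note [measurable] = gauss_div_borel[OF B]
  have bi: "integrable lborel (bessel_bump \<alpha> :: 'a \<Rightarrow> real)" by (rule bessel_bump_integrable[OF \<alpha>])
  have dil: "J \<le> (\<integral>x. bessel_bump \<alpha> x * gauss_div \<alpha> (\<lambda>x::'a. radial_field (2 ^ k *\<^sub>R x)) x \<partial>lborel)" for k :: nat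
  proof -
    define l :: real where "l = 2 ^ k"
    have l: "1 \<le> l" by (simp add: l_def)
    then have l0: "0 < l" by simp
    have "(\<integral>x. bessel_bump \<alpha> x * gauss_div \<alpha> (\<lambda>x::'a. radial_field (l *\<^sub>R x)) x \<partial>lborel)
      = (\<integral>x. bessel_bump \<alpha> x * (l powr \<alpha> * gauss_div \<alpha> radial_field (l *\<^sub>R x :: 'a)) \<partial>lborel)"
      unfolding gauss_div_dilate[OF l0 B] ..
    also have "\<dots> = (\<integral>s. indicator {..1} s * (\<integral>N. l powr \<alpha> * gauss_div \<alpha> radial_field (l *\<^sub>R s *\<^sub>R N :: 'a) \<partial>gauss) \<partial>pw \<alpha>)"
    proof (rule bessel_bump_pairing[OF \<alpha>])
      show "\<bar>l powr \<alpha> * gauss_div \<alpha> radial_field (l *\<^sub>R x :: 'a)\<bar> \<le> l powr \<alpha> * (B * gauss_div_const TYPE('a) \<alpha>)" for x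
        using gauss_div_bound[OF \<alpha> B] by (simp add: abs_mult mult_left_mono)
    qed measurable
    also have "\<dots> = l powr \<alpha> * (\<integral>s. indicator {..l} (l * s) * ?E (l * s) \<partial>pw \<alpha>)"
    proof -
      have "indicator {..1} s * (\<integral>N. l powr \<alpha> * gauss_div \<alpha> radial_field (l *\<^sub>R s *\<^sub>R N :: 'a) \<partial>gauss)
        = l powr \<alpha> * (indicator {..l} (l * s) * ?E (l * s))" for s
        using l0 by (simp add: radial_profile_def indicator_def)
      then show ?thesis by (simp only: integral_mult_right_zero)
    qed
    \<comment> \<open>The factor l^\<alpha> from dilating the divergence is exactly undone by the
      homogeneity of \<open>pw \<alpha>\<close>; only the window of scales has grown from 1 to
      l.\<close>
    also have "\<dots> = (\<integral>s. indicator {..l} s * ?E s \<partial>pw \<alpha>)"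
      using l0 by (subst pw_scale(2)[OF l0, of "\<lambda>s. indicator {..l} s * ?E s"]) (simp_all add: powr_minus)
    also have "\<dots> \<ge> J"
      unfolding J_def
    proof (rule integral_mono_AE)
      show "AE s in pw \<alpha>. indicator {..1} s * ?E s \<le> indicator {..l} s * ?E s"
        using AE_pw_pos by eventually_elim (use E0 l in \<open>auto simp: indicator_def\<close>)
    qed (use Ei l in auto)
    finally show ?thesis by (simp add: l_def)
  qed
  have "real m * J \<le> (\<integral>x. bessel_bump \<alpha> x * gauss_div \<alpha> (radial_stack m) x \<partial>(lborel :: 'a measure))" for m
  proof (induction m)
    case 0
    have "gauss_div \<alpha> (radial_stack 0) x = 0" for x :: 'a by (simp add: gauss_div_def radial_stack_def)
    then show ?case by simp
  next
    case (Suc m)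
    let ?\<phi> = "\<lambda>x::'a. radial_field (2 ^ m *\<^sub>R x)"
    have C: "?\<phi> \<in> Cc_infinity"
      using Cc_infinity_affine[OF radial_field_Cc_infinity, of "2 ^ m" 0] by simp
    obtain B1 where B1: "bounded_lipschitz B1 (radial_stack m :: 'a \<Rightarrow> 'a)"
      by (rule Cc_infinity_bounded_lipschitz[OF radial_stack_Cc_infinity])
    obtain B2 where B2: "bounded_lipschitz B2 (\<lambda>x. (- 1) *\<^sub>R ?\<phi> x)"
      by (rule Cc_infinity_bounded_lipschitz[OF Cc_infinity_scaleR[OF C]])
    obtain B3 where B3: "bounded_lipschitz B3 ?\<phi>" by (rule Cc_infinity_bounded_lipschitz[OF C])
    have "gauss_div \<alpha> (radial_stack (Suc m)) x = gauss_div \<alpha> (radial_stack m) x + gauss_div \<alpha> ?\<phi> x" for x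
      unfolding radial_stack_Suc[abs_def] gauss_div_diff[OF \<alpha> B1 B2] gauss_div_scaleR by simp
    then have "(\<integral>x. bessel_bump \<alpha> x * gauss_div \<alpha> (radial_stack (Suc m)) x \<partial>(lborel :: 'a measure))
      = (\<integral>x. bessel_bump \<alpha> x * gauss_div \<alpha> (radial_stack m) x \<partial>(lborel :: 'a measure)) + (\<integral>x. bessel_bump \<alpha> x * gauss_div \<alpha> ?\<phi> x \<partial>lborel)"
      using gauss_div_mult_integrable(1)[OF \<alpha> B1 bi] gauss_div_mult_integrable(1)[OF \<alpha> B3 bi]
      by (simp add: distrib_left)
    then show ?case using Suc dil[of m] by (simp add: distrib_right)
  qed
  then show ?thesis using that[OF J] by blast
qed

section \<open>The separating function\<close>

lemma bessel_bump_in_besov: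
  assumes \<alpha>: "0 < \<alpha>" "\<alpha> < 1"
  shows "(bessel_bump \<alpha> :: real ^ 'n \<Rightarrow> real) \<in> besov_1_infty \<alpha>"
proof -
  let ?f = "bessel_bump \<alpha> :: real ^ 'n \<Rightarrow> real"
  have fi: "integrable lborel ?f" by (rule bessel_bump_integrable[OF \<alpha>])
  then have fb: "?f \<in> borel_measurable borel" by auto
  have L: "?f \<in> L1" using fi fb by (simp add: L1_def integrable_completion)
  obtain C where C: "\<forall>h::real ^ 'n. h \<noteq> 0 \<longrightarrow> (\<integral>x. \<bar>?f (x + h) - ?f x\<bar> \<partial>lborel) \<le> C * norm h powr \<alpha>"
    by (rule bessel_bump_difference_bound[OF \<alpha>])
  show ?thesis by (rule besov_1_inftyI[OF L fb _ C]) simp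
qed

lemma bessel_bump_not_in_BV_frac:
  assumes \<alpha>: "0 < \<alpha>" "\<alpha> < 1"
  shows "(bessel_bump \<alpha> :: real ^ 'n \<Rightarrow> real) \<notin> BV_frac \<alpha>"
proof
  let ?f = "bessel_bump \<alpha> :: real ^ 'n \<Rightarrow> real"
  assume "?f \<in> BV_frac \<alpha>"
  then have "frac_variation \<alpha> ?f < \<infinity>" by (simp add: BV_frac_def)
  then obtain V where V: "frac_variation \<alpha> ?f \<le> ereal V"
    by (cases "frac_variation \<alpha> ?f") (auto intro: that)
  have fi: "integrable lborel ?f" by (rule bessel_bump_integrable[OF \<alpha>])
  obtain J where J: "0 < J"
    "\<forall>m. real m * J \<le> (\<integral>x. ?f x * gauss_div \<alpha> (radial_stack m) x \<partial>lborel)"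
    by (rule bessel_bump_unbounded_pairing[OF \<alpha>])
  define \<kappa> where "\<kappa> = mu_frac CARD('n) \<alpha> / kernel_const TYPE(real ^ 'n) \<alpha>"
  have \<kappa>: "0 < \<kappa>"
    unfolding \<kappa>_def using mu_frac_pos[OF \<alpha>] kernel_const_pos[OF \<alpha>] by (rule divide_pos_pos)
  have "real m * (\<kappa> / 2 * J) \<le> V" for m
  proof -
    \<comment> \<open>The factor 1/2 compensates the uniform bound 2 on the stacked fields.\<close>
    let ?\<phi> = "\<lambda>x::real ^ 'n. (1 / 2) *\<^sub>R radial_stack m x"
    have C: "?\<phi> \<in> Cc_infinity" by (rule Cc_infinity_scaleR[OF radial_stack_Cc_infinity])
    have le1: "\<forall>x. norm (?\<phi> x) \<le> 1" by (simp add: norm_radial_stack_le)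
    obtain B where B: "bounded_lipschitz B ?\<phi>" by (rule Cc_infinity_bounded_lipschitz[OF C])
    have "?f x * div_frac \<alpha> ?\<phi> x = \<kappa> / 2 * (?f x * gauss_div \<alpha> (radial_stack m) x)" for x
      unfolding div_frac_eq_gauss_div[OF \<alpha> B] gauss_div_scaleR \<kappa>_def by simp
    then have "\<kappa> / 2 * (\<integral>x. ?f x * gauss_div \<alpha> (radial_stack m) x \<partial>lborel) = (\<integral>x. ?f x * div_frac \<alpha> ?\<phi> x \<partial>lborel)"
      by (simp only: integral_mult_right_zero)
    moreover have "(\<integral>x. ?f x * div_frac \<alpha> ?\<phi> x \<partial>lborel) \<le> V"
      by (rule frac_variation_pairing_le[OF \<alpha> fi _ V C le1]) (use fi in auto)
    moreover have "\<kappa> / 2 * (real m * J) \<le> \<kappa> / 2 * (\<integral>x. ?f x * gauss_div \<alpha> (radial_stack m) x \<partial>lborel)"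
      using J(2) \<kappa> by (intro mult_left_mono) auto
    ultimately show ?thesis by (simp add: mult_ac)
  qed
  moreover have "0 < \<kappa> / 2 * J" using \<kappa> J(1) by simp
  then obtain m where "V < real m * (\<kappa> / 2 * J)" using reals_Archimedean3 by blast
  ultimately show False by (meson not_le)
qed

theorem theoremB3:
  fixes \<alpha> :: real
  assumes "0 < \<alpha>" and "\<alpha> < 1" and "CARD('n::finite) \<ge> 2"
  shows "(BV_frac \<alpha> :: (real ^ 'n \<Rightarrow> real) set) \<subset> besov_1_infty \<alpha>"
  using BV_frac_subset_besov[OF assms(1,2)] bessel_bump_in_besov[OF assms(1,2)]
    bessel_bump_not_in_BV_frac[OF assms(1,2)] by blast

end
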